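(* Let $\mathbf{k}$ be an algebraically closed field of characteristic $p > 0$, let $q = p^\nu$ with $\nu \geq 1$ an integer, and let $X \subset \mathbf{P}^{q+1}$ be the Fermat hypersurface over $\mathbf{k}$ defined by $T_0^{q+1} + \cdots + T_{q+1}^{q+1} = 0$. Let $\varphi \colon \mathbf{P}^1 \to X$ be a nonconstant morphism over $\mathbf{k}$ of degree $e$. If $\varphi$ is free, then $e \geq q^{3/2} - q$.
   Context: The degree of $\varphi$ is the degree of the line bundle $\varphi^*\mathcal{O}_{\mathbf{P}^{q+1}}(1)$ on $\mathbf{P}^1$. The morphism $\varphi$ is free if $\mathrm{H}^1(\mathbf{P}^1, \varphi^*\mathcal{T}_X \otimes \mathcal{O}_{\mathbf{P}^1}(-1)) = 0$, where $\mathcal{T}_X$ is the tangent bundle of $X$. *)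

theory Defs
  imports "HOL-Computational_Algebra.Computational_Algebra"
begin

text \<open>
  Classical (quasi-)projective varieties over an algebraically closed field. A vector of
  \<open>k\<^sup>n\<^sup>+\<^sup>1\<close> is a function \<open>x :: nat \<Rightarrow> 'k\<close> that vanishes above \<open>n\<close>; a point of projective
  \<open>n\<close>-space is the set of nonzero vectors of a line, i.e. the set of all its tuples of
  homogeneous coordinates.
\<close>

definition proj_pt :: "(nat \<Rightarrow> 'k::field) \<Rightarrow> (nat \<Rightarrow> 'k) set" where
  "proj_pt x = {\<lambda>i. c * x i | c. c \<noteq> 0}"

definition proj_space :: "nat \<Rightarrow> (nat \<Rightarrow> 'k::field) set set" where
  "proj_space n = proj_pt ` {x. (\<forall>i>n. x i = 0) \<and> (\<exists>i\<le>n. x i \<noteq> 0)}"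

abbreviation P1 :: "(nat \<Rightarrow> 'k::field) set set" where
  "P1 \<equiv> proj_space 1"

text \<open>Homogeneous polynomials of degree \<open>d\<close> in \<open>T\<^sub>0, \<dots>, T\<^sub>n\<close>, as functions (the field is infinite).\<close>

definition form :: "nat \<Rightarrow> nat \<Rightarrow> ((nat \<Rightarrow> 'k::field) \<Rightarrow> 'k) \<Rightarrow> bool" where
  "form n d f \<longleftrightarrow> (\<exists>(A :: (nat \<Rightarrow> nat) set) c. finite A \<and> (\<forall>a\<in>A. (\<Sum>i\<le>n. a i) = d) \<and>
     f = (\<lambda>x. \<Sum>a\<in>A. c a * (\<Prod>i\<le>n. x i ^ a i)))"

text \<open>The Fermat hypersurface of degree \<open>d\<close> in projective \<open>n\<close>-space.\<close>

definition fermat :: "nat \<Rightarrow> nat \<Rightarrow> (nat \<Rightarrow> 'k::field) set set" where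
  "fermat n d = {P \<in> proj_space n. \<forall>x\<in>P. (\<Sum>i\<le>n. x i ^ d) = 0}"

text \<open>Zariski open subsets of a subset \<open>X\<close> of projective \<open>n\<close>-space.\<close>

definition zopen :: "nat \<Rightarrow> (nat \<Rightarrow> 'k::field) set set \<Rightarrow> (nat \<Rightarrow> 'k) set set \<Rightarrow> bool" where
  "zopen n X U \<longleftrightarrow>
     (\<exists>S. (\<forall>f\<in>S. \<exists>d. form n d f) \<and> U = {P \<in> X. \<exists>f\<in>S. \<exists>x\<in>P. f x \<noteq> 0})"

text \<open>
  Sections of \<open>\<O>\<^sub>X(m)\<close> over an open \<open>U\<close>: functions on the punctured cone over \<open>U\<close> that are
  locally quotients \<open>g / h\<close> of forms with \<open>deg g - deg h = m\<close> (hence homogeneous of degree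
  \<open>m\<close>). Values off the cone are irrelevant. For \<open>m = 0\<close> these descend to functions of points,
  the regular functions on \<open>U\<close>.
\<close>

definition twist_section ::
    "nat \<Rightarrow> (nat \<Rightarrow> 'k::field) set set \<Rightarrow> int \<Rightarrow> (nat \<Rightarrow> 'k) set set \<Rightarrow> ((nat \<Rightarrow> 'k) \<Rightarrow> 'k) \<Rightarrow> bool" where
  "twist_section n X m U s \<longleftrightarrow>
     (\<forall>P\<in>U. \<exists>V g h d d'. zopen n X V \<and> P \<in> V \<and> V \<subseteq> U \<and>
        form n d g \<and> form n d' h \<and> int d = int d' + m \<and>
        (\<forall>Q\<in>V. \<forall>x\<in>Q. h x \<noteq> 0 \<and> s x = g x / h x))"

definition regular ::
    "nat \<Rightarrow> (nat \<Rightarrow> 'k::field) set set \<Rightarrow> (nat \<Rightarrow> 'k) set set \<Rightarrow> ((nat \<Rightarrow> 'k) set \<Rightarrow> 'k) \<Rightarrow> bool" where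
  "regular n X U f \<longleftrightarrow> twist_section n X 0 U (\<lambda>x. f (proj_pt x))"

definition preimage ::
    "((nat \<Rightarrow> 'k::field) set \<Rightarrow> (nat \<Rightarrow> 'k) set) \<Rightarrow> (nat \<Rightarrow> 'k) set set \<Rightarrow> (nat \<Rightarrow> 'k) set set" where
  "preimage \<phi> W = {Q \<in> P1. \<phi> Q \<in> W}"

text \<open>Morphisms of varieties from the projective line to \<open>X\<close>; only the values on \<open>P1\<close> matter.\<close>

definition is_morphism ::
    "nat \<Rightarrow> (nat \<Rightarrow> 'k::field) set set \<Rightarrow> ((nat \<Rightarrow> 'k) set \<Rightarrow> (nat \<Rightarrow> 'k) set) \<Rightarrow> bool" where
  "is_morphism n X \<phi> \<longleftrightarrow> \<phi> ` P1 \<subseteq> X \<and>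
     (\<forall>W. zopen n X W \<longrightarrow> zopen 1 P1 (preimage \<phi> W) \<and>
        (\<forall>f. regular n X W f \<longrightarrow> regular 1 P1 (preimage \<phi> W) (f \<circ> \<phi>)))"

text \<open>
  The order of vanishing at \<open>Q\<close> of the global section \<open>\<phi>\<^sup>*l\<close> of \<open>\<phi>\<^sup>*\<O>(1)\<close>, for a linear form
  \<open>l\<close>. Near \<open>Q\<close> the bundle is trivialised by \<open>\<phi>\<^sup>*h\<close> for a linear form \<open>h\<close>, and the linear form
  \<open>x\<^sub>0 y\<^sub>1 - x\<^sub>1 y\<^sub>0\<close>, where \<open>y\<close> represents \<open>Q\<close>, has a simple zero at \<open>Q\<close>; so the order is the
  \<open>m\<close> for which \<open>\<phi>\<^sup>*(l/h)\<close> is its \<open>m\<close>-th power times a nowhere vanishing section of \<open>\<O>(-m)\<close>.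
\<close>

definition vanishing_order ::
    "nat \<Rightarrow> ((nat \<Rightarrow> 'k::field) set \<Rightarrow> (nat \<Rightarrow> 'k) set) \<Rightarrow> ((nat \<Rightarrow> 'k) \<Rightarrow> 'k) \<Rightarrow> (nat \<Rightarrow> 'k) set \<Rightarrow> nat" where
  "vanishing_order n \<phi> l Q = (THE m. \<exists>h V u y.
     form n 1 h \<and> zopen 1 P1 V \<and> Q \<in> V \<and> y \<in> Q \<and> twist_section 1 P1 (- int m) V u \<and>
     (\<forall>R\<in>V. \<forall>x\<in>R. u x \<noteq> 0 \<and>
        (\<forall>z\<in>\<phi> R. h z \<noteq> 0 \<and> l z / h z = (x 0 * y 1 - x 1 * y 0) ^ m * u x)))"

text \<open>
  The degree of \<open>\<phi>\<^sup>*\<O>(1)\<close>, i.e. the degree of the divisor of any nonzero section; we use the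
  sections \<open>\<phi>\<^sup>*l\<close> for linear forms \<open>l\<close> not vanishing identically on the image of \<open>\<phi>\<close>. The sum
  ranges over the finitely many zeros of such a section.
\<close>

definition has_degree ::
    "nat \<Rightarrow> ((nat \<Rightarrow> 'k::field) set \<Rightarrow> (nat \<Rightarrow> 'k) set) \<Rightarrow> nat \<Rightarrow> bool" where
  "has_degree n \<phi> e \<longleftrightarrow> (\<exists>l. form n 1 l \<and> (\<exists>Q\<in>P1. \<exists>z\<in>\<phi> Q. l z \<noteq> 0) \<and>
     e = (\<Sum>Q\<in>{Q \<in> P1. \<forall>z\<in>\<phi> Q. l z = 0}. vanishing_order n \<phi> l Q))"

text \<open>
  Sections over an open \<open>V\<close> of the projective line of \<open>\<phi>\<^sup>*T\<^sub>X \<otimes> \<O>(m)\<close>, where \<open>T\<^sub>X\<close> is the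
  sheaf of \<open>k\<close>-derivations of \<open>\<O>\<^sub>X\<close> and \<open>X\<close> is smooth. As \<open>T\<^sub>X\<close> is the dual of the locally free
  sheaf \<open>\<Omega>\<^sub>X\<close>, this is \<open>Hom(\<phi>\<^sup>*\<Omega>\<^sub>X, \<O>(m))\<close>, whose sections over \<open>V\<close> are by adjunction the
  \<open>k\<close>-derivations \<open>\<O>\<^sub>X \<rightarrow> (\<phi>|\<^sub>V)\<^sub>*\<O>\<^sub>V(m)\<close>. Such a derivation is given by maps
  \<open>D W : \<O>\<^sub>X(W) \<rightarrow> \<O>(m)(V \<inter> \<phi>\<^sup>-\<^sup>1 W)\<close>. The condition on pairs \<open>W' \<subseteq> W\<close> says that they
  commute with restriction and (for \<open>W' = W\<close>) that \<open>D W f\<close> depends only on the values of \<open>f\<close>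
  on \<open>W\<close>.
\<close>

type_synonym 'k tsection =
  "(nat \<Rightarrow> 'k) set set \<Rightarrow> ((nat \<Rightarrow> 'k) set \<Rightarrow> 'k) \<Rightarrow> (nat \<Rightarrow> 'k) \<Rightarrow> 'k"

definition tangent_section ::
    "nat \<Rightarrow> (nat \<Rightarrow> 'k::field) set set \<Rightarrow> ((nat \<Rightarrow> 'k) set \<Rightarrow> (nat \<Rightarrow> 'k) set) \<Rightarrow> int \<Rightarrow>
     (nat \<Rightarrow> 'k) set set \<Rightarrow> 'k tsection \<Rightarrow> bool" where
  "tangent_section n X \<phi> m V D \<longleftrightarrow>
     (\<forall>W f. zopen n X W \<and> regular n X W f \<longrightarrow>
        twist_section 1 P1 m (V \<inter> preimage \<phi> W) (D W f)) \<and>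
     (\<forall>W W' f f'. zopen n X W \<and> zopen n X W' \<and> W' \<subseteq> W \<and>
        regular n X W f \<and> regular n X W' f' \<and> (\<forall>P\<in>W'. f P = f' P) \<longrightarrow>
        (\<forall>Q \<in> V \<inter> preimage \<phi> W'. \<forall>x\<in>Q. D W f x = D W' f' x)) \<and>
     (\<forall>W f g. zopen n X W \<and> regular n X W f \<and> regular n X W g \<longrightarrow>
        (\<forall>Q \<in> V \<inter> preimage \<phi> W. \<forall>x\<in>Q.
           (\<forall>c. D W (\<lambda>P. c * f P) x = c * D W f x) \<and>
           D W (\<lambda>P. f P + g P) x = D W f x + D W g x \<and>
           D W (\<lambda>P. f P * g P) x = f (\<phi> Q) * D W g x + g (\<phi> Q) * D W f x))"

definition tsection_eq ::
    "nat \<Rightarrow> (nat \<Rightarrow> 'k::field) set set \<Rightarrow> ((nat \<Rightarrow> 'k) set \<Rightarrow> (nat \<Rightarrow> 'k) set) \<Rightarrow>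
     (nat \<Rightarrow> 'k) set set \<Rightarrow> 'k tsection \<Rightarrow> 'k tsection \<Rightarrow> bool" where
  "tsection_eq n X \<phi> V D D' \<longleftrightarrow>
     (\<forall>W f. zopen n X W \<and> regular n X W f \<longrightarrow>
        (\<forall>Q \<in> V \<inter> preimage \<phi> W. \<forall>x\<in>Q. D W f x = D' W f x))"

text \<open>
  Vanishing of \<open>H\<^sup>1\<close> of \<open>\<phi>\<^sup>*T\<^sub>X \<otimes> \<O>(m)\<close>. For any sheaf, \<open>H\<^sup>1\<close> is the direct limit of the
  Cech groups of open covers, and the Cech \<open>H\<^sup>1\<close> of each cover injects into it; so \<open>H\<^sup>1 = 0\<close>
  means that every Cech 1-cocycle on every open cover is a coboundary.
\<close>

definition H1_tangent_zero ::
    "nat \<Rightarrow> (nat \<Rightarrow> 'k::field) set set \<Rightarrow> ((nat \<Rightarrow> 'k) set \<Rightarrow> (nat \<Rightarrow> 'k) set) \<Rightarrow> int \<Rightarrow> bool" where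
  "H1_tangent_zero n X \<phi> m \<longleftrightarrow>
     (\<forall>\<U> c. (\<forall>U\<in>\<U>. zopen 1 P1 U) \<and> \<Union>\<U> = P1 \<and>
        (\<forall>U\<in>\<U>. \<forall>V\<in>\<U>. tangent_section n X \<phi> m (U \<inter> V) (c U V)) \<and>
        (\<forall>U\<in>\<U>. \<forall>V\<in>\<U>. \<forall>T\<in>\<U>. tsection_eq n X \<phi> (U \<inter> V \<inter> T)
           (c U T) (\<lambda>W f x. c U V W f x + c V T W f x)) \<longrightarrow>
        (\<exists>b. (\<forall>U\<in>\<U>. tangent_section n X \<phi> m U (b U)) \<and>
             (\<forall>U\<in>\<U>. \<forall>V\<in>\<U>. tsection_eq n X \<phi> (U \<inter> V)
                (c U V) (\<lambda>W f x. b V W f x - b U W f x))))"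

definition free_morphism ::
    "nat \<Rightarrow> (nat \<Rightarrow> 'k::field) set set \<Rightarrow> ((nat \<Rightarrow> 'k) set \<Rightarrow> (nat \<Rightarrow> 'k) set) \<Rightarrow> bool" where
  "free_morphism n X \<phi> \<longleftrightarrow> H1_tangent_zero n X \<phi> (- 1)"

end

(*
  Write phi = [f_0 : ... : f_n] with n = q + 1 and f_i binary forms of degree d without common
  zero; then d = e. As the equation of X has differential sum T_i^q dT_i, freeness means that
  (f_0^q, ..., f_n^q) generates all forms of degree (q+1)d - 1. Let d = q m + r with r < q, and
  split polynomials as P = sum_{b<q} t^b (P_b)^q. Comparing components of t^(q-1) g^q shows that
  every polynomial g of degree < d + m is sum f_i w_i with deg w_i < m.
  The equation sum f_i^q f_i = 0 makes each tuple ((f_i)_b)_i a syzygy of f, of degree at most m,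
  and less than m if b > r. By the above, the syzygies of degree < m form a space of dimension
  (q+2)m - (d+m) = m - r. Hence all f_i lie in the span of (r + 1) + (m - r) = m + 1 polynomials
  times q-th powers of polynomials of degree at most m, which has dimension at most (m+1)^2. As
  the products of the f_i with polynomials of degree < m generate a space of dimension d + m, this
  gives d + m <= (m+1)^2 m, so q < (m+1)^2, and d >= q m > q (sqrt q - 1).
*)
theory Submission
  imports Defs
begin

text \<open>Freeness is turned into generation by explicit cochains. Where a linear form l(f) has no
  zero, a form F of degree (q+1)d - 1 has an obvious lift along (f_i^q), because l^q is a
  combination of the T_i^q with constant coefficients. Two such lifts differ by a vector tangent to
  the cone over X, and differentiating regular functions along it gives a Cech cocycle of phi^* T_X
  (-1). A cochain bounding it corrects the lifts, but only up to multiples of the Euler vector f;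
  the multiplier is a section of O(-1) on the overlap and splits, since H^1(O(-1)) = 0. The
  corrected lifts glue to polynomials z_i of degree at most d - 1 with F = sum f_i^q z_i. The twist
  by -1 makes this degree just small enough: the component of index q - 1 of such a z_i has degree
  less than m. The map from P to P_b is additive but takes scalars to their q-th roots. Hence linear
  relations among the components reappear with q-th powers of their coefficients when the f_i are
  put together again.\<close>

lemma infinite_alg_closed_field: "infinite (UNIV :: 'k::alg_closed_field set)"
proof
  assume fin: "finite (UNIV :: 'k set)"
  \<comment> \<open>On a finite field this polynomial takes the value 1 everywhere, so it has no
    root.\<close>
  define p :: "'k poly" where "p = (\<Prod>a\<in>UNIV. [:- a, 1:]) + 1"
  have "degree (\<Prod>a\<in>(UNIV :: 'k set). [:- a, 1:]) = card (UNIV :: 'k set)"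
    by (subst degree_prod_eq_sum_degree) auto
  moreover have "card (UNIV :: 'k set) > 0"
    using fin by (simp add: finite_UNIV_card_ge_0)
  ultimately have "degree p > 0"
    unfolding p_def by (simp add: degree_add_eq_left)
  then obtain x where "poly p x = 0"
    using alg_closed_imp_poly_has_root by blast
  moreover have "poly p x = 1"
    using fin by (auto simp: p_def poly_prod intro!: prod_zero)
  ultimately show False by simp
qed

text \<open>The difference would have infinitely many roots. Identities between rational expressions
  are checked through this away from the finitely many zeros of the denominators.\<close>

lemma poly_eqI_cofinite:
  fixes p q :: "'k::alg_closed_field poly"
  assumes "finite S" "\<And>t. t \<notin> S \<Longrightarrow> poly p t = poly q t"
  shows "p = q"
proof (rule ccontr)
  assume "p \<noteq> q"
  then have "finite {x. poly (p - q) x = 0}"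
    by (intro poly_roots_finite) simp
  moreover have "UNIV \<subseteq> {x. poly (p - q) x = 0} \<union> S"
    using assms(2) by auto
  ultimately show False
    using assms(1) infinite_alg_closed_field by (metis finite_UnI finite_subset)
qed

lemma poly_eqI_infinite_field:
  fixes p q :: "'k::alg_closed_field poly"
  assumes "\<And>t. poly p t = poly q t"
  shows "p = q"
  using poly_eqI_cofinite[of "{}"] assms by blast

subsection \<open>Forms\<close>

lemma form_zero: "form n d (\<lambda>x. 0)"
  unfolding form_def by (intro exI[of _ "{}"]) auto

lemma form_const: "form n 0 (\<lambda>x. c)"
  unfolding form_def
  by (rule exI[of _ "{\<lambda>_. 0}"], rule exI[of _ "\<lambda>_. c"]) auto

lemma form_add:
  assumes "form n d f" "form n d g"
  shows "form n d (\<lambda>x. f x + g x)"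
proof -
  obtain A c where A: "finite A" "\<forall>a\<in>A. (\<Sum>i\<le>n. a i) = d"
    "f = (\<lambda>x. \<Sum>a\<in>A. c a * (\<Prod>i\<le>n. x i ^ a i))"
    using assms(1) unfolding form_def by blast
  obtain B c' where B: "finite B" "\<forall>a\<in>B. (\<Sum>i\<le>n. a i) = d"
    "g = (\<lambda>x. \<Sum>a\<in>B. c' a * (\<Prod>i\<le>n. x i ^ a i))"
    using assms(2) unfolding form_def by blast
  let ?c = "\<lambda>a. (if a \<in> A then c a else 0) + (if a \<in> B then c' a else 0)"
  have 1: "(\<Sum>a\<in>A. c a * m a) = (\<Sum>a\<in>A \<union> B. (if a \<in> A then c a else 0) * m a)" for m :: "_ \<Rightarrow> 'a"
    using A(1) B(1) by (intro sum.mono_neutral_cong_left) auto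
  have 2: "(\<Sum>a\<in>B. c' a * m a) = (\<Sum>a\<in>A \<union> B. (if a \<in> B then c' a else 0) * m a)" for m :: "_ \<Rightarrow> 'a"
    using A(1) B(1) by (intro sum.mono_neutral_cong_left) auto
  have "(\<lambda>x. f x + g x) = (\<lambda>x. \<Sum>a\<in>A \<union> B. ?c a * (\<Prod>i\<le>n. x i ^ a i))"
    unfolding A(3) B(3) 1 2 by (simp add: sum.distrib distrib_right)
  then show ?thesis
    unfolding form_def using A B by (intro exI[of _ "A \<union> B"] exI[of _ ?c]) auto
qed

lemma form_sum:
  assumes "\<And>i. i \<in> I \<Longrightarrow> form n d (f i)"
  shows "form n d (\<lambda>x. \<Sum>i\<in>I. f i x)"
  using assms
proof (induction I rule: infinite_finite_induct)
  case (insert i I)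
  then show ?case using form_add[of n d "f i" "\<lambda>x. \<Sum>i\<in>I. f i x"] by simp
qed (simp_all add: form_zero)

lemma form_var_mult:
  assumes "i \<le> n" "form n d f"
  shows "form n (Suc d) (\<lambda>x. x i * f x)"
proof -
  obtain A c where A: "finite A" "\<forall>a\<in>A. (\<Sum>i\<le>n. a i) = d"
    "f = (\<lambda>x. \<Sum>a\<in>A. c a * (\<Prod>i\<le>n. x i ^ a i))"
    using assms(2) unfolding form_def by blast
  define s :: "(nat \<Rightarrow> nat) \<Rightarrow> nat \<Rightarrow> nat" where "s = (\<lambda>a. a(i := Suc (a i)))"
  \<comment> \<open>A left inverse of the shift \<open>s\<close> of exponents: it gives injectivity
    and carries the coefficients over to the shifted exponents.\<close>
  define s' :: "(nat \<Rightarrow> nat) \<Rightarrow> nat \<Rightarrow> nat" where "s' = (\<lambda>a. a(i := a i - 1))"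
  have ss: "s' (s a) = a" for a by (auto simp: s_def s'_def)
  have inj: "inj_on s A" by (metis ss inj_onI)
  have i: "finite {..n}" "i \<in> {..n}" using assms(1) by auto
  have sum: "(\<Sum>j\<le>n. s a j) = Suc (\<Sum>j\<le>n. a j)" for a
    unfolding sum.remove[OF i] by (simp add: s_def)
  have prod: "(\<Prod>j\<le>n. x j ^ s a j) = x i * (\<Prod>j\<le>n. x j ^ a j)" for a and x :: "nat \<Rightarrow> 'a"
    unfolding prod.remove[OF i] by (simp add: s_def mult.assoc)
  have "(\<lambda>x. x i * f x) = (\<lambda>x. \<Sum>a\<in>s ` A. c (s' a) * (\<Prod>j\<le>n. x j ^ a j))"
    unfolding A(3) by (simp add: sum.reindex[OF inj] ss prod sum_distrib_left algebra_simps)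
  then show ?thesis
    unfolding form_def using A sum
    by (intro exI[of _ "s ` A"] exI[of _ "c \<circ> s'"]) auto
qed

text \<open>Peeling one variable off each monomial reduces sums over exponent vectors to four
  closure properties. The zero function has a case of its own because it is a form of every degree,
  while constants have degree 0.\<close>

lemma form_induct [consumes 1, case_names zero const var_mult add]:
  assumes "form n d f"
    and zero: "\<And>d. P d (\<lambda>x. 0)"
    and const: "\<And>c. P 0 (\<lambda>x. c)"
    and vm: "\<And>i d f. i \<le> n \<Longrightarrow> form n d f \<Longrightarrow> P d f \<Longrightarrow> P (Suc d) (\<lambda>x. x i * f x)"
    and add: "\<And>d f g. form n d f \<Longrightarrow> form n d g \<Longrightarrow> P d f \<Longrightarrow> P d g \<Longrightarrow> P d (\<lambda>x. f x + g x)"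
  shows "P d f"
proof -
  have mon: "form n e (\<lambda>x. c * (\<Prod>i\<le>n. x i ^ a i)) \<and> P e (\<lambda>x. c * (\<Prod>i\<le>n. x i ^ a i))"
    if "(\<Sum>i\<le>n. a i) = e" for a c e
    using that
  proof (induction e arbitrary: a)
    case 0
    then show ?case using const form_const by simp
  next
    case (Suc e)
    then have "(\<Sum>i\<le>n. a i) \<noteq> 0" by simp
    then obtain i where i: "i \<le> n" "a i \<noteq> 0" by auto
    define b where "b = a(i := a i - 1)"
    have i': "finite {..n}" "i \<in> {..n}" using i by auto
    have eq: "Suc (\<Sum>j\<le>n. b j) = (\<Sum>j\<le>n. a j)"
      unfolding sum.remove[OF i'] using i by (simp add: b_def)
    have prod: "c * (\<Prod>j\<le>n. x j ^ a j) = x i * (c * (\<Prod>j\<le>n. x j ^ b j))" for x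
      unfolding prod.remove[OF i'] using i
      by (simp add: b_def power_eq_if[of _ "a i"] algebra_simps)
    from eq Suc.prems have "(\<Sum>j\<le>n. b j) = e" by simp
    from Suc.IH[OF this] show ?case
      unfolding prod using i form_var_mult[of i n] vm by blast
  qed
  obtain A c where A: "finite A" "\<forall>a\<in>A. (\<Sum>i\<le>n. a i) = d"
    "f = (\<lambda>x. \<Sum>a\<in>A. c a * (\<Prod>i\<le>n. x i ^ a i))"
    using assms(1) unfolding form_def by blast
  have "form n d (\<lambda>x. \<Sum>a\<in>A. c a * (\<Prod>i\<le>n. x i ^ a i)) \<and>
        P d (\<lambda>x. \<Sum>a\<in>A. c a * (\<Prod>i\<le>n. x i ^ a i))"
    using A(1,2)
  proof (induction A rule: finite_induct)
    case empty
    then show ?case by (simp add: zero form_zero)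
  next
    case (insert a A)
    then show ?case using mon[of a d "c a"]
      by (simp add: form_add add)
  qed
  then show ?thesis using A(3) by simp
qed

lemma form_mult:
  assumes "form n d f" "form n d' g"
  shows "form n (d + d') (\<lambda>x. f x * g x)"
  using assms(1)
proof (induction rule: form_induct)
  case (const c)
  show ?case using assms(2)
  proof (induction rule: form_induct)
    case (var_mult i d f)
    then show ?case using form_var_mult[OF var_mult(1) var_mult(3)]
      by (simp add: algebra_simps)
  next
    case (add d f g)
    then show ?case using form_add[OF add(3,4)] by (simp add: algebra_simps)
  qed (simp_all add: form_zero form_const)
next
  case (var_mult i d f)
  then show ?case using form_var_mult[OF var_mult(1) var_mult(3)]
    by (simp add: algebra_simps)
next
  case (add d f g)
  then show ?case using form_add[OF add(3,4)] by (simp add: algebra_simps)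
qed (simp_all add: form_zero)

lemma form_scale: "form n d f \<Longrightarrow> form n d (\<lambda>x. c * f x)"
  using form_mult[OF form_const[of n c], of d f] by simp

lemma form_diff: "form n d f \<Longrightarrow> form n d g \<Longrightarrow> form n d (\<lambda>x. f x - g x)"
  using form_add[of n d f "\<lambda>x. (-1) * g x"] form_scale[of n d g "-1"] by simp

lemma form_power: "form n d f \<Longrightarrow> form n (k * d) (\<lambda>x. f x ^ k)"
proof (induction k)
  case 0
  then show ?case using form_const[of n 1] by simp
next
  case (Suc k)
  then show ?case using form_mult[of n d f "k * d"] by simp
qed

lemma form_prod:
  "finite I \<Longrightarrow> (\<And>i. i \<in> I \<Longrightarrow> form n (d i) (f i)) \<Longrightarrow> form n (\<Sum>i\<in>I. d i) (\<lambda>x. \<Prod>i\<in>I. f i x)"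
proof (induction I rule: finite_induct)
  case empty
  then show ?case using form_const[of n 1] by simp
next
  case (insert i I)
  then show ?case using form_mult[of n "d i" "f i"] by simp
qed

lemma form_var: "i \<le> n \<Longrightarrow> form n 1 (\<lambda>x. x i)"
  using form_var_mult[OF _ form_const[of n 1], of i] by simp

lemma form_linear: "form n 1 (\<lambda>x. \<Sum>i\<le>n. l i * x i)"
  by (intro form_sum form_scale form_var) auto

lemma form_homogeneous: "form n d f \<Longrightarrow> f (\<lambda>i. c * x i) = c ^ d * f x"
  by (induction rule: form_induct) (simp_all add: algebra_simps)

lemma form_comp:
  assumes "form n d g" "\<And>i. i \<le> n \<Longrightarrow> form m e (\<lambda>x. F x i)"
  shows "form m (d * e) (\<lambda>x. g (F x))"
  using assms(1)
proof (induction rule: form_induct)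
  case (zero d)
  show ?case by (rule form_zero)
next
  case (const c)
  show ?case using form_const[of m c] by simp
next
  case (var_mult i d f)
  then show ?case using form_mult[OF assms(2)[OF var_mult(1)] var_mult(3)] by simp
next
  case (add d f g)
  then show ?case using form_add by blast
qed

subsection \<open>Directional derivatives of forms\<close>

text \<open>The coefficient of t in g(z + t v). Forms are functions here, so the polynomial in t has
  to be recovered from its values; it is unique because the field is infinite.\<close>

definition dderiv :: "((nat \<Rightarrow> 'k::alg_closed_field) \<Rightarrow> 'k) \<Rightarrow> (nat \<Rightarrow> 'k) \<Rightarrow> (nat \<Rightarrow> 'k) \<Rightarrow> 'k" where
  "dderiv g z v = coeff (THE p. \<forall>t. poly p t = g (\<lambda>i. z i + t * v i)) 1"

lemma dderiv_eq:
  assumes "\<And>t. poly p t = g (\<lambda>i. z i + t * v i)"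
  shows "dderiv g z v = coeff p 1"
proof -
  have "(THE p. \<forall>t. poly p t = g (\<lambda>i. z i + t * v i)) = p"
    by (rule the_equality) (use assms in \<open>auto intro!: poly_eqI_infinite_field\<close>)
  then show ?thesis by (simp add: dderiv_def)
qed

lemma form_poly_along_line:
  fixes g :: "(nat \<Rightarrow> 'k::alg_closed_field) \<Rightarrow> 'k"
  assumes "form n d g"
  obtains p where "\<And>t. poly p t = g (\<lambda>i. z i + t * v i)"
proof -
  have "\<exists>p. \<forall>t. poly p t = g (\<lambda>i. z i + t * v i)" using assms
  proof (induction rule: form_induct)
    case (zero d)
    show ?case by (intro exI[of _ 0]) simp
  next
    case (const c)
    show ?case by (intro exI[of _ "[:c:]"]) simp
  next
    case (var_mult i d f)
    then obtain p where "\<forall>t. poly p t = f (\<lambda>i. z i + t * v i)" by blast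
    then show ?case by (intro exI[of _ "[:z i, v i:] * p"]) (simp add: algebra_simps)
  next
    case (add d f g)
    then obtain p p' where "\<forall>t. poly p t = f (\<lambda>i. z i + t * v i)" "\<forall>t. poly p' t = g (\<lambda>i. z i + t * v i)"
      by blast
    then show ?case by (intro exI[of _ "p + p'"]) simp
  qed
  then show ?thesis using that by blast
qed

lemma coeff_0_along_line:
  fixes p :: "'k::alg_closed_field poly"
  assumes "\<And>t. poly p t = g (\<lambda>i. z i + t * v i)"
  shows "coeff p 0 = g z"
  using assms[of 0] by (simp add: poly_0_coeff_0)

lemma coeff_1_mult: "coeff (p * q) 1 = coeff p 0 * coeff q 1 + coeff p 1 * coeff q 0"
  for p q :: "'k::comm_semiring_1 poly"
  by (simp add: coeff_mult)

lemma dderiv_const [simp]: "dderiv (\<lambda>x. c) z v = 0"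
  using dderiv_eq[of "[:c:]" "\<lambda>x. c"] by simp

lemma dderiv_var [simp]: "dderiv (\<lambda>x. x i) z v = v i"
  using dderiv_eq[of "[:z i, v i:]" "\<lambda>x. x i"] by simp

lemma dderiv_mult:
  assumes "form n d f" "form n d' g"
  shows "dderiv (\<lambda>x. f x * g x) z v = f z * dderiv g z v + g z * dderiv f z v"
proof -
  obtain p where p: "\<And>t. poly p t = f (\<lambda>i. z i + t * v i)" using form_poly_along_line[OF assms(1)] by blast
  obtain r where r: "\<And>t. poly r t = g (\<lambda>i. z i + t * v i)" using form_poly_along_line[OF assms(2)] by blast
  have "dderiv (\<lambda>x. f x * g x) z v = coeff (p * r) 1" by (rule dderiv_eq) (simp add: p r)
  then show ?thesis
    using dderiv_eq[OF p] dderiv_eq[OF r] coeff_0_along_line[OF p] coeff_0_along_line[OF r]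
    unfolding coeff_1_mult by (simp add: mult.commute)
qed

lemma dderiv_add:
  assumes "form n d f" "form n d' g"
  shows "dderiv (\<lambda>x. f x + g x) z v = dderiv f z v + dderiv g z v"
proof -
  obtain p where p: "\<And>t. poly p t = f (\<lambda>i. z i + t * v i)" using form_poly_along_line[OF assms(1)] by blast
  obtain r where r: "\<And>t. poly r t = g (\<lambda>i. z i + t * v i)" using form_poly_along_line[OF assms(2)] by blast
  have "dderiv (\<lambda>x. f x + g x) z v = coeff (p + r) 1" by (rule dderiv_eq) (simp add: p r)
  then show ?thesis
    using dderiv_eq[OF p] dderiv_eq[OF r] by simp
qed

lemma dderiv_scale:
  assumes "form n d f"
  shows "dderiv (\<lambda>x. c * f x) z v = c * dderiv f z v"
  using dderiv_mult[OF form_const assms] by simp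

lemma dderiv_diff:
  assumes "form n d f" "form n d' g"
  shows "dderiv (\<lambda>x. f x - g x) z v = dderiv f z v - dderiv g z v"
  using dderiv_add[OF assms(1) form_scale[OF assms(2), of "-1"]] dderiv_scale[OF assms(2), of "-1"]
  by simp

lemma dderiv_combine:
  assumes "form n d g"
  shows "dderiv g z (\<lambda>i. a * v i + b * w i) = a * dderiv g z v + b * dderiv g z w"
  using assms
proof (induction rule: form_induct)
  case (var_mult i d f)
  show ?case
    unfolding dderiv_mult[OF form_var[OF var_mult(1)] var_mult(2)] var_mult(3)
    by (simp add: algebra_simps)
next
  case (add d f g)
  show ?case
    unfolding dderiv_add[OF add(1,2)] add(3,4) by (simp add: algebra_simps)
qed simp_all

text \<open>The expected degree is (d - 1) e + e'; it is written additively as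
  \<open>N + e = d * e + e'\<close> to avoid subtraction of naturals.\<close>

lemma form_dderiv_comp:
  assumes "form n d g" "\<And>i. i \<le> n \<Longrightarrow> form m e (\<lambda>x. F x i)" "\<And>i. i \<le> n \<Longrightarrow> form m e' (\<lambda>x. w x i)"
    and "N + e = d * e + e'"
  shows "form m N (\<lambda>x. dderiv g (F x) (w x))"
  using assms(1,4)
proof (induction arbitrary: N rule: form_induct)
  case (zero d)
  show ?case by (simp add: form_zero)
next
  case (const c)
  show ?case by (simp add: form_zero)
next
  case (var_mult i d f)
  have N: "N = d * e + e'" using var_mult by simp
  have 1: "form m N (\<lambda>x. f (F x) * w x i)"
    unfolding N by (rule form_mult[OF form_comp[OF var_mult(2) assms(2)] assms(3)[OF var_mult(1)]])
  have 2: "form m N (\<lambda>x. F x i * dderiv f (F x) (w x))"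
  proof (cases "d = 0")
    \<comment> \<open>For \<open>d = 0\<close> the difference \<open>N - e\<close> may be truncated,
      so the induction hypothesis does not apply; but a form of degree 0 is constant and this term
      vanishes.\<close>
    case True
    then have "dderiv f (F x) (w x) = 0" for x
    proof -
      have "f = (\<lambda>_. f (\<lambda>_. 0))"
      proof
        fix y
        have "f (\<lambda>i. 0 * y i) = 0 ^ d * f y" by (rule form_homogeneous[OF var_mult(2)])
        with True show "f y = f (\<lambda>_. 0)" by simp
      qed
      then show ?thesis using dderiv_const by metis
    qed
    then show ?thesis by (simp add: form_zero)
  next
    case False
    then have "N \<ge> e" unfolding N by (cases d) auto
    then have "form m (N - e) (\<lambda>x. dderiv f (F x) (w x))"
      by (intro var_mult(3)) (simp add: N)
    from form_mult[OF assms(2)[OF var_mult(1)] this] show ?thesis using \<open>N \<ge> e\<close> by simp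
  qed
  show ?case
    unfolding dderiv_mult[OF form_var[OF var_mult(1)] var_mult(2)]
    using form_add[OF 2 1] by simp
next
  case (add d f g)
  show ?case
    unfolding dderiv_add[OF add(1,2)] using add(3,4)[OF add(5)] by (rule form_add)
qed

subsection \<open>Points and open sets\<close>

lemma proj_pt_refl: "x \<in> proj_pt x"
  unfolding proj_pt_def by (auto intro: exI[of _ 1])

lemma proj_ptE:
  assumes "y \<in> proj_pt x"
  obtains c where "c \<noteq> 0" "y = (\<lambda>i. c * x i)"
  using assms unfolding proj_pt_def by blast

lemma proj_pt_scale:
  fixes x :: "nat \<Rightarrow> 'k::field"
  assumes "c \<noteq> 0"
  shows "proj_pt (\<lambda>i. c * x i) = proj_pt x"
proof (intro equalityI subsetI)
  fix y :: "nat \<Rightarrow> 'k" assume "y \<in> proj_pt (\<lambda>i. c * x i)"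
  then obtain d where "d \<noteq> 0" "y = (\<lambda>i. d * (c * x i))" by (rule proj_ptE)
  then show "y \<in> proj_pt x" unfolding proj_pt_def using assms
    by (auto intro!: exI[of _ "d * c"] simp: mult.assoc)
next
  fix y assume "y \<in> proj_pt x"
  then obtain d where "d \<noteq> 0" "y = (\<lambda>i. d * x i)" by (rule proj_ptE)
  then show "y \<in> proj_pt (\<lambda>i. c * x i)" unfolding proj_pt_def using assms
    by (auto intro!: exI[of _ "d / c"])
qed

lemma proj_pt_eqI_proportional:
  fixes x y :: "nat \<Rightarrow> 'k::field"
  assumes "\<forall>i>n. x i = 0" "\<forall>i>n. y i = 0" "x i0 \<noteq> 0" "y i1 \<noteq> 0"
    and "\<And>i j. i \<le> n \<Longrightarrow> j \<le> n \<Longrightarrow> x i * y j = x j * y i"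
  shows "proj_pt x = proj_pt y"
proof -
  have n: "i0 \<le> n" "i1 \<le> n"
    by (rule ccontr, use assms(1,3) in simp) (rule ccontr, use assms(2,4) in simp)
  have eq: "x i0 * y i1 = x i1 * y i0" by (rule assms(5)[OF n])
  have nz: "y i0 \<noteq> 0"
  proof
    assume "y i0 = 0"
    with eq have "x i0 * y i1 = 0" by simp
    with assms(3,4) show False by simp
  qed
  define c where "c = x i0 / y i0"
  have "x i = c * y i" for i
  proof (cases "i \<le> n")
    case True
    from assms(5)[OF this n(1)] show ?thesis using nz unfolding c_def
      by (simp add: nonzero_eq_divide_eq)
  qed (use assms(1,2) in simp)
  then have "x = (\<lambda>i. c * y i)" by (rule ext)
  moreover have "c \<noteq> 0" using assms(3) nz unfolding c_def by simp
  ultimately show ?thesis using proj_pt_scale[of c y] by simp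
qed

lemma proj_spaceD:
  assumes "P \<in> proj_space n" "x \<in> P"
  shows "P = proj_pt x" "\<forall>i>n. x i = 0" "\<exists>i\<le>n. x i \<noteq> 0"
proof -
  obtain y where y: "P = proj_pt y" "\<forall>i>n. y i = 0" "\<exists>i\<le>n. y i \<noteq> 0"
    using assms(1) unfolding proj_space_def by blast
  obtain c where c: "c \<noteq> 0" "x = (\<lambda>i. c * y i)"
    using assms(2) unfolding y(1) by (rule proj_ptE)
  show "P = proj_pt x" using proj_pt_scale[OF c(1)] c(2) y(1) by simp
  show "\<forall>i>n. x i = 0" "\<exists>i\<le>n. x i \<noteq> 0" using y c by auto
qed

lemma proj_spaceI: "\<forall>i>n. x i = 0 \<Longrightarrow> x i0 \<noteq> 0 \<Longrightarrow> proj_pt x \<in> proj_space n"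
  unfolding proj_space_def using not_le by blast

lemma proj_spaceE:
  assumes "P \<in> proj_space n"
  obtains x where "P = proj_pt x" "\<forall>i>n. x i = 0" "\<exists>i\<le>n. x i \<noteq> 0"
  using assms unfolding proj_space_def by blast

lemma form_proj_pt_nonzero:
  assumes "form n d f" "y \<in> proj_pt x" "f x \<noteq> 0"
  shows "f y \<noteq> 0"
  using assms form_homogeneous[OF assms(1)] by (auto elim!: proj_ptE)

lemma zopen_basic: "form n d h \<Longrightarrow> zopen n X {P \<in> X. \<exists>x\<in>P. h x \<noteq> 0}"
  unfolding zopen_def by (rule exI[of _ "{h}"]) auto

lemma zopen_subset: "zopen n X V \<Longrightarrow> V \<subseteq> X"
  unfolding zopen_def by blast

text \<open>Principal open sets form a basis: one member of the defining family that is nonzero at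
  \<open>P\<close> suffices, and homogeneity makes nonvanishing independent of the
  representative.\<close>

lemma zopen_nbhd:
  assumes "zopen n X V" "X \<subseteq> proj_space n" "P \<in> V"
  obtains d k where "form n d k" "\<And>x. x \<in> P \<Longrightarrow> k x \<noteq> 0"
    "\<And>R x. R \<in> X \<Longrightarrow> x \<in> R \<Longrightarrow> k x \<noteq> 0 \<Longrightarrow> R \<in> V"
proof -
  obtain S where S: "\<forall>f\<in>S. \<exists>d. form n d f" "V = {P \<in> X. \<exists>f\<in>S. \<exists>x\<in>P. f x \<noteq> 0}"
    using assms(1) unfolding zopen_def by blast
  from assms(3) obtain k x where k: "k \<in> S" "x \<in> P" "k x \<noteq> 0" and "P \<in> X"
    unfolding S(2) by blast
  obtain d where d: "form n d k" using S k by blast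
  have P: "P = proj_pt x" using proj_spaceD(1) k(2) assms(2) \<open>P \<in> X\<close> by blast
  show ?thesis
    by (rule that[OF d]) (use form_proj_pt_nonzero[OF d _ k(3)] P S(2) k(1) in auto)
qed

lemma zopen_Int:
  assumes "zopen n X U" "zopen n X V" "X \<subseteq> proj_space n"
  shows "zopen n X (U \<inter> V)"
proof -
  obtain S where S: "\<forall>f\<in>S. \<exists>d. form n d f" "U = {P \<in> X. \<exists>f\<in>S. \<exists>x\<in>P. f x \<noteq> 0}"
    using assms(1) unfolding zopen_def by blast
  obtain T where T: "\<forall>f\<in>T. \<exists>d. form n d f" "V = {P \<in> X. \<exists>f\<in>T. \<exists>x\<in>P. f x \<noteq> 0}"
    using assms(2) unfolding zopen_def by blast
  let ?R = "{\<lambda>x. f x * g x | f g. f \<in> S \<and> g \<in> T}"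
  have "U \<inter> V = {P \<in> X. \<exists>f\<in>?R. \<exists>x\<in>P. f x \<noteq> 0}"
  proof (intro equalityI subsetI)
    fix P assume P: "P \<in> U \<inter> V"
    then obtain f x g y where *: "f \<in> S" "x \<in> P" "f x \<noteq> 0" "g \<in> T" "y \<in> P" "g y \<noteq> 0" "P \<in> X"
      unfolding S(2) T(2) by blast
    obtain d where "form n d g" using T * by blast
    moreover have "P = proj_pt y" using proj_spaceD(1) * assms(3) by blast
    ultimately have "g x \<noteq> 0" using * form_proj_pt_nonzero by blast
    with * have "(\<lambda>x. f x * g x) \<in> ?R" "f x * g x \<noteq> 0" by auto
    then have "\<exists>h\<in>?R. \<exists>x\<in>P. h x \<noteq> 0" using *(2)
      by (intro bexI[of _ "\<lambda>x. f x * g x"] bexI[of _ x])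
    with *(7) show "P \<in> {P \<in> X. \<exists>f\<in>?R. \<exists>x\<in>P. f x \<noteq> 0}" by simp
  qed (use S(2) T(2) in fastforce)
  moreover have "\<forall>f\<in>?R. \<exists>d. form n d f"
    using S(1) T(1) form_mult by blast
  ultimately show ?thesis unfolding zopen_def by blast
qed

lemma zopen_whole:
  assumes "X \<subseteq> proj_space n"
  shows "zopen n X X"
proof -
  have "{P \<in> X. \<exists>x\<in>P. (1::'a) \<noteq> 0} = X"
  proof (intro equalityI subsetI)
    fix P assume "P \<in> X"
    moreover from this obtain x where "P = proj_pt x" using assms by (meson proj_spaceE subsetD)
    ultimately show "P \<in> {P \<in> X. \<exists>x\<in>P. (1::'a) \<noteq> 0}" using proj_pt_refl by auto
  qed auto
  with zopen_basic[OF form_const[of n 1], of X] show ?thesis by simp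
qed

lemma zopen_INT:
  assumes "finite I" "\<And>i. i \<in> I \<Longrightarrow> zopen n X (U i)" "X \<subseteq> proj_space n"
  shows "zopen n X (X \<inter> (\<Inter>i\<in>I. U i))"
  using assms(1,2)
proof (induction I rule: finite_induct)
  case empty
  then show ?case using zopen_whole[OF assms(3)] by simp
next
  case (insert i I)
  have "X \<inter> (\<Inter>j\<in>insert i I. U j) = U i \<inter> (X \<inter> (\<Inter>j\<in>I. U j))" by auto
  then show ?case using zopen_Int[OF _ _ assms(3)] insert by simp
qed

subsection \<open>Binary forms and the projective line\<close>

text \<open>Homogenisation with t = x_1 / x_0. The degree is a separate parameter because the excess
  of \<open>d\<close> over \<open>degree p\<close> records the order of the zero at infinity.
  Coefficients above \<open>d\<close> are dropped, hence the degree bounds in later lemmas.\<close>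

definition hom :: "nat \<Rightarrow> 'k::field poly \<Rightarrow> (nat \<Rightarrow> 'k) \<Rightarrow> 'k" where
  "hom d p x = (\<Sum>a\<le>d. coeff p a * (x 0 ^ (d - a) * x 1 ^ a))"

lemma form_hom: "form 1 d (hom d p)"
proof -
  have "form 1 d (\<lambda>x. coeff p a * (x 0 ^ (d - a) * x 1 ^ a))" if "a \<le> d" for a
    using form_scale[OF form_mult[OF form_power[OF form_var[of 0 1], of "d - a"] form_power[OF form_var[of 1 1], of a]],
        of "coeff p a"] that by simp
  then have "form 1 d (\<lambda>x. \<Sum>a\<le>d. coeff p a * (x 0 ^ (d - a) * x 1 ^ a))"
    by (intro form_sum) auto
  then show ?thesis unfolding hom_def[abs_def] .
qed

lemma poly_altdef_bound:
  fixes p :: "'k::field poly"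
  assumes "degree p \<le> d"
  shows "poly p y = (\<Sum>a\<le>d. coeff p a * y ^ a)"
  unfolding poly_altdef
  by (intro sum.mono_neutral_left) (use assms in \<open>auto simp: coeff_eq_0\<close>)

lemma hom_finite:
  assumes "degree p \<le> d" "x 0 \<noteq> 0"
  shows "hom d p x = x 0 ^ d * poly p (x 1 / x 0)"
  unfolding poly_altdef_bound[OF assms(1)] hom_def sum_distrib_left
proof (rule sum.cong)
  fix a assume "a \<in> {..d}"
  then have "x 0 ^ d = x 0 ^ (d - a) * x 0 ^ a" by (simp flip: power_add)
  then show "coeff p a * (x 0 ^ (d - a) * x 1 ^ a) = x 0 ^ d * (coeff p a * (x 1 / x 0) ^ a)"
    using assms(2) by (simp add: power_divide)
qed simp

lemma hom_infinity:
  assumes "x 0 = 0"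
  shows "hom d p x = coeff p d * x 1 ^ d"
proof -
  have "hom d p x = (\<Sum>a\<in>{d}. coeff p a * (x 0 ^ (d - a) * x 1 ^ a))"
    unfolding hom_def by (intro sum.mono_neutral_right) (use assms in auto)
  then show ?thesis by simp
qed

lemma coeff_mult_bound:
  fixes p q :: "'k::field poly"
  assumes "degree p \<le> d" "degree q \<le> d'"
  shows "coeff (p * q) (d + d') = coeff p d * coeff q d'"
proof (cases "degree p = d \<and> degree q = d'")
  case True
  then show ?thesis using coeff_mult_degree_sum by blast
next
  case False
  then have "degree p < d \<or> degree q < d'" using assms by auto
  moreover have "degree (p * q) \<le> degree p + degree q" by (rule degree_mult_le)
  ultimately have "degree (p * q) < d + d'" using assms by linarith
  then show ?thesis using \<open>degree p < d \<or> degree q < d'\<close> by (auto simp: coeff_eq_0)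
qed

lemma hom_mult:
  assumes "degree p \<le> d" "degree q \<le> d'"
  shows "hom (d + d') (p * q) x = hom d p x * hom d' q x"
proof (cases "x 0 = 0")
  case True
  then show ?thesis by (simp add: hom_infinity coeff_mult_bound[OF assms] power_add)
next
  case False
  have "degree (p * q) \<le> d + d'"
    using degree_mult_le[of p q] assms by linarith
  then show ?thesis using False assms by (simp add: hom_finite power_add)
qed

lemma hom_add: "hom d (p + q) x = hom d p x + hom d q x"
  by (simp add: hom_def sum.distrib distrib_right)

lemma hom_smult: "hom d (smult c p) x = c * hom d p x"
  by (simp add: hom_def sum_distrib_left mult.assoc)

lemma hom_sum: "hom d (\<Sum>i\<in>I. p i) x = (\<Sum>i\<in>I. hom d (p i) x)"
  by (simp add: hom_def coeff_sum sum_distrib_right sum.swap[of _ I])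

lemma form_1_hom:
  assumes "form 1 d g"
  obtains p where "degree p \<le> d" "g = hom d p"
proof -
  have "\<exists>p. degree p \<le> d \<and> (\<forall>x. g x = hom d p x)" using assms
  proof (induction rule: form_induct)
    case (zero d)
    show ?case by (intro exI[of _ 0]) (simp add: hom_def)
  next
    case (const c)
    show ?case by (intro exI[of _ "[:c:]"]) (simp add: hom_def)
  next
    case (var_mult i d f)
    then obtain p where p: "degree p \<le> d" "\<forall>x. f x = hom d p x" by blast
    have "x 0 = hom 1 1 x" "x 1 = hom 1 [:0, 1:] x" for x :: "nat \<Rightarrow> 'a"
      by (simp_all add: hom_def)
    then have "x 0 * f x = hom (1 + d) (1 * p) x" "x 1 * f x = hom (1 + d) ([:0, 1:] * p) x" for x
      using hom_mult[of 1 1 p d x] hom_mult[of "[:0, 1:]" 1 p d x] p by simp_all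
    moreover have "degree (1 * p) \<le> Suc d" "degree ([:0, 1:] * p) \<le> Suc d"
      using p degree_mult_le[of "[:0,1:]" p] by auto
    ultimately show ?case using var_mult(1) le_Suc_eq
      by (metis One_nat_def le_0_eq plus_1_eq_Suc)
  next
    case (add d f g)
    then obtain p p' where "degree p \<le> d" "\<forall>x. f x = hom d p x" "degree p' \<le> d" "\<forall>x. g x = hom d p' x"
      by blast
    then show ?case by (intro exI[of _ "p + p'"]) (simp add: hom_add degree_add_le)
  qed
  then show ?thesis using that by blast
qed

definition pt :: "'k::field \<Rightarrow> nat \<Rightarrow> 'k" where
  "pt t = (\<lambda>i. if i = 0 then 1 else if i = 1 then t else 0)"

definition pt_inf :: "nat \<Rightarrow> 'k::field" where
  "pt_inf = (\<lambda>i. if i = 1 then 1 else 0)"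

lemma pt_simps [simp]: "pt t 0 = 1" "pt t 1 = t" "pt t (Suc 0) = t" "pt_inf 0 = 0" "pt_inf 1 = 1" "pt_inf (Suc 0) = 1"
  by (simp_all add: pt_def pt_inf_def)

lemma hom_pt: "degree p \<le> d \<Longrightarrow> hom d p (pt t) = poly p t"
  by (simp add: hom_finite)

lemma hom_pt_inf: "hom d p pt_inf = coeff p d"
  by (simp add: hom_infinity)

lemma pt_in_P1: "proj_pt (pt t) \<in> P1" "proj_pt pt_inf \<in> P1"
  by (rule proj_spaceI[of _ _ 0], simp_all add: pt_def)
     (rule proj_spaceI[of _ _ 1], simp_all add: pt_inf_def)

lemma P1_cases:
  assumes "Q \<in> P1"
  obtains t where "Q = proj_pt (pt t)" | "Q = proj_pt pt_inf"
proof -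
  obtain x where x: "Q = proj_pt x" "\<forall>i>1. x i = 0" "\<exists>i\<le>1. x i \<noteq> 0"
    using assms by (rule proj_spaceE)
  show ?thesis
  proof (cases "x 0 = 0")
    case True
    then have "x 1 \<noteq> 0" using x(3) le_Suc_eq by auto
    have "Q = proj_pt pt_inf"
      unfolding x(1)
    proof (rule proj_pt_eqI_proportional[of 1 _ _ 1 1])
      fix i j :: nat assume "i \<le> 1" "j \<le> 1"
      then have "i = 0 \<or> i = 1" "j = 0 \<or> j = 1" by auto
      then show "x i * pt_inf j = x j * pt_inf i" using True by auto
    qed (use x True \<open>x 1 \<noteq> 0\<close> in \<open>auto simp: pt_inf_def\<close>)
    then show ?thesis by (rule that(2))
  next
    case False
    have "Q = proj_pt (pt (x 1 / x 0))"
      unfolding x(1)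
    proof (rule proj_pt_eqI_proportional[of 1 _ _ 0 0])
      fix i j :: nat assume "i \<le> 1" "j \<le> 1"
      then have "i = 0 \<or> i = 1" "j = 0 \<or> j = 1" by auto
      then show "x i * pt (x 1 / x 0) j = x j * pt (x 1 / x 0) i" using False by auto
    qed (use x False in \<open>auto simp: pt_def\<close>)
    then show ?thesis by (rule that(1))
  qed
qed

lemma hom_nonzero_cofinite:
  fixes p :: "'k::alg_closed_field poly"
  assumes "degree p \<le> d" "hom d p x \<noteq> 0"
  shows "p \<noteq> 0" "finite {t. hom d p (pt t) = 0}"
proof -
  show "p \<noteq> 0" using assms(2) by (auto simp: hom_def)
  then show "finite {t. hom d p (pt t) = 0}"
    unfolding hom_pt[OF assms(1)] by (rule poly_roots_finite)
qed

lemma zopen_P1_cofinite: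
  fixes V :: "(nat \<Rightarrow> 'k::alg_closed_field) set set"
  assumes "zopen 1 P1 V" "Q \<in> V"
  shows "finite {t. proj_pt (pt t) \<notin> V}"
proof -
  obtain d k where k: "form 1 d k" "\<And>x. x \<in> Q \<Longrightarrow> k x \<noteq> 0"
    "\<And>R x. R \<in> P1 \<Longrightarrow> x \<in> R \<Longrightarrow> k x \<noteq> 0 \<Longrightarrow> R \<in> V"
    using zopen_nbhd[OF assms(1) order_refl assms(2)] by blast
  obtain p where p: "degree p \<le> d" "k = hom d p" using form_1_hom[OF k(1)] .
  have "Q \<in> P1" using assms zopen_subset by blast
  then obtain x where "x \<in> Q" using proj_pt_refl by (metis proj_spaceE)
  from k(2)[OF this] have "finite {t. hom d p (pt t) = 0}"
    using hom_nonzero_cofinite(2)[OF p(1)] unfolding p(2) by blast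
  moreover have "{t. proj_pt (pt t) \<notin> V} \<subseteq> {t. hom d p (pt t) = 0}"
    using k(3)[OF pt_in_P1(1) proj_pt_refl] unfolding p(2) by blast
  ultimately show ?thesis by (rule finite_subset[rotated])
qed

subsection \<open>Polynomials without common zeros\<close>

text \<open>Common roots are divided out one at a time, and the degree of the nonzero member
  \<open>p j\<close> bounds the number of divisions. Over an algebraically closed field this does
  the work of a gcd of the family.\<close>

lemma cancel_common_roots:
  fixes p :: "'i \<Rightarrow> 'k::alg_closed_field poly"
  assumes "j \<in> I" "p j \<noteq> 0"
  obtains g p' where "g \<noteq> 0" "\<And>i. i \<in> I \<Longrightarrow> p i = g * p' i" "\<And>t. \<exists>i\<in>I. poly (p' i) t \<noteq> 0"
proof -
  have "\<exists>g p'. g \<noteq> 0 \<and> (\<forall>i\<in>I. p i = g * p' i) \<and> (\<forall>t. \<exists>i\<in>I. poly (p' i) t \<noteq> 0)"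
    using assms(2)
  proof (induction "degree (p j)" arbitrary: p rule: less_induct)
    case less
    show ?case
    proof (cases "\<exists>t. \<forall>i\<in>I. poly (p i) t = 0")
      case False
      then show ?thesis by (intro exI[of _ 1] exI[of _ p]) auto
    next
      case True
      then obtain t where "\<forall>i\<in>I. poly (p i) t = 0" by blast
      then have "\<forall>i\<in>I. \<exists>r. p i = [:- t, 1:] * r" by (metis poly_eq_0_iff_dvd dvdE)
      then obtain r where r: "\<forall>i\<in>I. p i = [:- t, 1:] * r i" by metis
      have "r j \<noteq> 0" using less.prems r assms(1) by auto
      then have "degree ([:- t, 1:] * r j) = Suc (degree (r j))"
        by (subst degree_mult_eq) auto
      then have "degree (p j) = Suc (degree (r j))"
        using r assms(1) by metis
      with less.hyps[of r] \<open>r j \<noteq> 0\<close> obtain g p' where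
        "g \<noteq> 0" "\<forall>i\<in>I. r i = g * p' i" "\<forall>t. \<exists>i\<in>I. poly (p' i) t \<noteq> 0" by auto
      with r show ?thesis
        by (intro exI[of _ "[:- t, 1:] * g"] exI[of _ p']) (auto simp: mult.assoc simp del: mult_pCons_left)
    qed
  qed
  then show ?thesis using that by blast
qed

lemma reduce_fraction:
  fixes G H :: "'k::alg_closed_field poly"
  assumes "H \<noteq> 0"
  obtains g G' H' where "g \<noteq> 0" "G = g * G'" "H = g * H'" "\<And>t. poly H' t = 0 \<Longrightarrow> poly G' t \<noteq> 0"
proof -
  \<comment> \<open>The pair is treated as a family indexed by the booleans, with \<open>H\<close>
    at \<open>True\<close> as the nonzero member.\<close>
  obtain g p' where g: "g \<noteq> 0" "\<And>i. i \<in> UNIV \<Longrightarrow> (\<lambda>b. if b then H else G) i = g * p' i"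
      "\<And>t. \<exists>i\<in>UNIV. poly (p' i) t \<noteq> 0"
    using cancel_common_roots[of True UNIV "\<lambda>b. if b then H else G"] assms by auto
  have "\<exists>i. poly (p' i) t \<noteq> 0" for t using g(3)[of t] by auto
  then have "poly (p' True) t \<noteq> 0 \<or> poly (p' False) t \<noteq> 0" for t by (metis (full_types))
  with that[of g "p' False" "p' True"] g(1) g(2)[of True] g(2)[of False] show ?thesis by auto
qed

text \<open>A nonzero combination of least degree divides every combination, by division with
  remainder. It divides both \<open>p\<close> and \<open>q\<close>, so it has no root and is a
  constant.\<close>

lemma bezout_no_common_root:
  fixes p q :: "'k::alg_closed_field poly"
  assumes "\<And>t. poly p t = 0 \<Longrightarrow> poly q t \<noteq> 0"
  obtains a b where "a * p + b * q = 1"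
proof -
  define I where "I = {r. \<exists>a b. r = a * p + b * q \<and> r \<noteq> 0}"
  have "p \<noteq> 0 \<or> q \<noteq> 0" using assms[of 0] by auto
  then have "p \<in> I \<or> q \<in> I" unfolding I_def
    by (auto intro: exI[of _ 1] exI[of _ 0])
  then obtain r where r: "r \<in> I" "\<And>s. s \<in> I \<Longrightarrow> degree r \<le> degree s"
    using ex_has_least_nat[of "\<lambda>r. r \<in> I" _ degree] by blast
  obtain a b where ab: "r = a * p + b * q" "r \<noteq> 0" using r(1) unfolding I_def by blast
  have dvd: "r dvd s" if s: "s = c * p + d * q" for s c d
  proof (rule ccontr)
    assume "\<not> r dvd s"
    then have nz: "s mod r \<noteq> 0" by (simp add: mod_eq_0_iff_dvd)
    have "s mod r = s - s div r * r" by (simp add: minus_div_mult_eq_mod)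
    also have "\<dots> = (c - s div r * a) * p + (d - s div r * b) * q"
      unfolding ab(1) using s by (simp add: algebra_simps)
    finally have "s mod r \<in> I" using nz unfolding I_def by blast
    then have "degree r \<le> degree (s mod r)" by (rule r(2))
    with degree_mod_less[OF ab(2), of s] nz show False by auto
  qed
  have "r dvd p" "r dvd q"
    using dvd[of p 1 0] dvd[of q 0 1] by simp_all
  then have "poly r t \<noteq> 0" for t using assms[of t] by (auto elim!: dvdE)
  then have "degree r = 0" using alg_closed_imp_poly_has_root[of r] by auto
  then obtain c where c: "r = [:c:]" by (rule degree_eq_zeroE)
  with ab(2) have "c \<noteq> 0" by simp
  have "smult (inverse c) a * p + smult (inverse c) b * q = smult (inverse c) r"
    unfolding ab(1) by (simp add: smult_add_right)
  also have "\<dots> = 1" unfolding c using \<open>c \<noteq> 0\<close> by (simp add: one_pCons)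
  finally show ?thesis by (rule that)
qed

text \<open>Roots in \<open>Z\<close> are moved into \<open>H0\<close> one by one. The two factors
  are the coprime denominators of a partial fraction decomposition.\<close>

lemma split_roots:
  fixes H :: "'k::alg_closed_field poly"
  assumes "H \<noteq> 0"
  obtains H0 H1 where "H = H0 * H1" "\<And>t. poly H0 t = 0 \<Longrightarrow> t \<in> Z" "\<And>t. poly H1 t = 0 \<Longrightarrow> t \<notin> Z"
proof -
  have "\<exists>H0 H1. H = H0 * H1 \<and> (\<forall>t. poly H0 t = 0 \<longrightarrow> t \<in> Z) \<and> (\<forall>t. poly H1 t = 0 \<longrightarrow> t \<notin> Z)"
    using assms
  proof (induction "degree H" arbitrary: H rule: less_induct)
    case less
    show ?case
    proof (cases "\<exists>t. t \<in> Z \<and> poly H t = 0")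
      case False
      then show ?thesis by (intro exI[of _ 1] exI[of _ H]) auto
    next
      case True
      then obtain t r where t: "t \<in> Z" "H = [:- t, 1:] * r" by (metis poly_eq_0_iff_dvd dvdE)
      then have "r \<noteq> 0" using less.prems by auto
      then have "degree H = Suc (degree r)" unfolding t(2) by (subst degree_mult_eq) auto
      with less.hyps[of r] \<open>r \<noteq> 0\<close> obtain H0 H1 where
        H: "r = H0 * H1" "\<forall>t. poly H0 t = 0 \<longrightarrow> t \<in> Z" "\<forall>t. poly H1 t = 0 \<longrightarrow> t \<notin> Z" by auto
      have "H = ([:- t, 1:] * H0) * H1" unfolding t(2) H(1) by (simp only: mult.assoc)
      moreover have "\<forall>s. poly ([:- t, 1:] * H0) s = 0 \<longrightarrow> s \<in> Z" using H(2) t(1) by auto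
      ultimately show ?thesis using H(3) by blast
    qed
  qed
  then show ?thesis using that by blast
qed

subsection \<open>Rational functions with poles in a given set\<close>

text \<open>The degree condition bounds the order at infinity, so that these are the sections of
  \<open>\<O>(m)\<close> over the complement of \<open>Z\<close> in the projective line.\<close>

definition rat :: "'k::field set \<Rightarrow> int \<Rightarrow> ('k \<Rightarrow> 'k) \<Rightarrow> bool" where
  "rat Z m s \<longleftrightarrow> (\<exists>G H. (\<forall>t. t \<notin> Z \<longrightarrow> poly H t \<noteq> 0 \<and> s t = poly G t / poly H t) \<and>
     H \<noteq> 0 \<and> (G = 0 \<or> int (degree G) \<le> int (degree H) + m))"

lemma ratI:
  assumes "\<And>t. t \<notin> Z \<Longrightarrow> poly H t \<noteq> 0" "\<And>t. t \<notin> Z \<Longrightarrow> s t = poly G t / poly H t"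
    "H \<noteq> 0" "G \<noteq> 0 \<Longrightarrow> int (degree G) \<le> int (degree H) + m"
  shows "rat Z m s"
  unfolding rat_def
proof (intro exI conjI allI impI)
  show "poly H t \<noteq> 0" "s t = poly G t / poly H t" if "t \<notin> Z" for t
    using assms that by blast+
  show "G = 0 \<or> int (degree G) \<le> int (degree H) + m" using assms(4) by blast
qed (rule assms(3))

lemma ratE:
  assumes "rat Z m s"
  obtains G H where "\<And>t. t \<notin> Z \<Longrightarrow> poly H t \<noteq> 0" "\<And>t. t \<notin> Z \<Longrightarrow> s t = poly G t / poly H t"
    "H \<noteq> 0" "G \<noteq> 0 \<Longrightarrow> int (degree G) \<le> int (degree H) + m"
proof -
  obtain G H where *: "\<forall>t. t \<notin> Z \<longrightarrow> poly H t \<noteq> 0 \<and> s t = poly G t / poly H t"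
     "H \<noteq> 0" "G = 0 \<or> int (degree G) \<le> int (degree H) + m"
    using assms unfolding rat_def by (elim exE conjE)
  show ?thesis by (rule that[of H G]) (use * in blast)+
qed

lemma rat_cong:
  assumes "rat Z m s" "\<And>t. t \<notin> Z \<Longrightarrow> s t = s' t"
  shows "rat Z m s'"
proof -
  obtain G H where *: "\<And>t. t \<notin> Z \<Longrightarrow> poly H t \<noteq> 0" "\<And>t. t \<notin> Z \<Longrightarrow> s t = poly G t / poly H t"
    "H \<noteq> 0" "G \<noteq> 0 \<Longrightarrow> int (degree G) \<le> int (degree H) + m" by (rule ratE[OF assms(1)], rule that)
  have "s' t = poly G t / poly H t" if "t \<notin> Z" for t
    using *(2)[OF that] assms(2)[OF that] by simp
  then show ?thesis using *(1,3,4) by (intro ratI[of Z H s' G m])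
qed

lemma rat_mono: "rat Z m s \<Longrightarrow> Z \<subseteq> Z' \<Longrightarrow> rat Z' m s"
  unfolding rat_def by (elim exE, intro exI) auto

lemma rat_poly:
  assumes "int (degree p) \<le> m"
  shows "rat Z m (poly p)"
  by (rule ratI[of _ 1 _ p]) (use assms in auto)

lemma rat_mult:
  assumes "rat Z m s" "rat Z m' s'"
  shows "rat Z (m + m') (\<lambda>t. s t * s' t)"
proof -
  obtain G H where 1: "\<And>t. t \<notin> Z \<Longrightarrow> poly H t \<noteq> 0" "\<And>t. t \<notin> Z \<Longrightarrow> s t = poly G t / poly H t"
    "H \<noteq> 0" "G \<noteq> 0 \<Longrightarrow> int (degree G) \<le> int (degree H) + m" by (rule ratE[OF assms(1)], rule that)
  obtain G' H' where 2: "\<And>t. t \<notin> Z \<Longrightarrow> poly H' t \<noteq> 0" "\<And>t. t \<notin> Z \<Longrightarrow> s' t = poly G' t / poly H' t"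
    "H' \<noteq> 0" "G' \<noteq> 0 \<Longrightarrow> int (degree G') \<le> int (degree H') + m'" by (rule ratE[OF assms(2)], rule that)
  show ?thesis
    by (rule ratI[of _ "H * H'" _ "G * G'"]) (use 1 2 in \<open>auto simp: degree_mult_eq\<close>)
qed

lemma rat_add:
  assumes "rat Z m s" "rat Z m s'"
  shows "rat Z m (\<lambda>t. s t + s' t)"
proof -
  obtain G H where 1: "\<And>t. t \<notin> Z \<Longrightarrow> poly H t \<noteq> 0" "\<And>t. t \<notin> Z \<Longrightarrow> s t = poly G t / poly H t"
    "H \<noteq> 0" "G \<noteq> 0 \<Longrightarrow> int (degree G) \<le> int (degree H) + m" by (rule ratE[OF assms(1)], rule that)
  obtain G' H' where 2: "\<And>t. t \<notin> Z \<Longrightarrow> poly H' t \<noteq> 0" "\<And>t. t \<notin> Z \<Longrightarrow> s' t = poly G' t / poly H' t"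
    "H' \<noteq> 0" "G' \<noteq> 0 \<Longrightarrow> int (degree G') \<le> int (degree H') + m" by (rule ratE[OF assms(2)], rule that)
  show ?thesis
  proof (rule ratI[of _ "H * H'" _ "G * H' + G' * H"])
    assume nz: "G * H' + G' * H \<noteq> 0"
    show "int (degree (G * H' + G' * H)) \<le> int (degree (H * H')) + m"
    proof (cases "G = 0 \<or> G' = 0")
      case True
      then show ?thesis using nz 1 2 by (auto simp: degree_mult_eq)
    next
      case False
      have "degree (G * H' + G' * H) \<le> max (degree (G * H')) (degree (G' * H))"
        by (rule degree_add_le_max)
      then show ?thesis using False 1 2 by (auto simp: degree_mult_eq)
    qed
  qed (use 1 2 in \<open>auto simp: field_simps\<close>)
qed

lemma rat_uminus: "rat Z m s \<Longrightarrow> rat Z m (\<lambda>t. - s t)"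
  using rat_mult[OF rat_poly[of "[:-1:]" 0 Z], of m s] by simp

lemma rat_diff: "rat Z m s \<Longrightarrow> rat Z m s' \<Longrightarrow> rat Z m (\<lambda>t. s t - s' t)"
  using rat_add[of Z m s "\<lambda>t. - s' t"] rat_uminus[of Z m s'] by simp

lemma rat_inverse:
  assumes "\<And>t. t \<notin> Z \<Longrightarrow> poly p t \<noteq> 0" "p \<noteq> 0"
  shows "rat Z (- int (degree p)) (\<lambda>t. inverse (poly p t))"
  by (rule ratI[of _ p _ 1]) (use assms in \<open>auto simp: field_simps\<close>)

text \<open>The quotient valid near infinity, in lowest terms, represents the section on all of
  \<open>U\<close>: any other local quotient agrees with it on a cofinite set, hence as a rational
  function, and a reduced denominator cannot vanish where another denominator does not.\<close>

lemma twist_section_rat: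
  fixes U :: "(nat \<Rightarrow> 'k::alg_closed_field) set set"
  assumes "twist_section 1 P1 m U s" "zopen 1 P1 U" "proj_pt pt_inf \<in> U"
  shows "rat {t. proj_pt (pt t) \<notin> U} m (\<lambda>t. s (pt t))"
proof -
  have loc: "\<exists>V g h d d'. zopen 1 P1 V \<and> Q \<in> V \<and> V \<subseteq> U \<and> degree g \<le> d \<and> degree h \<le> d' \<and> int d = int d' + m \<and>
     (\<forall>R\<in>V. \<forall>x\<in>R. hom d' h x \<noteq> 0 \<and> s x = hom d g x / hom d' h x)" if Q: "Q \<in> U" for Q
  proof -
    obtain V g h d d' where *: "zopen 1 P1 V" "Q \<in> V" "V \<subseteq> U" "form 1 d g" "form 1 d' h" "int d = int d' + m"
      "\<forall>R\<in>V. \<forall>x\<in>R. h x \<noteq> 0 \<and> s x = g x / h x"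
      using assms(1) Q unfolding twist_section_def by meson
    obtain p where "degree p \<le> d" "g = hom d p" using form_1_hom[OF *(4)] .
    moreover obtain r where "degree r \<le> d'" "h = hom d' r" using form_1_hom[OF *(5)] .
    ultimately show ?thesis using * by blast
  qed
  obtain V0 g0 h0 d d' where 0: "zopen 1 P1 V0" "proj_pt pt_inf \<in> V0" "V0 \<subseteq> U" "degree g0 \<le> d" "degree h0 \<le> d'"
     "int d = int d' + m" "\<forall>R\<in>V0. \<forall>x\<in>R. hom d' h0 x \<noteq> 0 \<and> s x = hom d g0 x / hom d' h0 x"
    using loc[OF assms(3)] by blast
  \<comment> \<open>The denominator is nonzero at infinity, so \<open>h0\<close> has exact degree
    \<open>d'\<close>. This turns \<open>d = d' + m\<close> into the bound on the degrees of
    numerator and denominator.\<close>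
  have lc: "coeff h0 d' \<noteq> 0" using 0(2,7) proj_pt_refl hom_pt_inf by metis
  then have h0: "h0 \<noteq> 0" "degree h0 = d'" using 0(5) le_degree by force+
  obtain c G H where cGH: "c \<noteq> 0" "g0 = c * G" "h0 = c * H" "\<And>t. poly H t = 0 \<Longrightarrow> poly G t \<noteq> 0"
    using reduce_fraction[OF h0(1)] by blast
  have H: "H \<noteq> 0" using h0 cGH by auto
  show ?thesis
  proof (rule ratI[of _ H _ G])
    assume "G \<noteq> 0"
    then have "degree g0 = degree c + degree G" "degree h0 = degree c + degree H"
      using H cGH by (auto simp: degree_mult_eq)
    then show "int (degree G) \<le> int (degree H) + m"
      using 0(4,6) h0(2) by linarith
  next
    have key: "poly H t \<noteq> 0 \<and> s (pt t) = poly G t / poly H t" if t: "proj_pt (pt t) \<in> U" for t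
    proof -
      obtain V g h e e' where 1: "zopen 1 P1 V" "proj_pt (pt t) \<in> V" "V \<subseteq> U" "degree g \<le> e" "degree h \<le> e'"
         "int e = int e' + m" "\<forall>R\<in>V. \<forall>x\<in>R. hom e' h x \<noteq> 0 \<and> s x = hom e g x / hom e' h x"
        using loc[OF t] by blast
      have eq: "g * h0 = g0 * h"
      proof (rule poly_eqI_cofinite)
        show "finite ({t. proj_pt (pt t) \<notin> V} \<union> {t. proj_pt (pt t) \<notin> V0})"
          using zopen_P1_cofinite[OF 1(1,2)] zopen_P1_cofinite[OF 0(1,2)] by simp
        fix u assume "u \<notin> {t. proj_pt (pt t) \<notin> V} \<union> {t. proj_pt (pt t) \<notin> V0}"
        then have "proj_pt (pt u) \<in> V" "proj_pt (pt u) \<in> V0" by auto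
        with 1(7) 0(7) have "poly h u \<noteq> 0" "s (pt u) = poly g u / poly h u"
           "poly h0 u \<noteq> 0" "s (pt u) = poly g0 u / poly h0 u"
          using hom_pt[OF 1(4)] hom_pt[OF 1(5)] hom_pt[OF 0(4)] hom_pt[OF 0(5)] proj_pt_refl by metis+
        then show "poly (g * h0) u = poly (g0 * h) u" by (simp add: field_simps)
      qed
      then have "c * (g * H) = c * (G * h)" unfolding cGH(2,3) by (simp add: algebra_simps)
      then have "g * H = G * h" using cGH(1) by simp
      then have eq': "poly g t * poly H t = poly G t * poly h t" by (metis poly_mult)
      have ht: "poly h t \<noteq> 0" "s (pt t) = poly g t / poly h t"
        using 1(2,7) hom_pt[OF 1(4)] hom_pt[OF 1(5)] proj_pt_refl by metis+
      have "poly H t \<noteq> 0" using eq' ht cGH(4)[of t] by auto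
      then have "poly g t / poly h t = poly G t / poly H t"
        using eq' ht(1) by (simp add: frac_eq_eq)
      then show ?thesis using ht(2) \<open>poly H t \<noteq> 0\<close> by simp
    qed
    show "poly H t \<noteq> 0" "s (pt t) = poly G t / poly H t" if "t \<notin> {t. proj_pt (pt t) \<notin> U}" for t
      using key[of t] that by auto
  qed (rule H)
qed

text \<open>The cohomology group \<open>H\<^sup>1(\<O>(-1))\<close> vanishes.\<close>

lemma rat_split:
  fixes s :: "'k::alg_closed_field \<Rightarrow> 'k"
  assumes "rat (A \<union> B) (- 1) s"
  obtains s0 s1 where "rat A (- 1) s0" "rat B (- 1) s1" "\<And>t. t \<notin> A \<union> B \<Longrightarrow> s t = s1 t - s0 t"
proof -
  obtain G H where GH: "\<And>t. t \<notin> A \<union> B \<Longrightarrow> poly H t \<noteq> 0" "\<And>t. t \<notin> A \<union> B \<Longrightarrow> s t = poly G t / poly H t"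
    "H \<noteq> 0" "G \<noteq> 0 \<Longrightarrow> int (degree G) \<le> int (degree H) + - 1" by (rule ratE[OF assms], rule that)
  obtain H0 H1 where H: "H = H0 * H1" "\<And>t. poly H0 t = 0 \<Longrightarrow> t \<in> A" "\<And>t. poly H1 t = 0 \<Longrightarrow> t \<notin> A"
    using split_roots[OF GH(3)] by blast
  have nz: "H0 \<noteq> 0" "H1 \<noteq> 0" using H(1) GH(3) by auto
  obtain a b where ab: "a * H0 + b * H1 = 1"
    using bezout_no_common_root[of H0 H1] H(2,3) by blast
  \<comment> \<open>Partial fractions: a H0 + b H1 = 1 gives G/H = G a/H1 + G b/H0, and reducing the
    first numerator modulo \<open>H1\<close> moves its polynomial part to the second term.\<close>
  define C where "C = (G * a) mod H1"
  define D where "D = G * b + (G * a) div H1 * H0"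
  have C: "C = G * a - (G * a) div H1 * H1" unfolding C_def by (simp add: minus_div_mult_eq_mod)
  have "C * H0 + D * H1 = G * (a * H0 + b * H1)"
    unfolding C D_def by (simp add: algebra_simps)
  then have G: "C * H0 + D * H1 = G" using ab by simp
  have degC: "degree C < degree H1" if "C \<noteq> 0"
    using degree_mod_less[OF nz(2), of "G * a"] that unfolding C_def by auto
  \<comment> \<open>No bound on \<open>D\<close> holds by construction. It comes from D H1 = G - C
    H0, where the right side has degree below that of \<open>H\<close>; for \<open>G\<close> this is
    the twist by -1.\<close>
  have degD: "degree D < degree H0" if "D \<noteq> 0"
  proof -
    have degG: "degree G < degree H0 + degree H1" if "G \<noteq> 0"
      using GH(4)[OF that] nz unfolding H(1) by (simp add: degree_mult_eq)
    have D': "D * H1 = G - C * H0" using G by (simp add: algebra_simps)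
    have "degree (D * H1) < degree H0 + degree H1"
    proof (cases "G = 0 \<or> C = 0")
      case True
      then show ?thesis using degG degC that nz unfolding D' 
        by (metis D' add.commute add_less_cancel_left degree_minus degree_mult_eq diff_0 diff_zero mult_eq_0_iff mult_zero_left)
    next
      case False
      then show ?thesis unfolding D' using degG degC nz
        by (intro degree_diff_less) (auto simp: degree_mult_eq)
    qed
    then show ?thesis using that nz by (simp add: degree_mult_eq)
  qed
  show ?thesis
  proof (rule that[of "\<lambda>t. poly (- D) t / poly H0 t" "\<lambda>t. poly C t / poly H1 t"])
    show "rat A (- 1) (\<lambda>t. poly (- D) t / poly H0 t)"
    proof (rule ratI[of _ H0 _ "- D"])
      show "poly H0 t \<noteq> 0" if "t \<notin> A" for t using H(2) that by blast
      show "int (degree (- D)) \<le> int (degree H0) + - 1" if "- D \<noteq> 0"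
        using degD that by simp
    qed (use nz in simp_all)
    show "rat B (- 1) (\<lambda>t. poly C t / poly H1 t)"
    proof (rule ratI[of _ H1 _ C])
      show "poly H1 t \<noteq> 0" if "t \<notin> B" for t
      proof
        assume *: "poly H1 t = 0"
        then have "t \<notin> A" by (rule H(3))
        with that have "poly H t \<noteq> 0" using GH(1) by blast
        with * show False unfolding H(1) by simp
      qed
      show "int (degree C) \<le> int (degree H1) + - 1" if "C \<noteq> 0"
        using degC[OF that] by simp
    qed (use nz in simp_all)
    fix t assume t: "t \<notin> A \<union> B"
    then have "poly H0 t \<noteq> 0" "poly H1 t \<noteq> 0" using GH(1)[OF t] H(1) by auto
    then show "s t = poly C t / poly H1 t - poly (- D) t / poly H0 t"
      unfolding GH(2)[OF t] H(1) G[symmetric] by (simp add: field_simps)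
  qed
qed

text \<open>In lowest terms a root of the denominator would lie in both \<open>A\<close> and
  \<open>B\<close>, so the denominator is constant. In effect this computes the global sections of
  O(m).\<close>

lemma rat_glue:
  fixes s0 s1 :: "'k::alg_closed_field \<Rightarrow> 'k"
  assumes "rat A m s0" "rat B m s1" "A \<inter> B = {}" "finite A" "finite B"
    and "\<And>t. t \<notin> A \<union> B \<Longrightarrow> s0 t = s1 t"
  obtains p where "p \<noteq> 0 \<Longrightarrow> int (degree p) \<le> m" "\<And>t. t \<notin> A \<Longrightarrow> s0 t = poly p t"
proof -
  obtain G0 H0 where 1: "\<And>t. t \<notin> A \<Longrightarrow> poly H0 t \<noteq> 0" "\<And>t. t \<notin> A \<Longrightarrow> s0 t = poly G0 t / poly H0 t"
    "H0 \<noteq> 0" "G0 \<noteq> 0 \<Longrightarrow> int (degree G0) \<le> int (degree H0) + m" by (rule ratE[OF assms(1)], rule that)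
  obtain G1 H1 where 2: "\<And>t. t \<notin> B \<Longrightarrow> poly H1 t \<noteq> 0" "\<And>t. t \<notin> B \<Longrightarrow> s1 t = poly G1 t / poly H1 t"
    "H1 \<noteq> 0" "G1 \<noteq> 0 \<Longrightarrow> int (degree G1) \<le> int (degree H1) + m" by (rule ratE[OF assms(2)], rule that)
  obtain c G H where c: "c \<noteq> 0" "G0 = c * G" "H0 = c * H" "\<And>t. poly H t = 0 \<Longrightarrow> poly G t \<noteq> 0"
    using reduce_fraction[OF 1(3)] by blast
  have "G0 * H1 = G1 * H0"
  proof (rule poly_eqI_cofinite)
    show "finite (A \<union> B)" using assms by simp
    fix t assume t: "t \<notin> A \<union> B"
    then have "poly G0 t / poly H0 t = poly G1 t / poly H1 t" "poly H0 t \<noteq> 0" "poly H1 t \<noteq> 0"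
      using 1 2 assms(6)[OF t] by auto
    then show "poly (G0 * H1) t = poly (G1 * H0) t" by (simp add: field_simps)
  qed
  then have "c * (G * H1) = c * (G1 * H)" using c by (simp add: algebra_simps)
  then have "G * H1 = G1 * H" using c(1) by simp
  then have eq: "poly G t * poly H1 t = poly G1 t * poly H t" for t by (metis poly_mult)
  have "poly H t \<noteq> 0" for t
  proof
    assume t: "poly H t = 0"
    with eq[of t] c(4)[OF t] have "poly H1 t = 0" by simp
    then have "t \<in> B" using 2(1) by blast
    moreover have "poly H0 t = 0" using t c(3) by simp
    then have "t \<in> A" using 1(1) by blast
    ultimately show False using assms(3) by blast
  qed
  then have "degree H = 0" using alg_closed_imp_poly_has_root[of H] by auto
  then obtain h where h: "H = [:h:]" by (rule degree_eq_zeroE)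
  have hnz: "h \<noteq> 0" using c(3) 1(3) h by auto
  show ?thesis
  proof (rule that[of "smult (inverse h) G"])
    assume "smult (inverse h) G \<noteq> 0"
    then have "G \<noteq> 0" by simp
    then show "int (degree (smult (inverse h) G)) \<le> m"
      using 1(4) hnz unfolding c(2,3) h using c(1) by (simp add: degree_mult_eq)
  next
    fix t assume t: "t \<notin> A"
    have "poly c t \<noteq> 0" using 1(1)[OF t] c(3) by auto
    then show "s0 t = poly (smult (inverse h) G) t"
      using hnz unfolding 1(2)[OF t] c(2,3) h by (simp add: field_simps)
  qed
qed

subsection \<open>Powers of the characteristic\<close>

locale char_power =
  fixes q \<nu> :: nat and k_type :: "'k::alg_closed_field itself"
  assumes char_pos: "CHAR('k) > 0" and q_eq: "q = CHAR('k) ^ \<nu>" and \<nu>_pos: "\<nu> \<ge> 1"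
begin

lemma prime_char: "prime CHAR('k)"
  using prime_CHAR_semidom[where 'a = 'k] char_pos by blast

lemma q_ge_2: "q \<ge> 2"
proof -
  have "CHAR('k) \<ge> 2" using prime_char by (rule prime_ge_2_nat)
  moreover have "CHAR('k) \<le> q" unfolding q_eq
    using \<nu>_pos char_pos by (metis One_nat_def Suc_leI power_increasing power_one_right)
  ultimately show ?thesis by linarith
qed

lemma of_nat_q: "of_nat q = (0 :: 'k)"
  using \<nu>_pos unfolding q_eq of_nat_eq_0_iff_char_dvd by (simp add: dvd_power)

lemma power_q_add: "((x :: 'k) + y) ^ q = x ^ q + y ^ q"
  by (rule freshmans_dream'[OF prime_char q_eq])

lemma power_q_sum: "(\<Sum>i\<in>I. f i :: 'k) ^ q = (\<Sum>i\<in>I. f i ^ q)"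
  by (rule freshmans_dream_sum'[OF prime_char q_eq])

lemma poly_power_q_add: "((p :: 'k poly) + r) ^ q = p ^ q + r ^ q"
  by (rule freshmans_dream') (simp_all add: prime_char q_eq)

lemma poly_power_q_sum: "(\<Sum>i\<in>I. f i :: 'k poly) ^ q = (\<Sum>i\<in>I. f i ^ q)"
  by (rule freshmans_dream_sum') (simp_all add: prime_char q_eq)

text \<open>By additivity of Frobenius (a + b t)^q = a^q + b^q t^q, so the linear term comes from
  the remaining factor alone: the differential of T^(q+1) is T^q dT.\<close>

lemma coeff_linear_power_Suc_q:
  fixes a b :: 'k
  shows "coeff ([:a, b:] ^ (q + 1)) 0 = a ^ (q + 1)" "coeff ([:a, b:] ^ (q + 1)) 1 = a ^ q * b"
proof -
  have "[:a, b:] = [:a:] + monom b 1" by (simp add: monom_Suc monom_0)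
  then have e: "[:a, b:] ^ q = [:a ^ q:] + monom (b ^ q) q"
    by (simp add: poly_power_q_add poly_const_pow monom_power)
  have "coeff ([:a, b:] ^ q) 0 = a ^ q" "coeff ([:a, b:] ^ q) 1 = 0"
    unfolding e using q_ge_2 by auto
  moreover have "[:a, b:] ^ (q + 1) = [:a, b:] ^ q * [:a, b:]" by simp
  ultimately show "coeff ([:a, b:] ^ (q + 1)) 0 = a ^ (q + 1)" "coeff ([:a, b:] ^ (q + 1)) 1 = a ^ q * b"
    unfolding \<open>[:a, b:] ^ (q + 1) = _\<close> coeff_1_mult by (simp_all add: coeff_mult del: mult_pCons_right)
qed

text \<open>The polynomial x^(q+1) - c is separable: its derivative is x^q, which vanishes only at
  0, and 0 is not a root.\<close>

lemma card_Suc_q_roots: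
  fixes c :: 'k
  assumes "c \<noteq> 0"
  obtains S where "finite S" "card S = q + 1" "\<And>x. x \<in> S \<Longrightarrow> x ^ (q + 1) = c"
proof -
  define p where "p = monom 1 (q + 1) + [:- c:]"
  have deg: "degree p = q + 1"
    unfolding p_def by (subst degree_add_eq_left) (simp_all add: degree_monom_eq)
  then have "p \<noteq> 0" by auto
  then obtain A where A: "size A = degree p" "p = smult (lead_coeff p) (\<Prod>x\<in>#A. [:-x, 1:])"
    using alg_closed_imp_factorization by blast
  have root: "x ^ (q + 1) = c" if "poly p x = 0" for x
    using that by (simp add: p_def poly_monom)
  have deriv: "poly (pderiv p) x = x ^ q" for x
    by (simp add: p_def pderiv_add pderiv_monom poly_monom of_nat_q pderiv_pCons)
  have simple: "count A x \<le> 1" for x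
  proof (rule ccontr)
    assume "\<not> count A x \<le> 1"
    then have "{#x, x#} \<subseteq># A" by (simp add: subseteq_mset_def)
    then obtain B where B: "A = {#x, x#} + B" using mset_subset_eq_exists_conv by blast
    define s where "s = smult (lead_coeff p) (\<Prod>x\<in>#B. [:-x, 1:])"
    have "p = smult (lead_coeff p) ([:-x, 1:] * ([:-x, 1:] * (\<Prod>x\<in>#B. [:-x, 1:])))"
      using A(2) unfolding B by (simp del: mult_pCons_left)
    then have s: "p = [:-x, 1:] * ([:-x, 1:] * s)"
      unfolding s_def by (simp only: mult_smult_right)
    then have "x ^ (q + 1) = c" by (intro root) simp
    moreover have "poly (pderiv p) x = 0" unfolding s pderiv_mult by simp
    then have "x ^ q = 0" unfolding deriv .
    ultimately show False using assms by simp
  qed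
  have "count A x = count (mset_set (set_mset A)) x" for x
  proof (cases "x \<in># A")
    case True
    then have "count A x > 0" by simp
    then have "count A x = 1" using simple[of x] by linarith
    then show ?thesis using True by simp
  next
    case False
    then show ?thesis by (simp add: not_in_iff)
  qed
  then have "A = mset_set (set_mset A)" by (rule multiset_eqI)
  from arg_cong[OF this, of size] have "card (set_mset A) = q + 1"
    unfolding size_mset_set A(1) deg ..
  moreover have "x ^ (q + 1) = c" if x: "x \<in># A" for x
  proof (rule root)
    obtain B where B: "A = add_mset x B" using x by (blast dest: multi_member_split)
    show "poly p x = 0" by (subst A(2), subst B) simp
  qed
  ultimately show ?thesis by (intro that[of "set_mset A"]) auto
qed

subsection \<open>Functions vanishing on an open subset of the Fermat hypersurface\<close>

text \<open>The inner variable is the parameter t of the line, the outer one stands for the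
  \<open>j\<close>-th coordinate. Keeping them apart allows division in the outer variable with
  coefficients in k[t].\<close>

lemma form_poly_poly:
  fixes g :: "(nat \<Rightarrow> 'k) \<Rightarrow> 'k"
  assumes "form n d g"
  obtains pp :: "'k poly poly" where
    "\<And>r t. poly (poly pp r) t = g ((\<lambda>i. z i + t * v i)(j := poly r t))"
proof -
  have "\<exists>pp :: 'k poly poly. \<forall>r t. poly (poly pp r) t = g ((\<lambda>i. z i + t * v i)(j := poly r t))"
    using assms
  proof (induction rule: form_induct)
    case (zero d)
    show ?case by (intro exI[of _ 0]) simp
  next
    case (const c)
    show ?case by (intro exI[of _ "[:[:c:]:]"]) simp
  next
    case (var_mult i d f)
    then obtain pp :: "'k poly poly" where
      "\<forall>r t. poly (poly pp r) t = f ((\<lambda>i. z i + t * v i)(j := poly r t))" by blast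
    then show ?case
      by (intro exI[of _ "(if i = j then [:0, 1:] else [:[:z i, v i:]:]) * pp"])
         (simp add: algebra_simps del: fun_upd_apply, simp)
  next
    case (add d f g)
    then obtain p p' :: "'k poly poly" where
      "\<forall>r t. poly (poly p r) t = f ((\<lambda>i. z i + t * v i)(j := poly r t))"
      "\<forall>r t. poly (poly p' r) t = g ((\<lambda>i. z i + t * v i)(j := poly r t))" by blast
    then show ?case by (intro exI[of _ "p + p'"]) (simp del: fun_upd_apply)
  qed
  then show ?thesis using that by blast
qed

lemma poly_map_poly_eval:
  fixes \<rho> :: "'k poly poly"
  shows "poly (map_poly (\<lambda>c. poly c t) \<rho>) x = poly (poly \<rho> [:x:]) t"
  by (induction \<rho> rule: pCons_induct) (simp_all add: map_poly_pCons)

text \<open>A point \<open>z\<close> of the punctured affine cone over X and a vector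
  \<open>v\<close> of its tangent space: the last sum is the differential of the equation, whose
  factor q + 1 equals 1 in k.\<close>

definition cone_tangent :: "nat \<Rightarrow> (nat \<Rightarrow> 'k) \<Rightarrow> (nat \<Rightarrow> 'k) \<Rightarrow> bool" where
  "cone_tangent n z v \<longleftrightarrow> (\<forall>i>n. z i = 0) \<and> (\<forall>i>n. v i = 0) \<and> (\<exists>i. z i \<noteq> 0) \<and>
     (\<Sum>i\<le>n. z i ^ (q + 1)) = 0 \<and> (\<Sum>i\<le>n. z i ^ q * v i) = 0"

text \<open>
  The equation of the hypersurface is monic in \<open>T\<^sub>j\<close>. Dividing \<open>P k\<close>, restricted to the plane
  spanned by the line \<open>z + t v\<close> and the \<open>j\<close>-th axis, by this equation leaves a remainder of
  degree at most \<open>q\<close> in \<open>T\<^sub>j\<close> that has \<open>q + 1\<close> zeros for almost all \<open>t\<close>.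
\<close>

lemma vanishing_to_second_order:
  fixes P k :: "(nat \<Rightarrow> 'k) \<Rightarrow> 'k"
  assumes P: "form n dP P" and k: "form n dk k" and kz: "k z \<noteq> 0"
    and tan: "cone_tangent n z v"
    and van: "\<And>y. \<forall>i>n. y i = 0 \<Longrightarrow> \<exists>i. y i \<noteq> 0 \<Longrightarrow> (\<Sum>i\<le>n. y i ^ (q + 1)) = 0 \<Longrightarrow> k y \<noteq> 0 \<Longrightarrow> P y = 0"
  shows "P z = 0" "dderiv P z v = 0"
proof -
  \<comment> \<open>With z_j nonzero, R(0) = - z_j^(q+1) is nonzero, so R(t) vanishes for finitely
    many t only; for all others T_j^(q+1) = - R(t) has q + 1 distinct roots.\<close>
  obtain j where j: "z j \<noteq> 0" using tan unfolding cone_tangent_def by blast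
  have jn: "j \<le> n" using j tan unfolding cone_tangent_def by (meson not_le)
  obtain p1 :: "'k poly poly" where p1: "\<And>r t. poly (poly p1 r) t = P ((\<lambda>i. z i + t * v i)(j := poly r t))"
    using form_poly_poly[OF P, of z v j] by blast
  obtain p2 :: "'k poly poly" where p2: "\<And>r t. poly (poly p2 r) t = k ((\<lambda>i. z i + t * v i)(j := poly r t))"
    using form_poly_poly[OF k, of z v j] by blast
  define R where "R = (\<Sum>i\<in>{..n} - {j}. [:z i, v i:] ^ (q + 1))"
  have Rt: "poly R t = (\<Sum>i\<in>{..n} - {j}. (z i + t * v i) ^ (q + 1))" for t
    unfolding R_def by (simp add: poly_sum poly_power distrib_right mult.assoc)
  have "poly R 0 + z j ^ (q + 1) = (\<Sum>i\<le>n. z i ^ (q + 1))"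
    unfolding Rt using jn by (subst sum.remove[of "{..n}" j]) auto
  then have "poly R 0 = - (z j ^ (q + 1))" using tan unfolding cone_tangent_def by (simp add: add_eq_0_iff)
  then have R0: "R \<noteq> 0" using j by auto
  define \<Phi> :: "'k poly poly" where "\<Phi> = monom 1 (q + 1) + [:R:]"
  have deg\<Phi>: "degree \<Phi> = q + 1"
    unfolding \<Phi>_def by (subst degree_add_eq_left) (simp_all add: degree_monom_eq)
  have lead: "coeff \<Phi> (degree \<Phi>) = 1"
    unfolding deg\<Phi> by (simp add: \<Phi>_def coeff_pCons)
  have "\<Phi> \<noteq> 0" using deg\<Phi> by auto
  \<comment> \<open>The coefficients lie in k[t], not in a field, so pseudo-division is used; since
    \<open>\<Phi>\<close> is monic, its extra factor is 1.\<close>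
  obtain Q \<rho> where div: "pseudo_divmod (p1 * p2) \<Phi> = (Q, \<rho>)" by (cases "pseudo_divmod (p1 * p2) \<Phi>")
  have eq: "p1 * p2 = \<Phi> * Q + \<rho>" and deg\<rho>: "\<rho> = 0 \<or> degree \<rho> < q + 1"
    using pseudo_divmod[OF \<open>\<Phi> \<noteq> 0\<close> div, unfolded lead] deg\<Phi> by simp_all
  have \<rho>t: "map_poly (\<lambda>c. poly c t) \<rho> = 0" if t: "poly R t \<noteq> 0" for t
  proof (rule ccontr)
    assume nz: "map_poly (\<lambda>c. poly c t) \<rho> \<noteq> 0"
    obtain S where S: "finite S" "card S = q + 1" "\<And>x. x \<in> S \<Longrightarrow> x ^ (q + 1) = - poly R t"
      using card_Suc_q_roots[of "- poly R t"] t by auto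
    have "S \<subseteq> {x. poly (map_poly (\<lambda>c. poly c t) \<rho>) x = 0}"
    proof
      fix x assume "x \<in> S"
      then have x: "x ^ (q + 1) = - poly R t" by (rule S(3))
      define y where "y = (\<lambda>i. z i + t * v i)(j := x)"
      have y0: "\<forall>i>n. y i = 0" using tan jn unfolding y_def cone_tangent_def by auto
      have "y j \<noteq> 0" using x t unfolding y_def by auto
      then have y1: "\<exists>i. y i \<noteq> 0" by blast
      have "(\<Sum>i\<le>n. y i ^ (q + 1)) = x ^ (q + 1) + poly R t"
        unfolding Rt using jn by (subst sum.remove[of "{..n}" j]) (auto simp: y_def)
      then have "(\<Sum>i\<le>n. y i ^ (q + 1)) = 0" using x by simp
      from van[OF y0 y1 this] have "P y * k y = 0" by auto
      then have "poly (poly (p1 * p2) [:x:]) t = 0"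
        using p1[of "[:x:]" t] p2[of "[:x:]" t] by (simp add: y_def)
      moreover have "poly (poly \<Phi> [:x:]) t = 0"
        using x by (simp add: \<Phi>_def poly_monom poly_power)
      ultimately have "poly (poly \<rho> [:x:]) t = 0" unfolding eq by simp
      then show "x \<in> {x. poly (map_poly (\<lambda>c. poly c t) \<rho>) x = 0}"
        by (simp add: poly_map_poly_eval)
    qed
    then have "q + 1 \<le> card {x. poly (map_poly (\<lambda>c. poly c t) \<rho>) x = 0}"
      using S(2) poly_roots_finite[OF nz] by (metis card_mono)
    also have "\<dots> \<le> degree (map_poly (\<lambda>c. poly c t) \<rho>)" by (rule card_poly_roots_bound[OF nz])
    also have "\<dots> \<le> degree \<rho>" by (rule map_poly_degree_leq)
    also have "\<dots> < q + 1" using deg\<rho> nz by (cases "\<rho> = 0") auto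
    finally show False by simp
  qed
  have "\<rho> = 0"
  proof (rule poly_eqI)
    fix i
    have "coeff \<rho> i = 0"
    proof (rule poly_eqI_cofinite)
      show "finite {t. poly R t = 0}" by (rule poly_roots_finite[OF R0])
      fix t assume "t \<notin> {t. poly R t = 0}"
      then have "coeff (map_poly (\<lambda>c. poly c t) \<rho>) i = 0" using \<rho>t by simp
      then show "poly (coeff \<rho> i) t = poly 0 t" by (simp add: coeff_map_poly)
    qed
    then show "coeff \<rho> i = coeff 0 i" by simp
  qed
  \<comment> \<open>Substituting z_j + t v_j for the outer variable returns to the line z + t v.
    There P k is a multiple of the equation \<open>E\<close>, which vanishes to second order at t =
    0 by tangency.\<close>
  define A B where "A = poly p1 [:z j, v j:]" and "B = poly p2 [:z j, v j:]"
  have upd: "(\<lambda>i. z i + t * v i)(j := poly [:z j, v j:] t) = (\<lambda>i. z i + t * v i)" for t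
    by auto
  have A: "poly A t = P (\<lambda>i. z i + t * v i)" for t unfolding A_def p1 upd ..
  have B: "poly B t = k (\<lambda>i. z i + t * v i)" for t unfolding B_def p2 upd ..
  define E where "E = (\<Sum>i\<le>n. [:z i, v i:] ^ (q + 1))"
  have "poly \<Phi> [:z j, v j:] = E"
    unfolding E_def \<Phi>_def R_def using jn
    by (subst sum.remove[of "{..n}" j]) (auto simp: poly_monom)
  then have AB: "A * B = E * poly Q [:z j, v j:]"
    unfolding A_def B_def using eq \<open>\<rho> = 0\<close> by (metis add.right_neutral poly_mult)
  have E: "coeff E 0 = 0" "coeff E 1 = 0"
    unfolding E_def coeff_sum using tan
    by (simp_all only: coeff_linear_power_Suc_q) (simp_all add: cone_tangent_def)
  have B0: "coeff B 0 \<noteq> 0" using coeff_0_along_line[OF B] kz by simp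
  have "coeff A 0 * coeff B 0 = 0"
    using arg_cong[OF AB, of "\<lambda>p. coeff p 0"] E by (simp add: coeff_mult)
  then have A0: "coeff A 0 = 0" using B0 by simp
  have "coeff A 1 * coeff B 0 = 0"
    using arg_cong[OF AB, of "\<lambda>p. coeff p 1"] E A0 unfolding coeff_1_mult by simp
  then have A1: "coeff A 1 = 0" using B0 by simp
  show "P z = 0" using coeff_0_along_line[OF A] A0 by simp
  show "dderiv P z v = 0" using dderiv_eq[OF A] A1 by simp
qed

end

subsection \<open>Derivatives of regular functions\<close>

definition local_quotient ::
  "nat \<Rightarrow> (nat \<Rightarrow> 'k::field) set set \<Rightarrow> ((nat \<Rightarrow> 'k) set \<Rightarrow> 'k) \<Rightarrow> (nat \<Rightarrow> 'k) set \<Rightarrow>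
    nat \<Rightarrow> ((nat \<Rightarrow> 'k) \<Rightarrow> 'k) \<Rightarrow> ((nat \<Rightarrow> 'k) \<Rightarrow> 'k) \<Rightarrow> bool" where
  "local_quotient n X f P d g h \<longleftrightarrow> form n d g \<and> form n d h \<and>
     (\<exists>V. zopen n X V \<and> P \<in> V \<and> (\<forall>R\<in>V. \<forall>x\<in>R. h x \<noteq> 0 \<and> f (proj_pt x) = g x / h x))"

text \<open>The derivative of \<open>f\<close>, as a function on the cone, by the quotient rule for
  a local presentation g / h. That the presentation does not matter when \<open>v\<close> is tangent
  to the cone is shown in \<open>dfun_eq\<close>.\<close>

definition dfun ::
  "nat \<Rightarrow> (nat \<Rightarrow> 'k::alg_closed_field) set set \<Rightarrow> ((nat \<Rightarrow> 'k) set \<Rightarrow> 'k) \<Rightarrow>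
     (nat \<Rightarrow> 'k) \<Rightarrow> (nat \<Rightarrow> 'k) \<Rightarrow> 'k" where
  "dfun n X f z v = (THE r. \<exists>d g h. local_quotient n X f (proj_pt z) d g h \<and>
     r = (dderiv g z v * h z - g z * dderiv h z v) / (h z)\<^sup>2)"

lemma local_quotientE:
  assumes "local_quotient n X f P d g h"
  obtains V where "form n d g" "form n d h" "zopen n X V" "P \<in> V"
    "\<And>R x. R \<in> V \<Longrightarrow> x \<in> R \<Longrightarrow> h x \<noteq> 0" "\<And>R x. R \<in> V \<Longrightarrow> x \<in> R \<Longrightarrow> f (proj_pt x) = g x / h x"
  using assms unfolding local_quotient_def by blast

lemma local_quotientI:
  assumes "form n d g" "form n d h" "zopen n X V" "P \<in> V"
    "\<And>R x. R \<in> V \<Longrightarrow> x \<in> R \<Longrightarrow> h x \<noteq> 0" "\<And>R x. R \<in> V \<Longrightarrow> x \<in> R \<Longrightarrow> f (proj_pt x) = g x / h x"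
  shows "local_quotient n X f P d g h"
  using assms unfolding local_quotient_def by blast

lemma local_quotient_at:
  assumes "local_quotient n X f (proj_pt z) d g h"
  shows "h z \<noteq> 0" "f (proj_pt z) = g z / h z"
  using assms proj_pt_refl[of z] unfolding local_quotient_def by blast+

lemma regular_local_quotient:
  assumes "regular n X W f" "P \<in> W"
  obtains d g h where "local_quotient n X f P d g h"
proof -
  obtain V g h d d' where *: "zopen n X V" "P \<in> V" "V \<subseteq> W" "form n d g" "form n d' h" "int d = int d' + 0"
    "\<forall>Q\<in>V. \<forall>x\<in>Q. h x \<noteq> 0 \<and> f (proj_pt x) = g x / h x"
    using assms unfolding regular_def twist_section_def by meson
  then have "local_quotient n X f P d g h" by (intro local_quotientI[of n d g h X V]) auto
  then show ?thesis by (rule that)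
qed

lemma regularI_local_quotient:
  assumes "zopen n X W" "X \<subseteq> proj_space n" "\<And>P. P \<in> W \<Longrightarrow> \<exists>d g h. local_quotient n X f P d g h"
  shows "regular n X W f"
  unfolding regular_def twist_section_def
proof
  fix P assume P: "P \<in> W"
  then obtain d g h where "local_quotient n X f P d g h" using assms(3) by blast
  then obtain V where V: "form n d g" "form n d h" "zopen n X V" "P \<in> V"
    "\<And>R x. R \<in> V \<Longrightarrow> x \<in> R \<Longrightarrow> h x \<noteq> 0" "\<And>R x. R \<in> V \<Longrightarrow> x \<in> R \<Longrightarrow> f (proj_pt x) = g x / h x"
    by (rule local_quotientE) (rule that)
  show "\<exists>V g h d d'. zopen n X V \<and> P \<in> V \<and> V \<subseteq> W \<and> form n d g \<and> form n d' h \<and> int d = int d' + 0 \<and>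
        (\<forall>Q\<in>V. \<forall>x\<in>Q. h x \<noteq> 0 \<and> f (proj_pt x) = g x / h x)"
    using V P zopen_Int[OF V(3) assms(1,2)]
    by (intro exI[of _ "V \<inter> W"] exI[of _ g] exI[of _ h] exI[of _ d]) auto
qed

lemma local_quotient_cong:
  assumes "local_quotient n X f P d g h" "zopen n X W" "P \<in> W" "X \<subseteq> proj_space n"
    and "\<And>R. R \<in> W \<Longrightarrow> f R = f' R"
  shows "local_quotient n X f' P d g h"
proof -
  obtain V where V: "form n d g" "form n d h" "zopen n X V" "P \<in> V"
    "\<And>R x. R \<in> V \<Longrightarrow> x \<in> R \<Longrightarrow> h x \<noteq> 0" "\<And>R x. R \<in> V \<Longrightarrow> x \<in> R \<Longrightarrow> f (proj_pt x) = g x / h x"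
    using assms(1) by (rule local_quotientE) (rule that)
  show ?thesis
  proof (rule local_quotientI[OF V(1,2) zopen_Int[OF V(3) assms(2,4)]])
    fix R x assume R: "R \<in> V \<inter> W" "x \<in> R"
    then show "h x \<noteq> 0" using V(5) by blast
    have "R \<in> proj_space n" using R assms(2,4) zopen_subset by blast
    then have "R = proj_pt x" using R proj_spaceD(1) by blast
    then have "f' (proj_pt x) = f (proj_pt x)" using R assms(5) by auto
    then show "f' (proj_pt x) = g x / h x" using V(6) R by auto
  qed (use V assms in auto)
qed

lemma local_quotient_const: "X \<subseteq> proj_space n \<Longrightarrow> P \<in> X \<Longrightarrow> local_quotient n X (\<lambda>_. c) P 0 (\<lambda>_. c) (\<lambda>_. 1)"
  by (rule local_quotientI[of _ _ _ _ _ X]) (simp_all add: form_const zopen_whole)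

lemma local_quotient_add:
  assumes "local_quotient n X f P d g h" "local_quotient n X f' P d' g' h'" "X \<subseteq> proj_space n"
  shows "local_quotient n X (\<lambda>P. f P + f' P) P (d + d') (\<lambda>x. g x * h' x + h x * g' x) (\<lambda>x. h x * h' x)"
proof -
  obtain V where V: "form n d g" "form n d h" "zopen n X V" "P \<in> V"
    "\<And>R x. R \<in> V \<Longrightarrow> x \<in> R \<Longrightarrow> h x \<noteq> 0" "\<And>R x. R \<in> V \<Longrightarrow> x \<in> R \<Longrightarrow> f (proj_pt x) = g x / h x"
    using assms(1) by (rule local_quotientE) (rule that)
  obtain V' where V': "form n d' g'" "form n d' h'" "zopen n X V'" "P \<in> V'"
    "\<And>R x. R \<in> V' \<Longrightarrow> x \<in> R \<Longrightarrow> h' x \<noteq> 0" "\<And>R x. R \<in> V' \<Longrightarrow> x \<in> R \<Longrightarrow> f' (proj_pt x) = g' x / h' x"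
    using assms(2) by (rule local_quotientE) (rule that)
  show ?thesis
  proof (rule local_quotientI[OF _ _ zopen_Int[OF V(3) V'(3) assms(3)]])
    fix R x assume "R \<in> V \<inter> V'" "x \<in> R"
    then have "h x \<noteq> 0" "h' x \<noteq> 0" "f (proj_pt x) = g x / h x" "f' (proj_pt x) = g' x / h' x"
      using V V' by blast+
    then show "h x * h' x \<noteq> 0" "f (proj_pt x) + f' (proj_pt x) = (g x * h' x + h x * g' x) / (h x * h' x)"
      by (simp_all add: field_simps)
  qed (use V V' in \<open>auto intro: form_add form_mult\<close>)
qed

lemma local_quotient_mult:
  assumes "local_quotient n X f P d g h" "local_quotient n X f' P d' g' h'" "X \<subseteq> proj_space n"
  shows "local_quotient n X (\<lambda>P. f P * f' P) P (d + d') (\<lambda>x. g x * g' x) (\<lambda>x. h x * h' x)"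
proof -
  obtain V where V: "form n d g" "form n d h" "zopen n X V" "P \<in> V"
    "\<And>R x. R \<in> V \<Longrightarrow> x \<in> R \<Longrightarrow> h x \<noteq> 0" "\<And>R x. R \<in> V \<Longrightarrow> x \<in> R \<Longrightarrow> f (proj_pt x) = g x / h x"
    using assms(1) by (rule local_quotientE) (rule that)
  obtain V' where V': "form n d' g'" "form n d' h'" "zopen n X V'" "P \<in> V'"
    "\<And>R x. R \<in> V' \<Longrightarrow> x \<in> R \<Longrightarrow> h' x \<noteq> 0" "\<And>R x. R \<in> V' \<Longrightarrow> x \<in> R \<Longrightarrow> f' (proj_pt x) = g' x / h' x"
    using assms(2) by (rule local_quotientE) (rule that)
  show ?thesis
  proof (rule local_quotientI[OF _ _ zopen_Int[OF V(3) V'(3) assms(3)]])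
    fix R x assume "R \<in> V \<inter> V'" "x \<in> R"
    then have "h x \<noteq> 0" "h' x \<noteq> 0" "f (proj_pt x) = g x / h x" "f' (proj_pt x) = g' x / h' x"
      using V V' by blast+
    then show "h x * h' x \<noteq> 0" "f (proj_pt x) * f' (proj_pt x) = (g x * g' x) / (h x * h' x)"
      by simp_all
  qed (use V V' in \<open>auto intro: form_mult\<close>)
qed

lemma regular_const: "zopen n X W \<Longrightarrow> X \<subseteq> proj_space n \<Longrightarrow> regular n X W (\<lambda>_. c)"
  by (rule regularI_local_quotient) (use zopen_subset local_quotient_const in blast)+

lemma regular_add:
  assumes "zopen n X W" "X \<subseteq> proj_space n" "regular n X W f" "regular n X W f'"
  shows "regular n X W (\<lambda>P. f P + f' P)"
proof (rule regularI_local_quotient[OF assms(1,2)])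
  fix P assume P: "P \<in> W"
  obtain d g h where "local_quotient n X f P d g h" using regular_local_quotient[OF assms(3) P] .
  moreover obtain d' g' h' where "local_quotient n X f' P d' g' h'"
    using regular_local_quotient[OF assms(4) P] .
  ultimately show "\<exists>d g h. local_quotient n X (\<lambda>P. f P + f' P) P d g h"
    using local_quotient_add[OF _ _ assms(2)] by blast
qed

lemma regular_mult:
  assumes "zopen n X W" "X \<subseteq> proj_space n" "regular n X W f" "regular n X W f'"
  shows "regular n X W (\<lambda>P. f P * f' P)"
proof (rule regularI_local_quotient[OF assms(1,2)])
  fix P assume P: "P \<in> W"
  obtain d g h where "local_quotient n X f P d g h" using regular_local_quotient[OF assms(3) P] .
  moreover obtain d' g' h' where "local_quotient n X f' P d' g' h'"
    using regular_local_quotient[OF assms(4) P] .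
  ultimately show "\<exists>d g h. local_quotient n X (\<lambda>P. f P * f' P) P d g h"
    using local_quotient_mult[OF _ _ assms(2)] by blast
qed

lemma regular_power:
  assumes "zopen n X W" "X \<subseteq> proj_space n" "regular n X W f"
  shows "regular n X W (\<lambda>P. f P ^ k)"
  by (induction k) (simp_all add: regular_const regular_mult assms)

lemma regular_sum:
  assumes "zopen n X W" "X \<subseteq> proj_space n" "\<And>i. i \<in> I \<Longrightarrow> regular n X W (f i)"
  shows "regular n X W (\<lambda>P. \<Sum>i\<in>I. f i P)"
  using assms(3)
  by (induction I rule: infinite_finite_induct)
     (simp_all add: regular_const regular_add assms(1,2))

section \<open>Well-definedness and rules of the derivative on the Fermat hypersurface\<close>

context char_power
begin

text \<open>In spite of its name a set of projective points; the affine cone itself appears in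
  \<open>cone_tangent\<close>.\<close>

abbreviation fermat_cone :: "nat \<Rightarrow> (nat \<Rightarrow> 'k) set set" where
  "fermat_cone n \<equiv> fermat n (q + 1)"

lemma fermat_proj_space: "fermat_cone n \<subseteq> proj_space n"
  unfolding fermat_def by blast

lemma proj_pt_in_fermat:
  assumes "\<forall>i>n. z i = 0" "z j \<noteq> 0" "(\<Sum>i\<le>n. z i ^ (q + 1)) = 0"
  shows "proj_pt z \<in> fermat_cone n"
  unfolding fermat_def
proof (intro CollectI conjI ballI)
  show "proj_pt z \<in> proj_space n" by (rule proj_spaceI[OF assms(1,2)])
  fix x assume "x \<in> proj_pt z"
  then obtain c where "x = (\<lambda>i. c * z i)" by (rule proj_ptE)
  then have "(\<Sum>i\<le>n. x i ^ (q + 1)) = c ^ (q + 1) * (\<Sum>i\<le>n. z i ^ (q + 1))"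
    by (simp only: power_mult_distrib sum_distrib_left)
  then show "(\<Sum>i\<le>n. x i ^ (q + 1)) = 0" using assms(3) by simp
qed

text \<open>For two presentations the form g h' - g' h vanishes on an open part of the cone, so by
  \<open>vanishing_to_second_order\<close> its derivative along \<open>v\<close> vanishes too. By
  the product rule this says that the two quotient rule expressions agree.\<close>

lemma dfun_eq:
  assumes lq: "local_quotient n (fermat_cone n) f (proj_pt z) d g h" and tan: "cone_tangent n z v"
  shows "dfun n (fermat_cone n) f z v = (dderiv g z v * h z - g z * dderiv h z v) / (h z)\<^sup>2"
  unfolding dfun_def
proof (rule the_equality)
  fix r assume "\<exists>d g h. local_quotient n (fermat_cone n) f (proj_pt z) d g h \<and>
     r = (dderiv g z v * h z - g z * dderiv h z v) / (h z)\<^sup>2"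
  then obtain d' g' h' where lq': "local_quotient n (fermat_cone n) f (proj_pt z) d' g' h'"
    and r: "r = (dderiv g' z v * h' z - g' z * dderiv h' z v) / (h' z)\<^sup>2" by blast
  obtain V where V: "form n d g" "form n d h" "zopen n (fermat_cone n) V" "proj_pt z \<in> V"
    "\<And>R x. R \<in> V \<Longrightarrow> x \<in> R \<Longrightarrow> h x \<noteq> 0" "\<And>R x. R \<in> V \<Longrightarrow> x \<in> R \<Longrightarrow> f (proj_pt x) = g x / h x"
    using lq by (rule local_quotientE) (rule that)
  obtain V' where V': "form n d' g'" "form n d' h'" "zopen n (fermat_cone n) V'" "proj_pt z \<in> V'"
    "\<And>R x. R \<in> V' \<Longrightarrow> x \<in> R \<Longrightarrow> h' x \<noteq> 0" "\<And>R x. R \<in> V' \<Longrightarrow> x \<in> R \<Longrightarrow> f (proj_pt x) = g' x / h' x"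
    using lq' by (rule local_quotientE) (rule that)
  have "zopen n (fermat_cone n) (V \<inter> V')" by (rule zopen_Int[OF V(3) V'(3) fermat_proj_space])
  then obtain e k where k: "form n e k" "\<And>x. x \<in> proj_pt z \<Longrightarrow> k x \<noteq> 0"
    "\<And>R x. R \<in> fermat_cone n \<Longrightarrow> x \<in> R \<Longrightarrow> k x \<noteq> 0 \<Longrightarrow> R \<in> V \<inter> V'"
    using zopen_nbhd[OF _ fermat_proj_space, of n "V \<inter> V'" "proj_pt z"] V(4) V'(4) by blast
  define P where "P = (\<lambda>x. g x * h' x - g' x * h x)"
  have f1: "form n (d + d') (\<lambda>x. g x * h' x)" by (rule form_mult[OF V(1) V'(2)])
  have f2: "form n (d' + d) (\<lambda>x. g' x * h x)" by (rule form_mult[OF V'(1) V(2)])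
  have f2': "form n (d + d') (\<lambda>x. g' x * h x)" using f2 by (simp add: add.commute)
  have P: "form n (d + d') P" unfolding P_def by (rule form_diff[OF f1 f2'])
  have van: "P y = 0" if y: "\<forall>i>n. y i = 0" "\<exists>i. y i \<noteq> 0" "(\<Sum>i\<le>n. y i ^ (q + 1)) = 0" "k y \<noteq> 0" for y
  proof -
    have "proj_pt y \<in> V \<inter> V'" using k(3)[OF _ proj_pt_refl] y proj_pt_in_fermat by blast
    then have "g y / h y = g' y / h' y" "h y \<noteq> 0" "h' y \<noteq> 0"
      using V(5,6)[OF _ proj_pt_refl] V'(5,6)[OF _ proj_pt_refl] by (metis IntE)+
    then show ?thesis by (simp add: P_def frac_eq_eq)
  qed
  have z: "P z = 0" "dderiv P z v = 0"
    using vanishing_to_second_order[OF P k(1) k(2)[OF proj_pt_refl] tan van] by blast+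
  have nz: "h z \<noteq> 0" "h' z \<noteq> 0" using local_quotient_at lq lq' by blast+
  define \<rho> where "\<rho> = f (proj_pt z)"
  have g: "g z = \<rho> * h z" "g' z = \<rho> * h' z"
    unfolding \<rho>_def using local_quotient_at(2)[OF lq] nz(1)
      local_quotient_at(2)[OF lq'] nz(2) by (metis nonzero_divide_eq_eq)+
  have "g z * dderiv h' z v + h' z * dderiv g z v - (g' z * dderiv h z v + h z * dderiv g' z v) = 0"
    using z(2) unfolding P_def dderiv_diff[OF f1 f2] dderiv_mult[OF V(1) V'(2)] dderiv_mult[OF V'(1) V(2)] .
  then have key: "h' z * (dderiv g z v - \<rho> * dderiv h z v) = h z * (dderiv g' z v - \<rho> * dderiv h' z v)"
    unfolding g by (simp add: algebra_simps)
  have 1: "(dderiv g z v * h z - g z * dderiv h z v) / (h z)\<^sup>2 = (dderiv g z v - \<rho> * dderiv h z v) / h z"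
    unfolding g using nz by (simp add: power2_eq_square field_simps)
  have 2: "r = (dderiv g' z v - \<rho> * dderiv h' z v) / h' z"
    unfolding r g using nz by (simp add: power2_eq_square field_simps)
  show "r = (dderiv g z v * h z - g z * dderiv h z v) / (h z)\<^sup>2"
    unfolding 1 2 using key nz by (simp add: frac_eq_eq mult.commute)
qed (use lq in blast)

lemma dfun_combine:
  assumes "local_quotient n (fermat_cone n) f (proj_pt z) d g h" "cone_tangent n z v" "cone_tangent n z w"
  shows "dfun n (fermat_cone n) f z (\<lambda>i. a * v i + b * w i) =
    a * dfun n (fermat_cone n) f z v + b * dfun n (fermat_cone n) f z w"
proof -
  have t: "cone_tangent n z (\<lambda>i. a * v i + b * w i)"
  proof -
    have "(\<Sum>i\<le>n. z i ^ q * (a * v i + b * w i)) = a * (\<Sum>i\<le>n. z i ^ q * v i) + b * (\<Sum>i\<le>n. z i ^ q * w i)"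
      by (simp add: sum_distrib_left sum.distrib algebra_simps)
    then show ?thesis using assms(2,3) unfolding cone_tangent_def by simp
  qed
  have fo: "form n d g" "form n d h" using assms(1) unfolding local_quotient_def by auto
  show ?thesis
    unfolding dfun_eq[OF assms(1) t] dfun_eq[OF assms(1,2)] dfun_eq[OF assms(1,3)]
      dderiv_combine[OF fo(1)] dderiv_combine[OF fo(2)]
    by (simp add: algebra_simps add_divide_distrib diff_divide_distrib)
qed

lemma dfun_cong:
  assumes "local_quotient n (fermat_cone n) f (proj_pt z) d g h" "cone_tangent n z v"
    and "zopen n (fermat_cone n) W" "proj_pt z \<in> W" "\<And>R. R \<in> W \<Longrightarrow> f R = f' R"
  shows "dfun n (fermat_cone n) f' z v = dfun n (fermat_cone n) f z v"
  using dfun_eq[OF assms(1,2)]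
    dfun_eq[OF local_quotient_cong[OF assms(1,3,4) fermat_proj_space assms(5)] assms(2)] by simp

lemma cone_tangent_in_fermat: "cone_tangent n z v \<Longrightarrow> proj_pt z \<in> fermat_cone n"
  using proj_pt_in_fermat unfolding cone_tangent_def by blast

lemma dfun_mult:
  assumes "local_quotient n (fermat_cone n) f (proj_pt z) d g h" "cone_tangent n z v"
    and "local_quotient n (fermat_cone n) f' (proj_pt z) d' g' h'"
  shows "dfun n (fermat_cone n) (\<lambda>P. f P * f' P) z v =
    f (proj_pt z) * dfun n (fermat_cone n) f' z v + f' (proj_pt z) * dfun n (fermat_cone n) f z v"
proof -
  have fo: "form n d g" "form n d h" "form n d' g'" "form n d' h'"
    using assms(1,3) unfolding local_quotient_def by auto
  have nz: "h z \<noteq> 0" "h' z \<noteq> 0" using local_quotient_at assms by blast+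
  show ?thesis
    unfolding dfun_eq[OF local_quotient_mult[OF assms(1,3) fermat_proj_space] assms(2)]
      dfun_eq[OF assms(1,2)] dfun_eq[OF assms(3,2)] local_quotient_at(2)[OF assms(1)]
      local_quotient_at(2)[OF assms(3)] dderiv_mult[OF fo(1,3)] dderiv_mult[OF fo(2,4)]
    using nz by (simp add: field_simps power2_eq_square)
qed

lemma dfun_add:
  assumes "local_quotient n (fermat_cone n) f (proj_pt z) d g h" "cone_tangent n z v"
    and "local_quotient n (fermat_cone n) f' (proj_pt z) d' g' h'"
  shows "dfun n (fermat_cone n) (\<lambda>P. f P + f' P) z v =
    dfun n (fermat_cone n) f z v + dfun n (fermat_cone n) f' z v"
proof -
  have fo: "form n d g" "form n d h" "form n d' g'" "form n d' h'"
    using assms(1,3) unfolding local_quotient_def by auto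
  have nz: "h z \<noteq> 0" "h' z \<noteq> 0" using local_quotient_at assms by blast+
  show ?thesis
    unfolding dfun_eq[OF local_quotient_add[OF assms(1,3) fermat_proj_space] assms(2)]
      dfun_eq[OF assms(1,2)] dfun_eq[OF assms(3,2)]
      dderiv_add[OF form_mult[OF fo(1,4)] form_mult[OF fo(2,3)]]
      dderiv_mult[OF fo(1,4)] dderiv_mult[OF fo(2,3)] dderiv_mult[OF fo(2,4)]
    using nz by (simp add: field_simps power2_eq_square)
qed

lemma dfun_scale:
  assumes "local_quotient n (fermat_cone n) f (proj_pt z) d g h" "cone_tangent n z v"
  shows "dfun n (fermat_cone n) (\<lambda>P. c * f P) z v = c * dfun n (fermat_cone n) f z v"
proof -
  have lc: "local_quotient n (fermat_cone n) (\<lambda>_. c) (proj_pt z) 0 (\<lambda>_. c) (\<lambda>_. 1)"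
    by (rule local_quotient_const[OF fermat_proj_space cone_tangent_in_fermat[OF assms(2)]])
  show ?thesis
    using dfun_mult[OF lc assms(2) assms(1)] dfun_eq[OF lc assms(2)] by simp
qed

end

subsection \<open>Morphisms from the projective line are given by binary forms\<close>

text \<open>A function of points obtained from an arbitrary representative; for forms of equal
  degree the scalar cancels.\<close>

definition form_quotient :: "((nat \<Rightarrow> 'k::field) \<Rightarrow> 'k) \<Rightarrow> ((nat \<Rightarrow> 'k) \<Rightarrow> 'k) \<Rightarrow> (nat \<Rightarrow> 'k) set \<Rightarrow> 'k" where
  "form_quotient g h P = (let z = (SOME z. z \<in> P) in g z / h z)"

lemma form_quotient_proj_pt:
  assumes "form n d g" "form n d h"
  shows "form_quotient g h (proj_pt z) = g z / h z"
proof -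
  have "(SOME y. y \<in> proj_pt z) \<in> proj_pt z" using proj_pt_refl[of z] by (rule someI[of "\<lambda>y. y \<in> proj_pt z"])
  then obtain c where c: "c \<noteq> 0" "(SOME y. y \<in> proj_pt z) = (\<lambda>i. c * z i)" by (rule proj_ptE)
  show ?thesis
    unfolding form_quotient_def Let_def c(2) form_homogeneous[OF assms(1)] form_homogeneous[OF assms(2)]
    using c(1) by simp
qed

lemma local_quotient_form_quotient:
  assumes "form n d g" "form n d h" "X \<subseteq> proj_space n" "P \<in> {P \<in> X. \<exists>x\<in>P. h x \<noteq> 0}"
  shows "local_quotient n X (form_quotient g h) P d g h"
proof (rule local_quotientI[OF assms(1,2) zopen_basic[OF assms(2)] assms(4)])
  fix R x assume R: "R \<in> {P \<in> X. \<exists>x\<in>P. h x \<noteq> 0}" "x \<in> R"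
  then obtain y where y: "y \<in> R" "h y \<noteq> 0" by blast
  then have "R = proj_pt y" using R(1) assms(3) proj_spaceD(1) by blast
  then show "h x \<noteq> 0" using form_proj_pt_nonzero[OF assms(2) _ y(2)] R(2) by blast
qed (rule form_quotient_proj_pt[OF assms(1,2)])

lemma regular_form_quotient:
  assumes "form n d g" "form n d h" "X \<subseteq> proj_space n" "zopen n X W" "W \<subseteq> {P \<in> X. \<exists>x\<in>P. h x \<noteq> 0}"
  shows "regular n X W (form_quotient g h)"
  by (rule regularI_local_quotient[OF assms(4,3)]) (use local_quotient_form_quotient[OF assms(1-3)] assms(5) in blast)

definition bin_vec :: "(nat \<Rightarrow> 'k::field) \<Rightarrow> bool" where
  "bin_vec x \<longleftrightarrow> (\<forall>i>1. x i = 0) \<and> (x 0 \<noteq> 0 \<or> x 1 \<noteq> 0)"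

lemma bin_vec_P1: "bin_vec x \<Longrightarrow> proj_pt x \<in> P1"
  unfolding bin_vec_def using proj_spaceI[of 1 x] by blast

lemma P1_bin_vec: "Q \<in> P1 \<Longrightarrow> x \<in> Q \<Longrightarrow> bin_vec x \<and> Q = proj_pt x"
proof -
  assume "Q \<in> P1" "x \<in> Q"
  note * = proj_spaceD[OF this]
  then obtain i where "i \<le> 1" "x i \<noteq> 0" by blast
  then have "i = 0 \<or> i = 1" by auto
  with * \<open>x i \<noteq> 0\<close> show ?thesis unfolding bin_vec_def by auto
qed

lemma bin_vec_pt: "bin_vec (pt t)" "bin_vec pt_inf"
  by (auto simp: bin_vec_def pt_def pt_inf_def)

lemma form_eqI_cofinite:
  fixes f g :: "(nat \<Rightarrow> 'k::alg_closed_field) \<Rightarrow> 'k"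
  assumes "form 1 d f" "form 1 d g" "finite S" "\<And>t. t \<notin> S \<Longrightarrow> f (pt t) = g (pt t)"
  shows "f = g"
proof -
  obtain p where p: "degree p \<le> d" "f = hom d p" using form_1_hom[OF assms(1)] .
  obtain r where r: "degree r \<le> d" "g = hom d r" using form_1_hom[OF assms(2)] .
  have "p = r"
    by (rule poly_eqI_cofinite[OF assms(3)])
       (use assms(4) in \<open>simp add: p(2) r(2) hom_pt[OF p(1)] hom_pt[OF r(1)]\<close>)
  then show ?thesis using p r by simp
qed

text \<open>With T_j nonzero at \<open>\<phi> Q\<close>, the regular functions T_i / T_j pull back
  to regular functions, that is, locally to quotients of binary forms. Clearing denominators gives
  homogeneous coordinates of \<open>\<phi>\<close>.\<close>

lemma morphism_local_forms:
  fixes \<phi> :: "(nat \<Rightarrow> 'k::alg_closed_field) set \<Rightarrow> (nat \<Rightarrow> 'k) set"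
  assumes "is_morphism n X \<phi>" "X \<subseteq> proj_space n" "Q \<in> P1"
  obtains V D p where "zopen 1 P1 V" "Q \<in> V" "\<And>i. degree (p i) \<le> D" "\<And>i. i > n \<Longrightarrow> p i = 0"
    "\<And>R x. R \<in> V \<Longrightarrow> x \<in> R \<Longrightarrow> \<exists>i. hom D (p i) x \<noteq> 0"
    "\<And>R x. R \<in> V \<Longrightarrow> x \<in> R \<Longrightarrow> \<phi> R = proj_pt (\<lambda>i. hom D (p i) x)"
proof -
  have \<phi>X: "\<phi> R \<in> X" if "R \<in> P1" for R using assms(1) that unfolding is_morphism_def by blast
  obtain z0 where z0: "\<phi> Q = proj_pt z0" "\<exists>i\<le>n. z0 i \<noteq> 0"
    using \<phi>X[OF assms(3)] assms(2) by (meson proj_spaceE subsetD)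
  then obtain j where j: "j \<le> n" "z0 j \<noteq> 0" by blast
  define W where "W = {P \<in> X. \<exists>x\<in>P. x j \<noteq> 0}"
  define fq :: "nat \<Rightarrow> (nat \<Rightarrow> 'k) set \<Rightarrow> 'k" where "fq i = form_quotient (\<lambda>x. x i) (\<lambda>x. x j)" for i
  have W: "zopen n X W" unfolding W_def by (rule zopen_basic[OF form_var[OF j(1)]])
  have Q: "Q \<in> preimage \<phi> W"
    unfolding preimage_def W_def using assms(3) \<phi>X z0(1) j(2) proj_pt_refl by blast
  have pre: "zopen 1 P1 (preimage \<phi> W)" using assms(1) W unfolding is_morphism_def by blast
  have lq: "\<exists>d g h. local_quotient 1 P1 (fq i \<circ> \<phi>) Q d g h" if "i \<le> n" for i
  proof -
    have "regular n X W (fq i)" unfolding fq_def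
      by (rule regular_form_quotient[OF form_var[OF that] form_var[OF j(1)] assms(2) W]) (simp add: W_def)
    then have "regular 1 P1 (preimage \<phi> W) (fq i \<circ> \<phi>)"
      using assms(1) W unfolding is_morphism_def by blast
    then show ?thesis using Q regular_local_quotient by blast
  qed
  define loc where "loc i V d g h \<longleftrightarrow> form 1 d g \<and> form 1 d h \<and> zopen 1 P1 V \<and> Q \<in> V \<and>
     (\<forall>R\<in>V. \<forall>x\<in>R. h x \<noteq> 0 \<and> (fq i \<circ> \<phi>) (proj_pt x) = g x / h x)" for i V d g h
  have "\<exists>V d g h. loc i V d g h" if "i \<le> n" for i
    using lq[OF that] unfolding local_quotient_def loc_def by blast
  then obtain V d g h where "\<And>i. i \<le> n \<Longrightarrow> loc i (V i) (d i) (g i) (h i)"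
    by metis
  then have loc: "\<And>i. i \<le> n \<Longrightarrow> form 1 (d i) (g i)" "\<And>i. i \<le> n \<Longrightarrow> form 1 (d i) (h i)"
    "\<And>i. i \<le> n \<Longrightarrow> zopen 1 P1 (V i)" "\<And>i. i \<le> n \<Longrightarrow> Q \<in> V i"
    "\<And>i. i \<le> n \<Longrightarrow> (\<forall>R\<in>V i. \<forall>x\<in>R. h i x \<noteq> 0 \<and> (fq i \<circ> \<phi>) (proj_pt x) = g i x / h i x)"
    unfolding loc_def by blast+
  define D where "D = (\<Sum>i\<le>n. d i)"
  \<comment> \<open>The numerator of T_i / T_j over the common denominator, the product of all h_k.
    All these numerators have the same degree \<open>D\<close>.\<close>
  define N where "N i = (\<lambda>x. g i x * (\<Prod>k\<in>{..n} - {i}. h k x))" for i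
  have "form 1 D (N i)" if "i \<le> n" for i
  proof -
    have "form 1 (d i + (\<Sum>k\<in>{..n} - {i}. d k)) (N i)"
      unfolding N_def using loc that by (intro form_mult form_prod) auto
    moreover have "D = d i + (\<Sum>k\<in>{..n} - {i}. d k)"
      unfolding D_def using that by (intro sum.remove) auto
    ultimately show ?thesis by simp
  qed
  then have "\<forall>i\<in>{..n}. \<exists>p. degree p \<le> D \<and> N i = hom D p" using form_1_hom by (metis atMost_iff)
  then obtain p0 where p0: "\<And>i. i \<le> n \<Longrightarrow> degree (p0 i) \<le> D" "\<And>i. i \<le> n \<Longrightarrow> N i = hom D (p0 i)"
    by (metis atMost_iff)
  define p where "p i = (if i \<le> n then p0 i else 0)" for i
  define V' where "V' = (P1 \<inter> (\<Inter>i\<in>{..n}. V i)) \<inter> preimage \<phi> W"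
  have key: "(\<exists>i. hom D (p i) x \<noteq> 0) \<and> \<phi> R = proj_pt (\<lambda>i. hom D (p i) x)" if R: "R \<in> V'" "x \<in> R" for R x
  proof -
    have RP: "R \<in> P1" "\<phi> R \<in> W" using R unfolding V'_def preimage_def by auto
    then have R': "R = proj_pt x" using R(2) proj_spaceD(1) by blast
    obtain z where z: "z \<in> \<phi> R" "z j \<noteq> 0" "\<phi> R \<in> X" using RP(2) unfolding W_def by blast
    then have "\<phi> R \<in> proj_space n" using assms(2) by blast
    note \<phi>R = proj_spaceD(1,2)[OF this z(1)]
    have h: "h i x \<noteq> 0" "g i x = z i / z j * h i x" if "i \<le> n" for i
    proof -
      have "R \<in> V i" using R that unfolding V'_def by auto
      then have *: "h i x \<noteq> 0" "fq i (\<phi> R) = g i x / h i x"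
        using loc(5)[OF that] R(2) unfolding R' by (auto simp: R')
      then show "h i x \<noteq> 0" by simp
      have "fq i (\<phi> R) = z i / z j" unfolding fq_def \<phi>R(1)
        by (rule form_quotient_proj_pt[OF form_var[OF that] form_var[OF j(1)]])
      with * show "g i x = z i / z j * h i x" by (metis nonzero_divide_eq_eq)
    qed
    define c where "c = (\<Prod>k\<le>n. h k x) / z j"
    have c: "c \<noteq> 0" unfolding c_def using h(1) z(2) by simp
    have "hom D (p i) x = c * z i" for i
    proof (cases "i \<le> n")
      case True
      have "hom D (p i) x = N i x"
        using fun_cong[OF p0(2)[OF True], of x] True by (simp add: p_def)
      also have "\<dots> = g i x * (\<Prod>k\<in>{..n} - {i}. h k x)" by (simp add: N_def)
      also have "\<dots> = z i / z j * (h i x * (\<Prod>k\<in>{..n} - {i}. h k x))"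
        unfolding h(2)[OF True] by (simp add: mult.assoc)
      also have "h i x * (\<Prod>k\<in>{..n} - {i}. h k x) = (\<Prod>k\<le>n. h k x)"
        using True by (intro prod.remove[symmetric]) auto
      finally show ?thesis unfolding c_def by simp
    next
      case False
      then show ?thesis using \<phi>R(2) by (simp add: p_def hom_def)
    qed
    then have eq: "(\<lambda>i. hom D (p i) x) = (\<lambda>i. c * z i)" by (rule ext)
    have "hom D (p j) x \<noteq> 0" using c z(2) fun_cong[OF eq, of j] by simp
    moreover have "\<phi> R = proj_pt (\<lambda>i. hom D (p i) x)" unfolding eq proj_pt_scale[OF c] \<phi>R(1) ..
    ultimately show ?thesis by blast
  qed
  show ?thesis
  proof (rule that[of V' p D])
    show "zopen 1 P1 V'" unfolding V'_def
      by (intro zopen_Int zopen_INT pre) (use loc in auto)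
    show "Q \<in> V'" unfolding V'_def using Q assms(3) loc(4) by auto
  qed (use key p0(1) in \<open>auto simp: p_def\<close>)
qed

text \<open>The maximum of the degrees works: the coefficient at \<open>d\<close> is the value at
  infinity, so a nonzero one excludes a common zero there.\<close>

lemma common_degree:
  fixes p :: "nat \<Rightarrow> 'k::field poly"
  assumes "\<exists>i\<le>n. p i \<noteq> 0"
  obtains d where "\<And>i. i \<le> n \<Longrightarrow> degree (p i) \<le> d" "\<exists>i\<le>n. coeff (p i) d \<noteq> 0"
proof -
  define I where "I = {i. i \<le> n \<and> p i \<noteq> 0}"
  have I: "finite I" "I \<noteq> {}" using assms unfolding I_def by auto
  define d where "d = Max ((\<lambda>i. degree (p i)) ` I)"
  have "d \<in> (\<lambda>i. degree (p i)) ` I" unfolding d_def using I by (intro Max_in) auto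
  then obtain i where "i \<in> I" "d = degree (p i)" by blast
  then have "\<exists>i\<le>n. coeff (p i) d \<noteq> 0" unfolding I_def by auto
  moreover have "degree (p i) \<le> d" if "i \<le> n" for i
  proof (cases "p i = 0")
    case False
    then show ?thesis unfolding d_def using I that by (intro Max_ge) (auto simp: I_def)
  qed simp
  ultimately show ?thesis by (rule that[rotated])
qed

text \<open>Homogeneous coordinates of \<open>\<phi>\<close>: the last condition excludes a common zero at infinity.\<close>

definition binary_coords :: "nat \<Rightarrow> nat \<Rightarrow> (nat \<Rightarrow> 'k::field poly) \<Rightarrow> bool" where
  "binary_coords n d fp \<longleftrightarrow> (\<forall>i. degree (fp i) \<le> d) \<and> (\<forall>i>n. fp i = 0) \<and>
     (\<forall>t. \<exists>i\<le>n. poly (fp i) t \<noteq> 0) \<and> (\<exists>i\<le>n. coeff (fp i) d \<noteq> 0)"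

definition hom_vec :: "nat \<Rightarrow> (nat \<Rightarrow> 'k::field poly) \<Rightarrow> (nat \<Rightarrow> 'k) \<Rightarrow> nat \<Rightarrow> 'k" where
  "hom_vec d fp x = (\<lambda>i. hom d (fp i) x)"

lemma hom_vec_nonzero:
  assumes "binary_coords n d fp" "bin_vec x"
  shows "\<exists>i\<le>n. hom_vec d fp x i \<noteq> 0"
proof (cases "x 0 = 0")
  case True
  then show ?thesis using assms unfolding binary_coords_def hom_vec_def bin_vec_def
    by (auto simp: hom_infinity)
next
  case False
  obtain i where "i \<le> n" "poly (fp i) (x 1 / x 0) \<noteq> 0" using assms(1) unfolding binary_coords_def by blast
  then show ?thesis using assms(1) False unfolding binary_coords_def hom_vec_def
    by (intro exI[of _ i]) (auto simp: hom_finite)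
qed

lemma hom_vec_above: "binary_coords n d fp \<Longrightarrow> i > n \<Longrightarrow> hom_vec d fp x i = 0"
  unfolding binary_coords_def hom_vec_def by (simp add: hom_def)

lemma form_hom_vec: "form 1 d (\<lambda>x. hom_vec d fp x i)"
  unfolding hom_vec_def by (rule form_hom)

text \<open>The coordinates found near infinity, divided by their common factor, serve on the whole
  line. Any other local coordinates p satisfy p_i f_k = p_k f_i on a cofinite set, hence
  identically, so the two vectors are proportional at every point of the neighbourhood.\<close>

lemma morphism_binary_coords:
  fixes \<phi> :: "(nat \<Rightarrow> 'k::alg_closed_field) set \<Rightarrow> (nat \<Rightarrow> 'k) set"
  assumes mor: "is_morphism n X \<phi>" and X: "X \<subseteq> proj_space n"
  obtains d fp where "binary_coords n d fp" "\<And>x. bin_vec x \<Longrightarrow> \<phi> (proj_pt x) = proj_pt (hom_vec d fp x)"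
proof -
  obtain V0 D0 p0 where 0: "zopen 1 P1 V0" "proj_pt pt_inf \<in> V0" "\<And>i. degree (p0 i) \<le> D0" "\<And>i. i > n \<Longrightarrow> p0 i = 0"
    "\<And>R x. R \<in> V0 \<Longrightarrow> x \<in> R \<Longrightarrow> \<exists>i. hom D0 (p0 i) x \<noteq> 0"
    "\<And>R x. R \<in> V0 \<Longrightarrow> x \<in> R \<Longrightarrow> \<phi> R = proj_pt (\<lambda>i. hom D0 (p0 i) x)"
    by (rule morphism_local_forms[OF mor X pt_in_P1(2)], rule that)
  obtain j where "hom D0 (p0 j) pt_inf \<noteq> 0" using 0(5)[OF 0(2) proj_pt_refl] by blast
  then have "p0 j \<noteq> 0" by (auto simp: hom_def)
  then have j: "p0 j \<noteq> 0" "j \<in> {..n}" using 0(4)[of j] by (auto simp: not_le[symmetric])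
  obtain g fp0 where g: "g \<noteq> 0" "\<And>i. i \<in> {..n} \<Longrightarrow> p0 i = g * fp0 i" "\<And>t. \<exists>i\<in>{..n}. poly (fp0 i) t \<noteq> 0"
    using cancel_common_roots[of j "{..n}" p0] j by blast
  define fp where "fp i = (if i \<le> n then fp0 i else 0)" for i
  have fp: "p0 i = g * fp i" for i using g(2)[of i] 0(4)[of i] unfolding fp_def by auto
  have nr: "\<exists>i\<le>n. poly (fp i) t \<noteq> 0" for t using g(3)[of t] unfolding fp_def by auto
  then have "\<exists>i\<le>n. fp i \<noteq> 0" by (metis poly_0)
  then obtain d where d: "\<And>i. i \<le> n \<Longrightarrow> degree (fp i) \<le> d" "\<exists>i\<le>n. coeff (fp i) d \<noteq> 0"
    by (rule common_degree) (rule that)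
  have deg: "degree (fp i) \<le> d" for i using d(1) unfolding fp_def by auto
  have bc: "binary_coords n d fp"
    unfolding binary_coords_def using deg nr d(2) by (auto simp: fp_def)
  have "\<phi> (proj_pt x) = proj_pt (hom_vec d fp x)" if x: "bin_vec x" for x
  proof -
    obtain V D p where 1: "zopen 1 P1 V" "proj_pt x \<in> V" "\<And>i. degree (p i) \<le> D" "\<And>i. i > n \<Longrightarrow> p i = 0"
      "\<And>R x. R \<in> V \<Longrightarrow> x \<in> R \<Longrightarrow> \<exists>i. hom D (p i) x \<noteq> 0"
      "\<And>R x. R \<in> V \<Longrightarrow> x \<in> R \<Longrightarrow> \<phi> R = proj_pt (\<lambda>i. hom D (p i) x)"
      by (rule morphism_local_forms[OF mor X bin_vec_P1[OF x]], rule that)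
    have eq: "p i * fp k = p k * fp i" for i k
    proof -
      have "p i * p0 k = p k * p0 i"
      proof (rule poly_eqI_cofinite)
        show "finite ({t. proj_pt (pt t) \<notin> V} \<union> {t. proj_pt (pt t) \<notin> V0})"
          using zopen_P1_cofinite[OF 1(1,2)] zopen_P1_cofinite[OF 0(1,2)] by simp
        fix u assume "u \<notin> {t. proj_pt (pt t) \<notin> V} \<union> {t. proj_pt (pt t) \<notin> V0}"
        then have u: "proj_pt (pt u) \<in> V" "proj_pt (pt u) \<in> V0" by auto
        have "proj_pt (\<lambda>i. hom D (p i) (pt u)) = proj_pt (\<lambda>i. hom D0 (p0 i) (pt u))"
          using 1(6)[OF u(1) proj_pt_refl] 0(6)[OF u(2) proj_pt_refl] by simp
        then have "(\<lambda>i. hom D (p i) (pt u)) \<in> proj_pt (\<lambda>i. hom D0 (p0 i) (pt u))"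
          using proj_pt_refl by metis
        then obtain c where "(\<lambda>i. hom D (p i) (pt u)) = (\<lambda>i. c * hom D0 (p0 i) (pt u))"
          by (rule proj_ptE)
        from fun_cong[OF this] have "poly (p i) u = c * poly (p0 i) u" for i
          unfolding hom_pt[OF 1(3)] hom_pt[OF 0(3)] .
        then show "poly (p i * p0 k) u = poly (p k * p0 i) u" by simp
      qed
      then have "g * (p i * fp k) = g * (p k * fp i)" unfolding fp by (simp add: algebra_simps)
      then show ?thesis using g(1) by simp
    qed
    have "\<phi> (proj_pt x) = proj_pt (\<lambda>i. hom D (p i) x)" by (rule 1(6)[OF 1(2) proj_pt_refl])
    also obtain i0 where i0: "hom D (p i0) x \<noteq> 0" using 1(5)[OF 1(2) proj_pt_refl] by blast
    obtain i1 where i1: "hom_vec d fp x i1 \<noteq> 0" using hom_vec_nonzero[OF bc x] by blast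
    have "proj_pt (\<lambda>i. hom D (p i) x) = proj_pt (hom_vec d fp x)"
    proof (rule proj_pt_eqI_proportional[of n _ _ i0 i1])
      fix i j
      have "hom (D + d) (p i * fp j) x = hom (D + d) (p j * fp i) x" unfolding eq[of i j] ..
      then show "hom D (p i) x * hom_vec d fp x j = hom D (p j) x * hom_vec d fp x i"
        unfolding hom_mult[OF 1(3) deg] hom_vec_def .
    qed (use i0 i1 1(4) hom_vec_above[OF bc] in \<open>simp_all add: hom_def\<close>)
    finally show ?thesis .
  qed
  then show ?thesis by (rule that[OF bc])
qed

subsection \<open>The degree of a morphism\<close>

text \<open>One normalised representative for each point of the line, so that divisors can be
  written as multisets of vectors.\<close>

definition std_pts :: "(nat \<Rightarrow> 'k::field) set" where
  "std_pts = insert pt_inf (range pt)"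

definition pt_form :: "(nat \<Rightarrow> 'k::field) \<Rightarrow> (nat \<Rightarrow> 'k) \<Rightarrow> 'k" where
  "pt_form y x = x 0 * y 1 - x 1 * y 0"

lemma form_pt_form: "form 1 1 (pt_form y)"
  unfolding pt_form_def[abs_def]
  using form_diff[OF form_scale[OF form_var[of 0 1], of "y 1"] form_scale[OF form_var[of 1 1], of "y 0"]]
  by (simp add: mult.commute)

lemma pt_form_std: "y \<in> std_pts \<Longrightarrow> y' \<in> std_pts \<Longrightarrow> pt_form y y' = 0 \<longleftrightarrow> y = y'"
  unfolding std_pts_def pt_form_def by auto

lemma std_pts_inj: "inj_on proj_pt (std_pts :: (nat \<Rightarrow> 'k::field) set)"
proof
  fix y y' :: "nat \<Rightarrow> 'k" assume *: "y \<in> std_pts" "y' \<in> std_pts" "proj_pt y = proj_pt y'"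
  then have "y \<in> proj_pt y'" using proj_pt_refl by metis
  then obtain c where "y = (\<lambda>i. c * y' i)" by (rule proj_ptE)
  then have "pt_form y y' = 0" by (simp add: pt_form_def)
  then show "y = y'" using * pt_form_std by blast
qed

lemma std_pts_bin_vec: "y \<in> std_pts \<Longrightarrow> bin_vec y"
  unfolding std_pts_def using bin_vec_pt by auto

lemma P1_std_pts: "P1 = proj_pt ` std_pts"
proof (intro equalityI subsetI)
  fix Q :: "(nat \<Rightarrow> 'a) set" assume "Q \<in> P1"
  then show "Q \<in> proj_pt ` std_pts" by (rule P1_cases) (auto simp: std_pts_def)
qed (use std_pts_bin_vec bin_vec_P1 in blast)

lemma hom_Suc_0: "hom (Suc 0) p x = coeff p 0 * x 0 + coeff p 1 * x 1"
  by (simp add: hom_def)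

text \<open>Induction on \<open>d\<close>: a root of \<open>p\<close> splits off a finite point, and
  a gap between \<open>degree p\<close> and \<open>d\<close> splits off
  \<open>pt_form pt_inf\<close>, which is x_0. Thus zeros at infinity are counted too and there are
  exactly \<open>d\<close> factors.\<close>

lemma hom_factorization:
  fixes p :: "'k::alg_closed_field poly"
  assumes "p \<noteq> 0" "degree p \<le> d"
  obtains c Y where "c \<noteq> 0" "size Y = d" "set_mset Y \<subseteq> std_pts"
    "\<And>x. hom d p x = c * (\<Prod>y\<in>#Y. pt_form y x)"
proof -
  have "\<exists>c Y. c \<noteq> 0 \<and> size Y = d \<and> set_mset Y \<subseteq> std_pts \<and> (\<forall>x. hom d p x = c * (\<Prod>y\<in>#Y. pt_form y x))"
    using assms
  proof (induction d arbitrary: p)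
    case 0
    then have "coeff p 0 \<noteq> 0" by (metis le_0_eq leading_coeff_0_iff)
    then show ?case by (intro exI[of _ "coeff p 0"] exI[of _ "{#}"]) (simp add: hom_def)
  next
    case (Suc d)
    show ?case
    proof (cases "degree p \<le> d")
      case True
      then obtain c Y where Y: "c \<noteq> 0" "size Y = d" "set_mset Y \<subseteq> std_pts"
        "\<And>x. hom d p x = c * (\<Prod>y\<in>#Y. pt_form y x)" using Suc by blast
      have "hom (Suc d) p x = pt_form pt_inf x * hom d p x" for x
        using hom_mult[of 1 1 p d x] True by (simp add: pt_form_def hom_Suc_0)
      with Y show ?thesis
        by (intro exI[of _ c] exI[of _ "add_mset pt_inf Y"]) (auto simp: std_pts_def)
    next
      case False
      then have deg: "degree p = Suc d" using Suc.prems by simp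
      then obtain r where "poly p r = 0" using alg_closed_imp_poly_has_root[of p] by auto
      then obtain s where s: "p = [:- r, 1:] * s" by (metis poly_eq_0_iff_dvd dvdE)
      have "s \<noteq> 0" using s Suc.prems by auto
      then have "degree ([:- r, 1:] * s) = Suc (degree s)" by (subst degree_mult_eq) auto
      then have ds: "degree s = d" using deg unfolding s by simp
      then obtain c Y where Y: "c \<noteq> 0" "size Y = d" "set_mset Y \<subseteq> std_pts"
        "\<And>x. hom d s x = c * (\<Prod>y\<in>#Y. pt_form y x)" using Suc.IH[OF \<open>s \<noteq> 0\<close>] by auto
      \<comment> \<open>\<open>pt_form (pt r)\<close> is r x_0 - x_1, the negative of the
        homogenised linear factor; hence the sign.\<close>
      have "hom (Suc d) p x = - (pt_form (pt r) x * hom d s x)" for x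
        using hom_mult[of "[:- r, 1:]" 1 s d x] ds unfolding s
        by (simp add: pt_form_def hom_Suc_0 algebra_simps del: mult_pCons_left)
      with Y show ?thesis
        by (intro exI[of _ "- c"] exI[of _ "add_mset (pt r) Y"]) (auto simp: std_pts_def)
    qed
  qed
  then show ?thesis using that by blast
qed

context
  fixes n d :: nat and \<phi> :: "(nat \<Rightarrow> 'k::alg_closed_field) set \<Rightarrow> (nat \<Rightarrow> 'k) set"
    and fp :: "nat \<Rightarrow> 'k poly"
  assumes bc: "binary_coords n d fp"
    and \<phi>: "\<And>x. bin_vec x \<Longrightarrow> \<phi> (proj_pt x) = proj_pt (hom_vec d fp x)"
begin

lemma form_linear_hom_vec:
  assumes "form n 1 l"
  shows "form 1 d (\<lambda>x. l (hom_vec d fp x))"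
  using form_comp[OF assms form_hom_vec[of d fp]] by simp

text \<open>The order m is realised by a coordinate h not vanishing at the image point and by u = B
  / H. For another order m', cancelling the smaller power of the point form leaves an identity of
  binary forms in which exactly one side vanishes at \<open>y\<close>.\<close>

lemma vanishing_order_eq:
  assumes l: "form n 1 l" and y: "y \<in> std_pts"
    and B: "form 1 (d - m) B" "m \<le> d" "B y \<noteq> 0"
    and L: "\<And>x. l (hom_vec d fp x) = pt_form y x ^ m * B x"
  shows "vanishing_order n \<phi> l (proj_pt y) = m"
  unfolding vanishing_order_def
proof (rule the_equality)
  have bvy: "bin_vec y" using y by (rule std_pts_bin_vec)
  obtain i where i: "i \<le> n" "hom_vec d fp y i \<noteq> 0" using hom_vec_nonzero[OF bc bvy] by blast
  define h :: "(nat \<Rightarrow> 'k) \<Rightarrow> 'k" where "h = (\<lambda>z. z i)"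
  have h: "form n 1 h" unfolding h_def by (rule form_var[OF i(1)])
  define H where "H = (\<lambda>x. h (hom_vec d fp x))"
  have H: "form 1 d H" unfolding H_def by (rule form_linear_hom_vec[OF h])
  define V where "V = {Q \<in> P1. \<exists>x\<in>Q. B x * H x \<noteq> 0}"
  have BH: "form 1 (d - m + d) (\<lambda>x. B x * H x)" by (rule form_mult[OF B(1) H])
  have V: "zopen 1 P1 V" unfolding V_def by (rule zopen_basic[OF BH])
  have yV: "proj_pt y \<in> V" unfolding V_def
    using B(3) i(2) bin_vec_P1[OF bvy] proj_pt_refl[of y] by (auto simp: H_def h_def)
  have nz: "B x \<noteq> 0 \<and> H x \<noteq> 0" if R: "R \<in> V" "x \<in> R" for R x
  proof -
    obtain x' where x': "x' \<in> R" "B x' * H x' \<noteq> 0" "R \<in> P1" using R(1) unfolding V_def by blast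
    then have "x \<in> proj_pt x'" using P1_bin_vec R(2) by blast
    from form_proj_pt_nonzero[OF BH this x'(2)] show ?thesis by auto
  qed
  show "\<exists>h V u ya. form n 1 h \<and> zopen 1 P1 V \<and> proj_pt y \<in> V \<and> ya \<in> proj_pt y \<and>
     twist_section 1 P1 (- int m) V u \<and> (\<forall>R\<in>V. \<forall>x\<in>R. u x \<noteq> 0 \<and>
        (\<forall>z\<in>\<phi> R. h z \<noteq> 0 \<and> l z / h z = (x 0 * ya 1 - x 1 * ya 0) ^ m * u x))"
  proof (rule exI[of _ h], rule exI[of _ V], rule exI[of _ "\<lambda>x. B x / H x"], rule exI[of _ y],
      intro conjI ballI h V yV proj_pt_refl)
    show "twist_section 1 P1 (- int m) V (\<lambda>x. B x / H x)"
      unfolding twist_section_def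
    proof
      fix P assume "P \<in> V"
      show "\<exists>V' g h da d'. zopen 1 P1 V' \<and> P \<in> V' \<and> V' \<subseteq> V \<and> form 1 da g \<and> form 1 d' h \<and>
          int da = int d' + - int m \<and> (\<forall>Q\<in>V'. \<forall>x\<in>Q. h x \<noteq> 0 \<and> B x / H x = g x / h x)"
        by (rule exI[of _ V], rule exI[of _ B], rule exI[of _ H],
            rule exI[of _ "d - m"], rule exI[of _ d]) (use V B(1,2) H nz \<open>P \<in> V\<close> in auto)
    qed
    fix R x assume R: "R \<in> V" "x \<in> R"
    then show "B x / H x \<noteq> 0" using nz by auto
    have bx: "bin_vec x" "R = proj_pt x" using R P1_bin_vec unfolding V_def by blast+
    fix z assume "z \<in> \<phi> R"
    then obtain c where c: "c \<noteq> 0" "z = (\<lambda>i. c * hom_vec d fp x i)"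
      unfolding bx(2) \<phi>[OF bx(1)] by (rule proj_ptE)
    have hz: "h z = c * H x" "l z = c * l (hom_vec d fp x)"
      unfolding c(2) H_def using form_homogeneous[OF h] form_homogeneous[OF l] by simp_all
    show "h z \<noteq> 0" unfolding hz using c(1) nz[OF R] by simp
    show "l z / h z = (x 0 * y 1 - x 1 * y 0) ^ m * (B x / H x)"
      unfolding hz L using c(1) by (simp add: pt_form_def)
  qed
  fix m' assume "\<exists>h V u ya. form n 1 h \<and> zopen 1 P1 V \<and> proj_pt y \<in> V \<and> ya \<in> proj_pt y \<and>
     twist_section 1 P1 (- int m') V u \<and> (\<forall>R\<in>V. \<forall>x\<in>R. u x \<noteq> 0 \<and>
        (\<forall>z\<in>\<phi> R. h z \<noteq> 0 \<and> l z / h z = (x 0 * ya 1 - x 1 * ya 0) ^ m' * u x))"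
  then obtain h V u ya where *: "form n 1 h" "zopen 1 P1 V" "proj_pt y \<in> V" "ya \<in> proj_pt y"
     "twist_section 1 P1 (- int m') V u" and
     all: "\<forall>R\<in>V. \<forall>x\<in>R. u x \<noteq> 0 \<and>
        (\<forall>z\<in>\<phi> R. h z \<noteq> 0 \<and> l z / h z = (x 0 * ya 1 - x 1 * ya 0) ^ m' * u x)"
    by (elim exE conjE)
  have u: "u x \<noteq> 0" if "R \<in> V" "x \<in> R" for R x
    using all that by blast
  have lh: "h z \<noteq> 0 \<and> l z / h z = (x 0 * ya 1 - x 1 * ya 0) ^ m' * u x"
    if "R \<in> V" "x \<in> R" "z \<in> \<phi> R" for R x z
    using all that by blast
  obtain V' g k e e' where g: "zopen 1 P1 V'" "proj_pt y \<in> V'" "V' \<subseteq> V" "form 1 e g" "form 1 e' k"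
      "int e = int e' + - int m'" "\<forall>Q\<in>V'. \<forall>x\<in>Q. k x \<noteq> 0 \<and> u x = g x / k x"
    using *(3,5) unfolding twist_section_def by meson
  obtain s where s: "s \<noteq> 0" "ya = (\<lambda>i. s * y i)" using *(4) by (rule proj_ptE)
  define H' where "H' = (\<lambda>x. h (hom_vec d fp x))"
  have H': "form 1 d H'" unfolding H'_def by (rule form_linear_hom_vec[OF *(1)])
  \<comment> \<open>The condition for \<open>m'\<close> with all denominators cleared;
    \<open>s\<close> is the scalar relating the representative \<open>ya\<close> to
    \<open>y\<close>.\<close>
  have rel: "k x \<noteq> 0 \<and> g x \<noteq> 0 \<and> H' x \<noteq> 0 \<and> pt_form y x ^ m * (B x * k x) = s ^ m' * pt_form y x ^ m' * (g x * H' x)"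
    if R: "R \<in> V'" "x \<in> R" for R x
  proof -
    have RV: "R \<in> V" using R g(3) by blast
    have bx: "bin_vec x" "R = proj_pt x" using R(2) RV *(2) P1_bin_vec zopen_subset by blast+
    have "hom_vec d fp x \<in> \<phi> R" unfolding bx(2) \<phi>[OF bx(1)] by (rule proj_pt_refl)
    from lh[OF RV R(2) this] have a: "H' x \<noteq> 0"
      "l (hom_vec d fp x) / H' x = (s * pt_form y x) ^ m' * u x"
      unfolding H'_def s(2) by (simp_all add: pt_form_def algebra_simps)
    have b: "k x \<noteq> 0" "u x = g x / k x" using g(7) R by blast+
    have "u x \<noteq> 0" using u[OF RV R(2)] .
    then have "g x \<noteq> 0" using b by auto
    moreover have "pt_form y x ^ m * (B x * k x) = s ^ m' * pt_form y x ^ m' * (g x * H' x)"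
      using a b unfolding L by (simp add: field_simps)
    ultimately show ?thesis using a b by blast
  qed
  have fin: "finite ({t. proj_pt (pt t) \<notin> V'} \<union> {t. pt_form y (pt t) = 0})"
  proof -
    have "{t. pt_form y (pt t) = 0} \<subseteq> {y 1}"
    proof
      fix t assume "t \<in> {t. pt_form y (pt t) = 0}"
      moreover have "pt t \<in> std_pts" unfolding std_pts_def by simp
      ultimately have "y = pt t" using pt_form_std[OF y] by simp
      then show "t \<in> {y 1}" by simp
    qed
    then have "finite {t. pt_form y (pt t) = 0}" by (rule finite_subset) simp
    then show ?thesis using zopen_P1_cofinite[OF g(1,2)] by simp
  qed
  have yy: "pt_form y y = 0" by (simp add: pt_form_def)
  note aty = rel[OF g(2) proj_pt_refl]
  show "m' = m"
  proof (rule ccontr)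
    assume "m' \<noteq> m"
    then consider "m < m'" | "m' < m" by linarith
    then show False
    proof cases
      case 1
      have "form 1 (d - m + e') (\<lambda>x. B x * k x)" by (rule form_mult[OF B(1) g(5)])
      moreover have "form 1 ((m' - m) * 1 + (e + d)) (\<lambda>x. pt_form y x ^ (m' - m) * (s ^ m' * (g x * H' x)))"
        by (intro form_mult form_power form_pt_form form_scale g(4) H')
      moreover have "(m' - m) * 1 + (e + d) = d - m + e'" using g(6) 1 B(2) by linarith
      \<comment> \<open>Both sides have the same degree, so agreement at almost all points makes
        them equal as forms, also at \<open>y\<close>, where the point form was cancelled.\<close>
      ultimately have "(\<lambda>x. B x * k x) = (\<lambda>x. pt_form y x ^ (m' - m) * (s ^ m' * (g x * H' x)))"
      proof (intro form_eqI_cofinite[OF _ _ fin])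
        fix t assume "t \<notin> {t. proj_pt (pt t) \<notin> V'} \<union> {t. pt_form y (pt t) = 0}"
        then have t: "proj_pt (pt t) \<in> V'" "pt_form y (pt t) \<noteq> 0" by auto
        have "pt_form y (pt t) ^ m * (B (pt t) * k (pt t)) =
            pt_form y (pt t) ^ m * (pt_form y (pt t) ^ (m' - m) * (s ^ m' * (g (pt t) * H' (pt t))))"
        proof -
          have "pt_form y (pt t) ^ m' = pt_form y (pt t) ^ m * pt_form y (pt t) ^ (m' - m)"
            using 1 by (simp flip: power_add)
          with rel[OF t(1) proj_pt_refl] show ?thesis by (simp only: ac_simps)
        qed
        then show "B (pt t) * k (pt t) = pt_form y (pt t) ^ (m' - m) * (s ^ m' * (g (pt t) * H' (pt t)))"
          using t(2) by simp
      qed simp_all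
      from fun_cong[OF this, of y] show False using yy 1 B(3) aty by (simp add: power_0_left)
    next
      case 2
      have "form 1 ((m - m') * 1 + (d - m + e')) (\<lambda>x. pt_form y x ^ (m - m') * (B x * k x))"
        by (intro form_mult form_power form_pt_form B(1) g(5))
      moreover have "form 1 (e + d) (\<lambda>x. s ^ m' * (g x * H' x))"
        by (intro form_mult form_scale g(4) H')
      moreover have "(m - m') * 1 + (d - m + e') = e + d" using g(6) 2 B(2) by linarith
      ultimately have "(\<lambda>x. pt_form y x ^ (m - m') * (B x * k x)) = (\<lambda>x. s ^ m' * (g x * H' x))"
      proof (intro form_eqI_cofinite[OF _ _ fin])
        fix t assume "t \<notin> {t. proj_pt (pt t) \<notin> V'} \<union> {t. pt_form y (pt t) = 0}"
        then have t: "proj_pt (pt t) \<in> V'" "pt_form y (pt t) \<noteq> 0" by auto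
        have "pt_form y (pt t) ^ m' * (pt_form y (pt t) ^ (m - m') * (B (pt t) * k (pt t))) =
            pt_form y (pt t) ^ m' * (s ^ m' * (g (pt t) * H' (pt t)))"
        proof -
          have "pt_form y (pt t) ^ m = pt_form y (pt t) ^ m' * pt_form y (pt t) ^ (m - m')"
            using 2 by (simp flip: power_add)
          with rel[OF t(1) proj_pt_refl] show ?thesis by (simp only: ac_simps)
        qed
        then show "pt_form y (pt t) ^ (m - m') * (B (pt t) * k (pt t)) = s ^ m' * (g (pt t) * H' (pt t))"
          using t(2) by simp
      qed simp_all
      from fun_cong[OF this, of y] show False using yy 2 aty s(1) by (simp add: power_0_left)
    qed
  qed
qed

text \<open>The pullback of \<open>l\<close> is a nonzero binary form of degree \<open>d\<close>.
  Its vanishing orders are the multiplicities of its linear factors, and these add up to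
  \<open>d\<close>.\<close>

lemma has_degree_eq:
  assumes "has_degree n \<phi> e"
  shows "e = d"
proof -
  obtain l where l: "form n 1 l" "\<exists>Q\<in>P1. \<exists>z\<in>\<phi> Q. l z \<noteq> 0"
    and e: "e = (\<Sum>Q\<in>{Q \<in> P1. \<forall>z\<in>\<phi> Q. l z = 0}. vanishing_order n \<phi> l Q)"
    using assms unfolding has_degree_def by blast
  obtain p where p: "degree p \<le> d" "(\<lambda>x. l (hom_vec d fp x)) = hom d p"
    using form_1_hom[OF form_linear_hom_vec[OF l(1)]] .
  have lz: "l z = 0 \<longleftrightarrow> hom d p x = 0" if xz: "bin_vec x" "z \<in> \<phi> (proj_pt x)" for x z
  proof -
    obtain c where c: "c \<noteq> 0" "z = (\<lambda>i. c * hom_vec d fp x i)"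
      using xz(2) unfolding \<phi>[OF xz(1)] by (rule proj_ptE)
    have "l z = c * hom d p x" unfolding c(2) using form_homogeneous[OF l(1)] fun_cong[OF p(2)] by simp
    then show ?thesis using c(1) by simp
  qed
  have "p \<noteq> 0"
  proof
    assume "p = 0"
    obtain Q z where Q: "Q \<in> P1" "z \<in> \<phi> Q" "l z \<noteq> 0" using l(2) by blast
    then obtain y where y: "y \<in> std_pts" "Q = proj_pt y" unfolding P1_std_pts by blast
    then show False using lz[OF std_pts_bin_vec[OF y(1)]] Q \<open>p = 0\<close> by (auto simp: hom_def)
  qed
  then obtain c Y where Y: "c \<noteq> 0" "size Y = d" "set_mset Y \<subseteq> std_pts"
    "\<And>x. hom d p x = c * (\<Prod>y\<in>#Y. pt_form y x)" using hom_factorization[OF _ p(1)] by blast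
  have zero: "hom d p y = 0 \<longleftrightarrow> y \<in># Y" if "y \<in> std_pts" for y
  proof -
    have "hom d p y = 0 \<longleftrightarrow> (\<exists>y'\<in>#Y. pt_form y' y = 0)"
      unfolding Y(4) using Y(1) by (auto simp: prod_mset_zero_iff)
    also have "\<dots> \<longleftrightarrow> y \<in># Y" using pt_form_std that Y(3) by blast
    finally show ?thesis .
  qed
  have zs: "{Q \<in> P1. \<forall>z\<in>\<phi> Q. l z = 0} = proj_pt ` set_mset Y"
  proof (intro equalityI subsetI)
    fix Q assume "Q \<in> {Q \<in> P1. \<forall>z\<in>\<phi> Q. l z = 0}"
    then obtain y where y: "y \<in> std_pts" "Q = proj_pt y" "\<forall>z\<in>\<phi> Q. l z = 0" unfolding P1_std_pts by blast
    have "hom_vec d fp y \<in> \<phi> (proj_pt y)"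
      unfolding \<phi>[OF std_pts_bin_vec[OF y(1)]] by (rule proj_pt_refl)
    then have "hom d p y = 0" using y lz[OF std_pts_bin_vec[OF y(1)]] by blast
    then show "Q \<in> proj_pt ` set_mset Y" using zero y by blast
  next
    fix Q assume "Q \<in> proj_pt ` set_mset Y"
    then obtain y where y: "y \<in># Y" "Q = proj_pt y" by blast
    then have "y \<in> std_pts" using Y(3) by blast
    then show "Q \<in> {Q \<in> P1. \<forall>z\<in>\<phi> Q. l z = 0}"
      using lz[OF std_pts_bin_vec] zero[of y] y bin_vec_P1[OF std_pts_bin_vec] by blast
  qed
  have vo: "vanishing_order n \<phi> l (proj_pt y) = count Y y" if y: "y \<in># Y" for y
  proof -
    define Y' where "Y' = filter_mset (\<lambda>y'. y' \<noteq> y) Y"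
    have "Y = filter_mset (\<lambda>y'. y' = y) Y + Y'" unfolding Y'_def by (rule multiset_partition)
    then have Yeq: "Y = replicate_mset (count Y y) y + Y'" by (simp add: filter_eq_replicate_mset)
    have sz: "size Y' = d - count Y y" "count Y y \<le> d"
      using arg_cong[OF Yeq, of size] Y(2) by simp_all
    define B where "B = (\<lambda>x. c * (\<Prod>y\<in>#Y'. pt_form y x))"
    have "form 1 (size M) (\<lambda>x. \<Prod>y\<in>#M. pt_form y x)" for M :: "(nat \<Rightarrow> 'k) multiset"
    proof (induction M)
      case empty
      then show ?case using form_const[of 1 1] by simp
    next
      case (add y M)
      then show ?case using form_mult[OF form_pt_form[of y] add] by simp
    qed
    then have B: "form 1 (d - count Y y) B" unfolding B_def sz(1)[symmetric] by (rule form_scale)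
    have "pt_form y' y \<noteq> 0" if "y' \<in># Y'" for y'
      using that pt_form_std[of y' y] Y(3) y unfolding Y'_def by auto
    then have By: "B y \<noteq> 0" unfolding B_def using Y(1) by (auto simp: prod_mset_zero_iff)
    have "l (hom_vec d fp x) = pt_form y x ^ count Y y * B x" for x
    proof -
      have "l (hom_vec d fp x) = c * (\<Prod>y\<in>#Y. pt_form y x)" using fun_cong[OF p(2), of x] Y(4) by simp
      also have "\<dots> = pt_form y x ^ count Y y * B x" by (subst Yeq) (simp add: B_def)
      finally show ?thesis .
    qed
    then show ?thesis using vanishing_order_eq[OF l(1) _ B sz(2) By] y Y(3) by blast
  qed
  have "e = (\<Sum>y\<in>set_mset Y. vanishing_order n \<phi> l (proj_pt y))"
    unfolding e zs using Y(3) std_pts_inj by (subst sum.reindex) (auto intro: inj_on_subset)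
  also have "\<dots> = (\<Sum>y\<in>set_mset Y. count Y y)" using vo by (intro sum.cong) auto
  also have "\<dots> = size Y" by (simp add: size_multiset_overloaded_eq)
  finally show ?thesis using Y(2) by simp
qed

end

subsection \<open>Decomposition of polynomials with respect to Frobenius\<close>

context char_power
begin

definition frob_root :: "'k \<Rightarrow> 'k" where
  "frob_root c = (SOME x. x ^ q = c)"

lemma frob_root_power: "frob_root c ^ q = c"
proof -
  have "\<exists>x. x ^ q = c" using q_ge_2 by (intro nth_root_exists) simp
  then show ?thesis unfolding frob_root_def by (rule someI_ex)
qed

lemma power_q_inj:
  assumes "(x :: 'k) ^ q = y ^ q"
  shows "x = y"
proof -
  have "((x - y) + y) ^ q = (x - y) ^ q + y ^ q" by (rule power_q_add)
  then have "(x - y) ^ q = 0" using assms by simp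
  then show ?thesis by simp
qed

lemma frob_root_0: "frob_root 0 = 0"
  by (rule power_q_inj) (use q_ge_2 in \<open>simp add: frob_root_power\<close>)

lemma power_q_poly:
  fixes A :: "'k poly"
  assumes "\<And>i. i > m \<Longrightarrow> coeff A i = 0"
  shows "A ^ q = (\<Sum>i\<le>m. monom (coeff A i ^ q) (q * i))"
proof -
  have "A = (\<Sum>i\<le>m. monom (coeff A i) i)"
    using assms by (intro poly_eqI) (auto simp: coeff_sum not_le)
  then have "A ^ q = (\<Sum>i\<le>m. monom (coeff A i) i) ^ q" by simp
  then show ?thesis by (simp add: poly_power_q_sum monom_power mult.commute)
qed

text \<open>Division with remainder by q: for b < q the number q i + b determines i and b, so
  different components occupy disjoint sets of exponents.\<close>

lemma coeff_frob_component:
  fixes A :: "'k poly"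
  assumes "\<beta> < q" "\<gamma> < q"
  shows "coeff (monom 1 \<beta> * A ^ q) (q * \<zeta> + \<gamma>) = (if \<beta> = \<gamma> then coeff A \<zeta> ^ q else 0)"
proof -
  have A: "A ^ q = (\<Sum>i\<le>degree A. monom (coeff A i ^ q) (q * i))"
    by (rule power_q_poly) (simp add: coeff_eq_0)
  have uniq: "q * i + \<beta> = q * \<zeta> + \<gamma> \<longleftrightarrow> i = \<zeta> \<and> \<beta> = \<gamma>" for i
  proof
    assume "q * i + \<beta> = q * \<zeta> + \<gamma>"
    then have "(q * i + \<beta>) div q = (q * \<zeta> + \<gamma>) div q" "(q * i + \<beta>) mod q = (q * \<zeta> + \<gamma>) mod q" by simp_all
    then show "i = \<zeta> \<and> \<beta> = \<gamma>" using assms by simp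
  qed simp
  have "monom 1 \<beta> * A ^ q = (\<Sum>i\<le>degree A. monom (coeff A i ^ q) (q * i + \<beta>))"
    unfolding A sum_distrib_left by (simp add: mult_monom add.commute)
  then have "coeff (monom 1 \<beta> * A ^ q) (q * \<zeta> + \<gamma>) =
      (\<Sum>i\<le>degree A. if i = \<zeta> \<and> \<beta> = \<gamma> then coeff A i ^ q else 0)"
    by (simp add: coeff_sum uniq)
  also have "\<dots> = (if \<beta> = \<gamma> then coeff A \<zeta> ^ q else 0)"
    using q_ge_2 by (auto simp: coeff_eq_0 not_le)
  finally show ?thesis .
qed

lemma coeff_frob_sum:
  assumes "\<gamma> < q"
  shows "coeff (\<Sum>\<beta><q. monom 1 \<beta> * (A \<beta> :: 'k poly) ^ q) (q * \<zeta> + \<gamma>) = coeff (A \<gamma>) \<zeta> ^ q"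
proof -
  have "coeff (\<Sum>\<beta><q. monom 1 \<beta> * A \<beta> ^ q) (q * \<zeta> + \<gamma>) =
      (\<Sum>\<beta><q. if \<beta> = \<gamma> then coeff (A \<beta>) \<zeta> ^ q else 0)"
    unfolding coeff_sum using assms by (intro sum.cong) (simp_all add: coeff_frob_component)
  then show ?thesis using assms by simp
qed

lemma frob_sum_inj:
  assumes "(\<Sum>\<beta><q. monom 1 \<beta> * (A \<beta> :: 'k poly) ^ q) = (\<Sum>\<beta><q. monom 1 \<beta> * B \<beta> ^ q)" "\<gamma> < q"
  shows "A \<gamma> = B \<gamma>"
proof (rule poly_eqI)
  fix \<zeta>
  have "coeff (A \<gamma>) \<zeta> ^ q = coeff (B \<gamma>) \<zeta> ^ q"
    using arg_cong[OF assms(1), of "\<lambda>p. coeff p (q * \<zeta> + \<gamma>)"] unfolding coeff_frob_sum[OF assms(2)] .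
  then show "coeff (A \<gamma>) \<zeta> = coeff (B \<gamma>) \<zeta>" by (rule power_q_inj)
qed

text \<open>The q-th roots of the coefficients at the exponents congruent to \<open>\<beta>\<close>
  modulo q. The summation bound is generous: beyond it the coefficients of \<open>P\<close> are 0,
  and so are their roots.\<close>

definition frob_comp :: "nat \<Rightarrow> 'k poly \<Rightarrow> 'k poly" where
  "frob_comp \<beta> P = (\<Sum>\<zeta>\<le>degree P. monom (frob_root (coeff P (q * \<zeta> + \<beta>))) \<zeta>)"

lemma coeff_frob_comp: "coeff (frob_comp \<beta> P) \<zeta> = frob_root (coeff P (q * \<zeta> + \<beta>))"
proof -
  have "coeff P (q * \<zeta> + \<beta>) = 0" if "\<zeta> > degree P"
  proof -
    have "\<zeta> \<le> q * \<zeta>" using q_ge_2 by simp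
    then show ?thesis using that by (intro coeff_eq_0) linarith
  qed
  then show ?thesis unfolding frob_comp_def by (auto simp: coeff_sum frob_root_0 not_le)
qed

lemma frob_decomposition: "P = (\<Sum>\<beta><q. monom 1 \<beta> * frob_comp \<beta> P ^ q)"
proof (rule poly_eqI)
  fix N
  have N: "N = q * (N div q) + N mod q" by simp
  have "coeff (\<Sum>\<beta><q. monom 1 \<beta> * frob_comp \<beta> P ^ q) N = coeff (frob_comp (N mod q) P) (N div q) ^ q"
    using coeff_frob_sum[of "N mod q" "\<lambda>\<beta>. frob_comp \<beta> P" "N div q"] q_ge_2 by simp
  then show "coeff P N = coeff (\<Sum>\<beta><q. monom 1 \<beta> * frob_comp \<beta> P ^ q) N"
    by (simp add: coeff_frob_comp frob_root_power)
qed

text \<open>The q-th powers behave as constants for the decomposition. So a combination with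
  coefficients f_i^q has as its components combinations with coefficients f_i: this removes the
  Frobenius twist from every relation.\<close>

lemma frob_sum_combination:
  "(\<Sum>i\<in>I. f i ^ q * z i) = (\<Sum>\<beta><q. monom 1 \<beta> * (\<Sum>i\<in>I. f i * frob_comp \<beta> (z i)) ^ q)"
proof -
  have "(\<Sum>i\<in>I. f i ^ q * z i) = (\<Sum>i\<in>I. \<Sum>\<beta><q. monom 1 \<beta> * (f i * frob_comp \<beta> (z i)) ^ q)"
  proof (rule sum.cong)
    fix i
    have "f i ^ q * z i = f i ^ q * (\<Sum>\<beta><q. monom 1 \<beta> * frob_comp \<beta> (z i) ^ q)"
      by (subst frob_decomposition[of "z i"]) rule
    then show "f i ^ q * z i = (\<Sum>\<beta><q. monom 1 \<beta> * (f i * frob_comp \<beta> (z i)) ^ q)"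
      by (simp add: sum_distrib_left power_mult_distrib mult_ac)
  qed simp
  then show ?thesis
    by (simp add: poly_power_q_sum sum_distrib_left sum.swap[of _ I])
qed

end

subsection \<open>Linear algebra in the space of polynomials\<close>

interpretation poly_vs: vector_space "smult :: 'k::field \<Rightarrow> 'k poly \<Rightarrow> 'k poly"
  by standard (simp_all add: smult_add_right smult_add_left)

lemma poly_in_span_monoms:
  assumes "\<And>i. i \<ge> M \<Longrightarrow> coeff p i = 0"
  shows "p \<in> poly_vs.span ((\<lambda>i. monom 1 i) ` {..<M})"
proof -
  have "p = (\<Sum>i<M. smult (coeff p i) (monom 1 i))"
    using assms by (intro poly_eqI) (auto simp: coeff_sum smult_monom not_less)
  also have "\<dots> \<in> poly_vs.span ((\<lambda>i. monom 1 i) ` {..<M})"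
    by (intro poly_vs.span_sum poly_vs.span_scale poly_vs.span_base) auto
  finally show ?thesis .
qed

text \<open>The inequality behind rank and nullity: kernel vectors and preimages of 1, t, ...,
  t^(M-1) are independent together. The image of the span of the earlier vectors has coefficient 0
  at \<open>M\<close>, that of the new vector has coefficient 1.\<close>

lemma independent_kernel_and_lifts:
  fixes \<Psi> :: "'k::field poly \<Rightarrow> 'k poly"
  assumes add: "\<And>p r. \<Psi> (p + r) = \<Psi> p + \<Psi> r" and smult: "\<And>c p. \<Psi> (smult c p) = smult c (\<Psi> p)"
    and B: "poly_vs.independent B" "finite B" "\<And>b. b \<in> B \<Longrightarrow> \<Psi> b = 0"
    and c: "\<And>N. N < M \<Longrightarrow> \<Psi> (c N) = monom 1 N"
  shows "poly_vs.independent (B \<union> c ` {..<M}) \<and> card (B \<union> c ` {..<M}) = card B + M"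
  using c
proof (induction M)
  case 0
  then show ?case using B by simp
next
  case (Suc M)
  let ?S = "B \<union> c ` {..<M}"
  have \<Psi>0: "\<Psi> 0 = 0" using smult[of 0 0] by simp
  have "coeff (\<Psi> p) M = 0" if "p \<in> poly_vs.span ?S" for p
    using that
  proof (induction rule: poly_vs.span_induct_alt)
    case (step a x y)
    have "coeff (\<Psi> x) M = 0" using step(1) B(3) Suc.prems by auto
    then show ?case using step(2) by (simp add: add smult)
  qed (simp add: \<Psi>0)
  moreover have "coeff (\<Psi> (c M)) M = 1" using Suc.prems[of M] by simp
  ultimately have "c M \<notin> poly_vs.span ?S" by fastforce
  then have ns: "c M \<notin> poly_vs.span ?S" .
  then have nS: "c M \<notin> ?S" by (rule contrapos_nn) (rule poly_vs.span_base)
  have IH: "poly_vs.independent ?S" "card ?S = card B + M" using Suc by simp_all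
  have "poly_vs.independent (insert (c M) ?S)" using ns IH(1) by (rule poly_vs.independent_insertI)
  moreover have "card (insert (c M) ?S) = card B + Suc M" using nS IH(2) B(2) by simp
  moreover have "B \<union> c ` {..<Suc M} = insert (c M) ?S" by (simp add: lessThan_Suc)
  ultimately show ?case by simp
qed

subsection \<open>The bound\<close>

context char_power
begin

text \<open>A fixed \<open>h\<close> contributes at most m + 1 dimensions, because A^q is a
  polynomial of degree at most m in t^q.\<close>

lemma span_frob_multiples:
  assumes "\<And>i. i > m \<Longrightarrow> coeff A i = 0"
  shows "h * A ^ q \<in> poly_vs.span ((\<lambda>i. h * monom (1::'k) (q * i)) ` {..m})"
proof -
  have "h * A ^ q = (\<Sum>i\<le>m. smult (coeff A i ^ q) (h * monom 1 (q * i)))"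
  proof -
    have "A ^ q = (\<Sum>i\<le>m. monom (coeff A i ^ q) (q * i))" by (rule power_q_poly[OF assms])
    also have "\<dots> = (\<Sum>i\<le>m. smult (coeff A i ^ q) (monom 1 (q * i)))" by (simp add: smult_monom)
    finally show ?thesis by (simp add: sum_distrib_left)
  qed
  also have "\<dots> \<in> poly_vs.span ((\<lambda>i. h * monom 1 (q * i)) ` {..m})"
    by (intro poly_vs.span_sum poly_vs.span_scale poly_vs.span_base) auto
  finally show ?thesis .
qed

text \<open>From here on only polynomial algebra is involved: freeness enters through
  \<open>lift\<close>, which \<open>free_lift\<close> supplies, and the hypersurface through
  \<open>fermat\<close>.\<close>

context
  fixes n d m r :: nat and f :: "nat \<Rightarrow> 'k poly"
  assumes n: "n = q + 1" and d: "d \<ge> 1" "d = q * m + r" "r < q"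
    and deg: "\<And>i. degree (f i) \<le> d"
    and fermat: "(\<Sum>i\<le>n. f i ^ q * f i) = 0"
    and lift: "\<And>F. degree F \<le> (q + 1) * d - 1 \<Longrightarrow>
      \<exists>z. (\<forall>i\<le>n. degree (z i) \<le> d - 1) \<and> F = (\<Sum>i\<le>n. f i ^ q * z i)"
begin

text \<open>The polynomial t^(q-1) g^q has \<open>g\<close> as its only nonzero component, at index
  q - 1. This largest index gives the sharpest bound on the w_i: already the exponent q m + q - 1
  exceeds d - 1.\<close>

lemma small_lift:
  assumes "\<And>i. i \<ge> d + m \<Longrightarrow> coeff g i = 0"
  obtains w where "\<And>i \<zeta>. i \<le> n \<Longrightarrow> \<zeta> \<ge> m \<Longrightarrow> coeff (w i) \<zeta> = 0" "g = (\<Sum>i\<le>n. f i * w i)"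
proof -
  define F where "F = monom 1 (q - 1) * g ^ q"
  \<comment> \<open>The degree is at most q - 1 + q (d + m - 1) = q d + q m - 1, hence at most (q +
    1) d - 1 because q m \<le> d. This is where the bound d + m on \<open>g\<close> comes
    from.\<close>
  have "degree F \<le> (q + 1) * d - 1"
  proof (cases "g = 0")
    case True
    then show ?thesis using q_ge_2 by (simp add: F_def power_0_left)
  next
    case False
    then have "degree g < d + m" using assms[of "degree g"] by (metis leading_coeff_0_iff not_le)
    then have "q * degree g \<le> q * (d + m - 1)" by (intro mult_le_mono2) simp
    moreover have "degree F = q - 1 + q * degree g"
      unfolding F_def using False by (simp add: degree_mult_eq degree_monom_eq degree_power_eq)
    moreover have "q * (d + m - 1) + q = q * d + q * m"
    proof -
      have "q * Suc (d + m - 1) = q * d + q * m" using d(1) by (simp add: distrib_left)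
      then show ?thesis by simp
    qed
    moreover have "(q + 1) * d = q * d + d" by simp
    ultimately show ?thesis using d(2) q_ge_2 by linarith
  qed
  from lift[OF this] obtain z where z: "\<And>i. i \<le> n \<Longrightarrow> degree (z i) \<le> d - 1" "F = (\<Sum>i\<le>n. f i ^ q * z i)"
    by blast
  have "F = (\<Sum>\<beta><q. monom 1 \<beta> * (if \<beta> = q - 1 then g else 0) ^ q)"
  proof -
    have "(\<Sum>\<beta><q. monom 1 \<beta> * (if \<beta> = q - 1 then g else 0) ^ q) = (\<Sum>\<beta><q. if \<beta> = q - 1 then F else 0)"
      using q_ge_2 by (intro sum.cong) (auto simp: F_def power_0_left)
    also have "\<dots> = F" using q_ge_2 by simp
    finally show ?thesis ..
  qed
  then have "(\<Sum>\<beta><q. monom 1 \<beta> * (if \<beta> = q - 1 then g else 0) ^ q) =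
      (\<Sum>\<beta><q. monom 1 \<beta> * (\<Sum>i\<le>n. f i * frob_comp \<beta> (z i)) ^ q)"
    unfolding z(2) frob_sum_combination by simp
  from frob_sum_inj[OF this, of "q - 1"] have g: "g = (\<Sum>i\<le>n. f i * frob_comp (q - 1) (z i))"
    using q_ge_2 by simp
  show ?thesis
  proof (rule that[OF _ g])
    fix i \<zeta> assume i: "i \<le> n" "\<zeta> \<ge> m"
    have "q * m \<le> q * \<zeta>" using i(2) by simp
    then have "q * \<zeta> + (q - 1) > d - 1" using d by linarith
    then have "coeff (z i) (q * \<zeta> + (q - 1)) = 0" using z(1)[OF i(1)] by (intro coeff_eq_0) linarith
    then show "coeff (frob_comp (q - 1) (z i)) \<zeta> = 0" by (simp add: coeff_frob_comp frob_root_0)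
  qed
qed

lemma syzygy:
  assumes "\<beta> < q"
  shows "(\<Sum>i\<le>n. f i * frob_comp \<beta> (f i)) = 0"
proof -
  have "(\<Sum>\<beta><q. monom 1 \<beta> * (\<Sum>i\<le>n. f i * frob_comp \<beta> (f i)) ^ q) = (\<Sum>\<beta><q. monom 1 \<beta> * 0 ^ q)"
    using fermat q_ge_2 unfolding frob_sum_combination by (simp add: power_0_left)
  from frob_sum_inj[OF this assms] show ?thesis .
qed

text \<open>The degree of f_i is at most q m + r, so the exponent q m + b is out of reach as soon as
  b > r.\<close>

lemma coeff_syzygy:
  shows "\<zeta> > m \<Longrightarrow> coeff (frob_comp \<beta> (f i)) \<zeta> = 0"
    and "\<beta> > r \<Longrightarrow> \<zeta> \<ge> m \<Longrightarrow> coeff (frob_comp \<beta> (f i)) \<zeta> = 0"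
proof -
  show "coeff (frob_comp \<beta> (f i)) \<zeta> = 0" if "\<zeta> > m"
  proof -
    have "q * Suc m \<le> q * \<zeta>" using that by (intro mult_le_mono2) simp
    then have "q * \<zeta> + \<beta> > degree (f i)" using d deg[of i] by simp
    then show ?thesis by (simp add: coeff_frob_comp frob_root_0 coeff_eq_0)
  qed
  show "coeff (frob_comp \<beta> (f i)) \<zeta> = 0" if "\<beta> > r" "\<zeta> \<ge> m"
  proof -
    have "q * m \<le> q * \<zeta>" using that by simp
    then have "q * \<zeta> + \<beta> > degree (f i)" using d deg[of i] that by linarith
    then show ?thesis by (simp add: coeff_frob_comp frob_root_0 coeff_eq_0)
  qed
qed

text \<open>Tuples of polynomials of degree less than \<open>m\<close> become polynomials of degree less than \<open>(n + 1) m\<close>,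
  so that all dimension counts take place in the vector space of polynomials.\<close>

definition encode :: "(nat \<Rightarrow> 'k poly) \<Rightarrow> 'k poly" where
  "encode w = (\<Sum>i\<le>n. monom 1 (i * m) * w i)"

text \<open>Left inverse to \<open>encode\<close> on tuples of degree less than m. It is linear, so
  relations among codes pass to the tuples.\<close>

definition block :: "nat \<Rightarrow> 'k poly \<Rightarrow> 'k poly" where
  "block i P = (\<Sum>\<zeta><m. monom (coeff P (i * m + \<zeta>)) \<zeta>)"

lemma coeff_block: "coeff (block i P) \<zeta> = (if \<zeta> < m then coeff P (i * m + \<zeta>) else 0)"
  unfolding block_def by (auto simp: coeff_sum)

lemma block_add: "block i (P + R) = block i P + block i R"
  by (rule poly_eqI) (simp add: coeff_block)

lemma block_smult: "block i (smult c P) = smult c (block i P)"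
  by (rule poly_eqI) (simp add: coeff_block)

text \<open>The exponents i m, ..., i m + m - 1 of different indices i do not overlap.\<close>

lemma coeff_encode:
  assumes w: "\<And>i \<zeta>. i \<le> n \<Longrightarrow> \<zeta> \<ge> m \<Longrightarrow> coeff (w i) \<zeta> = 0"
  shows "i \<le> n \<Longrightarrow> \<zeta> < m \<Longrightarrow> coeff (encode w) (i * m + \<zeta>) = coeff (w i) \<zeta>"
    and "N \<ge> (n + 1) * m \<Longrightarrow> coeff (encode w) N = 0"
proof -
  have co: "coeff (encode w) N = (\<Sum>j\<le>n. if j * m \<le> N then coeff (w j) (N - j * m) else 0)" for N
    unfolding encode_def coeff_sum coeff_monom_mult by (intro sum.cong) auto
  show "coeff (encode w) (i * m + \<zeta>) = coeff (w i) \<zeta>" if i: "i \<le> n" "\<zeta> < m"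
  proof -
    have "coeff (encode w) (i * m + \<zeta>) = (\<Sum>j\<le>n. if j = i then coeff (w i) \<zeta> else 0)"
      unfolding co
    proof (rule sum.cong)
      fix j assume j: "j \<in> {..n}"
      consider "j = i" | "j < i" | "j > i" by linarith
      then show "(if j * m \<le> i * m + \<zeta> then coeff (w j) (i * m + \<zeta> - j * m) else 0) =
          (if j = i then coeff (w i) \<zeta> else 0)"
      proof cases
        case 2
        then have "Suc j * m \<le> i * m" by (intro mult_le_mono1) simp
        then have "i * m + \<zeta> - j * m \<ge> m" by simp
        then show ?thesis using w[of j "i * m + \<zeta> - j * m"] j 2 by simp
      next
        case 3
        then have "Suc i * m \<le> j * m" by (intro mult_le_mono1) simp
        then have "\<not> j * m \<le> i * m + \<zeta>" using i by simp
        then show ?thesis using 3 by simp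
      qed simp
    qed simp
    then show ?thesis using i by simp
  qed
  show "coeff (encode w) N = 0" if N: "N \<ge> (n + 1) * m"
    unfolding co
  proof (intro sum.neutral ballI)
    fix j assume j: "j \<in> {..n}"
    then have "Suc j * m \<le> (n + 1) * m" by (intro mult_le_mono1) simp
    with N have "Suc j * m \<le> N" by (rule order_trans[rotated])
    then have "j * m + m \<le> N" by simp
    then have "N - j * m \<ge> m" by linarith
    then show "(if j * m \<le> N then coeff (w j) (N - j * m) else 0) = 0" using w[of j "N - j * m"] j by simp
  qed
qed

lemma block_encode:
  assumes "\<And>i \<zeta>. i \<le> n \<Longrightarrow> \<zeta> \<ge> m \<Longrightarrow> coeff (w i) \<zeta> = 0" "i \<le> n"
  shows "block i (encode w) = w i"
  by (rule poly_eqI) (use assms coeff_encode(1)[of w i] in \<open>auto simp: coeff_block not_less\<close>)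

text \<open>The map taking a tuple w to sum f_i w_i, expressed on codes; its kernel consists of the
  syzygies of degree less than m.\<close>

definition contract :: "'k poly \<Rightarrow> 'k poly" where
  "contract P = (\<Sum>i\<le>n. f i * block i P)"

lemma contract_add: "contract (P + R) = contract P + contract R"
  by (simp add: contract_def block_add distrib_left sum.distrib)

lemma contract_smult: "contract (smult c P) = smult c (contract P)"
  by (simp add: contract_def block_smult poly_vs.scale_sum_right)

lemma contract_encode:
  assumes "\<And>i \<zeta>. i \<le> n \<Longrightarrow> \<zeta> \<ge> m \<Longrightarrow> coeff (w i) \<zeta> = 0"
  shows "contract (encode w) = (\<Sum>i\<le>n. f i * w i)"
  unfolding contract_def using block_encode[OF assms] by (intro sum.cong) auto

definition syz :: "nat \<Rightarrow> 'k poly" where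
  "syz \<beta> = encode (\<lambda>i. frob_comp \<beta> (f i))"

text \<open>The set \<open>B\<close> is chosen among the \<open>syz \<beta>\<close> alone. Together
  with lifts of 1, ..., t^(d+m-1) it is independent in a space of dimension (q + 2) m, which gives
  card B + d + m \<le> (q + 2) m.\<close>

lemma syzygy_basis:
  obtains B where "finite B" "card B + r \<le> m"
    "\<And>\<beta>. r < \<beta> \<Longrightarrow> \<beta> < q \<Longrightarrow> syz \<beta> \<in> poly_vs.span B"
proof -
  obtain B where B: "B \<subseteq> syz ` {r<..<q}" "poly_vs.independent B" "syz ` {r<..<q} \<subseteq> poly_vs.span B"
    by (rule poly_vs.maximal_independent_subset)
  have fin: "finite B" using B(1) by (rule finite_subset) simp
  let ?T = "(\<lambda>i. monom (1::'k) i) ` {..<(n + 1) * m}"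
  have ker: "contract b = 0 \<and> b \<in> poly_vs.span ?T" if b: "b \<in> B" for b
  proof -
    have "b \<in> syz ` {r<..<q}" using B(1) b by blast
    then obtain \<beta> where \<beta>: "r < \<beta>" "\<beta> < q" "b = syz \<beta>" by auto
    have small: "coeff (frob_comp \<beta> (f i)) \<zeta> = 0" if "i \<le> n" "\<zeta> \<ge> m" for i \<zeta>
      using coeff_syzygy(2)[OF \<beta>(1) that(2)] .
    have "contract b = 0"
      using contract_encode[of "\<lambda>i. frob_comp \<beta> (f i)", OF small] syzygy[OF \<beta>(2)]
      unfolding \<beta>(3) syz_def by simp
    moreover have "b \<in> poly_vs.span ?T"
      unfolding \<beta>(3) syz_def
      by (rule poly_in_span_monoms, rule coeff_encode(2)[of "\<lambda>i. frob_comp \<beta> (f i)", OF small])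
    ultimately show ?thesis by blast
  qed
  have "\<exists>P. contract P = monom 1 N \<and> P \<in> poly_vs.span ?T" if N: "N < d + m" for N
  proof -
    obtain w where w: "\<And>i \<zeta>. i \<le> n \<Longrightarrow> \<zeta> \<ge> m \<Longrightarrow> coeff (w i) \<zeta> = 0" "monom 1 N = (\<Sum>i\<le>n. f i * w i)"
      using small_lift[of "monom 1 N"] N by auto
    show ?thesis
      using contract_encode[OF w(1)] w(2) poly_in_span_monoms[OF coeff_encode(2)[OF w(1)]]
      by (intro exI[of _ "encode w"]) simp
  qed
  then obtain c where c: "\<And>N. N < d + m \<Longrightarrow> contract (c N) = monom 1 N"
    "\<And>N. N < d + m \<Longrightarrow> c N \<in> poly_vs.span ?T" by metis
  have ind: "poly_vs.independent (B \<union> c ` {..<d + m}) \<and> card (B \<union> c ` {..<d + m}) = card B + (d + m)"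
    by (rule independent_kernel_and_lifts[OF contract_add contract_smult B(2) fin])
       (use ker c(1) in auto)
  have "B \<union> c ` {..<d + m} \<subseteq> poly_vs.span ?T" using ker c(2) by auto
  then have "card (B \<union> c ` {..<d + m}) \<le> card ?T"
    using poly_vs.independent_span_bound[of ?T] ind by blast
  also have "\<dots> \<le> (n + 1) * m" using card_image_le[of "{..<(n + 1) * m}"] by simp
  finally have "card B + (d + m) \<le> (q + 2) * m" using ind n by simp
  then have "card B + r \<le> m" using d(2) by (simp add: distrib_right)
  then show ?thesis using fin B(3) by (intro that[of B]) auto
qed

text \<open>For b \<le> r the component of index b keeps its own multiplier t^b; the components of
  larger index share the multipliers \<open>h b\<close>. This leaves at most (r + 1) + card B \<le>
  m + 1 multipliers, common to all f_i, each with m + 1 powers of t^q.\<close>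

lemma span_of_coords:
  obtains T where "finite T" "card T \<le> (m + 1) * (m + 1)" "\<And>i. i \<le> n \<Longrightarrow> f i \<in> poly_vs.span T"
proof -
  obtain B where B: "finite B" "card B + r \<le> m"
    "\<And>\<beta>. r < \<beta> \<Longrightarrow> \<beta> < q \<Longrightarrow> syz \<beta> \<in> poly_vs.span B"
    by (rule syzygy_basis) (rule that)
  have "\<exists>u. syz \<beta> = (\<Sum>b\<in>B. smult (u b) b)" if "r < \<beta>" "\<beta> < q" for \<beta>
    using B(3)[OF that] unfolding poly_vs.span_finite[OF B(1)] by auto
  then obtain u where u: "\<And>\<beta>. r < \<beta> \<Longrightarrow> \<beta> < q \<Longrightarrow> syz \<beta> = (\<Sum>b\<in>B. smult (u \<beta> b) b)" by metis
  \<comment> \<open>The multiplier of the q-th power of \<open>block i b\<close> after exchanging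
    the sums over \<open>\<beta>\<close> and \<open>b\<close>; Frobenius turns \<open>u\<close> into
    its q-th power. It does not depend on i, so it serves all f_i at once.\<close>
  define h where "h b = (\<Sum>\<beta>\<in>{r<..<q}. monom (u \<beta> b ^ q) \<beta>)" for b
  define H where "H = (\<lambda>\<beta>. monom 1 \<beta>) ` {..r} \<union> h ` B"
  define T where "T = (\<lambda>(a, i). a * monom 1 (q * i)) ` (H \<times> {..m})"
  have H: "finite H" unfolding H_def using B(1) by simp
  have "card H \<le> card ((\<lambda>\<beta>. monom (1::'k) \<beta>) ` {..r}) + card (h ` B)"
    unfolding H_def by (rule card_Un_le)
  also have "\<dots> \<le> (r + 1) + card B"
    using card_image_le[of "{..r}" "\<lambda>\<beta>. monom (1::'k) \<beta>"] card_image_le[OF B(1), of h]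
    by simp
  finally have "card H \<le> m + 1" using B(2) by simp
  then have "card (H \<times> {..m}) \<le> (m + 1) * (m + 1)"
    unfolding card_cartesian_product card_atMost Suc_eq_plus1 by (rule mult_le_mono1)
  moreover have "card T \<le> card (H \<times> {..m})" unfolding T_def using H by (intro card_image_le) simp
  ultimately have cardT: "card T \<le> (m + 1) * (m + 1)" by linarith
  have finT: "finite T" unfolding T_def using H by simp
  have inT: "a * A ^ q \<in> poly_vs.span T" if "a \<in> H" "\<And>i. i > m \<Longrightarrow> coeff A i = 0" for a A
  proof -
    have "(\<lambda>i. a * monom 1 (q * i)) ` {..m} \<subseteq> T" unfolding T_def using that(1) by auto
    then show ?thesis using span_frob_multiples[OF that(2)] poly_vs.span_mono by blast
  qed
  have "f i \<in> poly_vs.span T" if i: "i \<le> n" for i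
  proof -
    have comp: "frob_comp \<beta> (f i) = (\<Sum>b\<in>B. smult (u \<beta> b) (block i b))" if \<beta>: "r < \<beta>" "\<beta> < q" for \<beta>
    proof -
      have sum: "block i (\<Sum>b\<in>B. smult (u \<beta> b) b) = (\<Sum>b\<in>B. smult (u \<beta> b) (block i b))"
        by (rule poly_eqI) (simp add: coeff_block coeff_sum)
      have "frob_comp \<beta> (f i) = block i (syz \<beta>)"
        unfolding syz_def using block_encode[OF coeff_syzygy(2)[OF \<beta>(1)] i] by simp
      then show ?thesis unfolding u[OF \<beta>] sum .
    qed
    have "f i = (\<Sum>\<beta><q. monom 1 \<beta> * frob_comp \<beta> (f i) ^ q)" by (rule frob_decomposition)
    also have "{..<q} = {..r} \<union> {r<..<q}" using d(3) by auto
    also have "(\<Sum>\<beta>\<in>{..r} \<union> {r<..<q}. monom 1 \<beta> * frob_comp \<beta> (f i) ^ q) =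
        (\<Sum>\<beta>\<le>r. monom 1 \<beta> * frob_comp \<beta> (f i) ^ q) + (\<Sum>\<beta>\<in>{r<..<q}. monom 1 \<beta> * frob_comp \<beta> (f i) ^ q)"
      by (rule sum.union_disjoint) auto
    also have "(\<Sum>\<beta>\<in>{r<..<q}. monom 1 \<beta> * frob_comp \<beta> (f i) ^ q) =
        (\<Sum>\<beta>\<in>{r<..<q}. \<Sum>b\<in>B. monom (u \<beta> b ^ q) \<beta> * block i b ^ q)"
    proof (rule sum.cong)
      fix \<beta> assume "\<beta> \<in> {r<..<q}"
      then have "frob_comp \<beta> (f i) = (\<Sum>b\<in>B. smult (u \<beta> b) (block i b))" using comp by simp
      then show "monom 1 \<beta> * frob_comp \<beta> (f i) ^ q = (\<Sum>b\<in>B. monom (u \<beta> b ^ q) \<beta> * block i b ^ q)"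
        by (simp add: poly_power_q_sum smult_power sum_distrib_left smult_monom flip: mult_smult_left)
    qed simp
    also have "\<dots> = (\<Sum>b\<in>B. h b * block i b ^ q)"
      unfolding h_def sum_distrib_right by (rule sum.swap)
    finally have fi: "f i = (\<Sum>\<beta>\<le>r. monom 1 \<beta> * frob_comp \<beta> (f i) ^ q) + (\<Sum>b\<in>B. h b * block i b ^ q)" .
    have "(\<Sum>\<beta>\<le>r. monom 1 \<beta> * frob_comp \<beta> (f i) ^ q) + (\<Sum>b\<in>B. h b * block i b ^ q) \<in> poly_vs.span T"
      by (intro poly_vs.span_add poly_vs.span_sum inT) (auto simp: H_def coeff_syzygy(1) coeff_block)
    then show ?thesis using fi by simp
  qed
  then show ?thesis using that finT cardT by blast
qed

text \<open>The powers 1, ..., t^(d+m-1) all lie in the span of the products of \<open>T\<close>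
  with t^l for l < m, and counting dimensions gives d + m \<le> (m+1)^2 m. As (q + 1) m \<le> d + m,
  the factor m cancels.\<close>

lemma degree_bound_nat: "m \<ge> 1 \<and> q < (m + 1) * (m + 1)"
proof -
  obtain T where T: "finite T" "card T \<le> (m + 1) * (m + 1)" "\<And>i. i \<le> n \<Longrightarrow> f i \<in> poly_vs.span T"
    by (rule span_of_coords) (rule that)
  define U where "U = (\<lambda>(a, i). a * monom 1 i) ` (T \<times> {..<m})"
  have finU: "finite U" unfolding U_def using T(1) by simp
  have prod: "p * monom 1 l \<in> poly_vs.span U" if p: "p \<in> poly_vs.span T" and l: "l < m" for p l
    using p
  proof (induction rule: poly_vs.span_induct_alt)
    case base
    then show ?case by (simp add: poly_vs.span_zero)
  next
    case (step c x y)
    have "x * monom 1 l \<in> U" unfolding U_def using step(1) l by auto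
    then have "smult c (x * monom 1 l) + y * monom 1 l \<in> poly_vs.span U"
      by (intro poly_vs.span_add poly_vs.span_scale step poly_vs.span_base)
    then show ?case by (simp add: distrib_right)
  qed
  have "monom 1 N \<in> poly_vs.span U" if N: "N < d + m" for N
  proof -
    obtain w where w: "\<And>i \<zeta>. i \<le> n \<Longrightarrow> \<zeta> \<ge> m \<Longrightarrow> coeff (w i) \<zeta> = 0" "monom 1 N = (\<Sum>i\<le>n. f i * w i)"
      using small_lift[of "monom 1 N"] N by auto
    have "f i * w i \<in> poly_vs.span U" if i: "i \<le> n" for i
    proof -
      have "w i = (\<Sum>l<m. smult (coeff (w i) l) (monom 1 l))"
        using w(1)[OF i] by (intro poly_eqI) (auto simp: coeff_sum smult_monom not_less)
      then have "f i * w i = (\<Sum>l<m. smult (coeff (w i) l) (f i * monom 1 l))"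
        by (metis (no_types, lifting) mult_smult_right sum.cong sum_distrib_left)
      also have "\<dots> \<in> poly_vs.span U"
        by (intro poly_vs.span_sum poly_vs.span_scale prod T(3)[OF i]) simp
      finally show ?thesis .
    qed
    then show ?thesis unfolding w(2) by (intro poly_vs.span_sum) simp
  qed
  then have sub: "(\<lambda>N. monom 1 N) ` {..<d + m} \<subseteq> poly_vs.span U" by auto
  have "poly_vs.independent ({} \<union> (\<lambda>N. monom (1::'k) N) ` {..<d + m}) \<and>
      card ({} \<union> (\<lambda>N. monom (1::'k) N) ` {..<d + m}) = card ({} :: 'k poly set) + (d + m)"
    by (rule independent_kernel_and_lifts[of "\<lambda>p. p"]) (simp_all add: poly_vs.independent_empty)
  then have "d + m \<le> card U"
    using poly_vs.independent_span_bound[OF finU _ sub] by simp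
  also have "card U \<le> card (T \<times> {..<m})" unfolding U_def using T(1) by (intro card_image_le) simp
  also have "\<dots> \<le> (m + 1) * (m + 1) * m"
    unfolding card_cartesian_product card_lessThan using T(2) by (rule mult_le_mono1)
  finally have le: "d + m \<le> (m + 1) * (m + 1) * m" .
  \<comment> \<open>For \<open>m = 0\<close> the inequality would read d \<le> 0.\<close>
  have "m \<ge> 1" using le d(1) by (cases m) auto
  have "(q + 1) * m \<le> d + m" using d(2) by simp
  also note le
  finally have "(q + 1) * m \<le> (m + 1) * (m + 1) * m" .
  then have "q + 1 \<le> (m + 1) * (m + 1)" using \<open>m \<ge> 1\<close> by simp
  then show ?thesis using \<open>m \<ge> 1\<close> by simp
qed

text \<open>In short, q^(3/2) = q sqrt q \<le> q (m + 1) \<le> d + q.\<close>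

lemma degree_bound: "real d \<ge> real q powr (3 / 2) - real q"
proof -
  have "real q \<le> real ((m + 1) * (m + 1))" using degree_bound_nat by (intro of_nat_mono) simp
  then have "real q \<le> (real m + 1)\<^sup>2" by (simp add: power2_eq_square algebra_simps)
  then have "sqrt (real q) \<le> real m + 1" by (intro real_le_lsqrt) auto
  then have "real q * sqrt (real q) \<le> real q * (real m + 1)" by (intro mult_left_mono) auto
  moreover have "real q powr (3 / 2) = real q * sqrt (real q)"
  proof -
    have "real q powr (3 / 2) = real q powr (1 + 1 / 2)" by simp
    also have "\<dots> = real q powr 1 * real q powr (1 / 2)" by (rule powr_add)
    finally show ?thesis by (simp add: powr_half_sqrt)
  qed
  moreover have "real q * real m \<le> real d" using d(2) by (simp flip: of_nat_mult)
  ultimately show ?thesis by (simp add: distrib_left)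
qed

end

end

subsection \<open>Derivations along a morphism\<close>

context
  fixes n :: nat and X :: "(nat \<Rightarrow> 'k::alg_closed_field) set set" and \<phi> m V D W Q x
  assumes D: "tangent_section n X \<phi> m V D" and X: "X \<subseteq> proj_space n" and W: "zopen n X W"
    and Q: "Q \<in> V \<inter> preimage \<phi> W" "x \<in> Q"
begin

lemma tangent_section_cong:
  assumes "zopen n X W'" "W \<subseteq> W'" "regular n X W' f'" "regular n X W f" "\<And>P. P \<in> W \<Longrightarrow> f P = f' P"
  shows "D W f x = D W' f' x"
proof -
  note cong = conjunct1[OF conjunct2[OF D[unfolded tangent_section_def]]]
  have "D W' f' x = D W f x"
    by (rule cong[rule_format, OF _ Q]) (use assms W in auto)
  then show ?thesis ..
qed

lemma tangent_section_rules:
  assumes "regular n X W f" "regular n X W g"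
  shows "D W (\<lambda>P. c * f P) x = c * D W f x"
    "D W (\<lambda>P. f P + g P) x = D W f x + D W g x"
    "D W (\<lambda>P. f P * g P) x = f (\<phi> Q) * D W g x + g (\<phi> Q) * D W f x"
proof -
  note rules = conjunct2[OF conjunct2[OF D[unfolded tangent_section_def]]]
  have "zopen n X W \<and> regular n X W f \<and> regular n X W g" using assms W by blast
  from rules[rule_format, OF this Q] show "D W (\<lambda>P. c * f P) x = c * D W f x"
    "D W (\<lambda>P. f P + g P) x = D W f x + D W g x"
    "D W (\<lambda>P. f P * g P) x = f (\<phi> Q) * D W g x + g (\<phi> Q) * D W f x"
    by blast+
qed

lemma tangent_section_const: "D W (\<lambda>_. c) x = 0"
proof -
  have r: "regular n X W (\<lambda>_. 1)" by (rule regular_const[OF W X])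
  have "D W (\<lambda>_. 1) x = D W (\<lambda>_. 1) x + D W (\<lambda>_. 1) x"
    using tangent_section_rules(3)[OF r r] by (simp only: mult_1_left)
  then have "D W (\<lambda>_. 1) x = 0" by (simp only: add_cancel_right_right)
  then show ?thesis using tangent_section_rules(1)[OF r r, of c] by simp
qed

lemma tangent_section_power:
  assumes f: "regular n X W f"
  shows "D W (\<lambda>P. f P ^ Suc k) x = of_nat (Suc k) * f (\<phi> Q) ^ k * D W f x"
proof (induction k)
  case (Suc k)
  have "D W (\<lambda>P. f P * f P ^ Suc k) x = f (\<phi> Q) * D W (\<lambda>P. f P ^ Suc k) x + f (\<phi> Q) ^ Suc k * D W f x"
    by (rule tangent_section_rules(3)[OF f regular_power[OF W X f]])
  then show ?case unfolding Suc by (simp add: algebra_simps)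
qed simp

lemma tangent_section_sum:
  assumes "finite I" "\<And>i. i \<in> I \<Longrightarrow> regular n X W (f i)"
  shows "D W (\<lambda>P. \<Sum>i\<in>I. f i P) x = (\<Sum>i\<in>I. D W (f i) x)"
  using assms
proof (induction I rule: finite_induct)
  case empty
  then show ?case by (simp add: tangent_section_const)
next
  case (insert i I)
  have "D W (\<lambda>P. f i P + (\<Sum>i\<in>I. f i P)) x = D W (f i) x + D W (\<lambda>P. \<Sum>i\<in>I. f i P) x"
    by (rule tangent_section_rules(2)) (use insert regular_sum[OF W X, of I f] in auto)
  then show ?case using insert by simp
qed

end

subsection \<open>Free morphisms\<close>

lemma dderiv_divide:
  assumes "form n d g"
  shows "dderiv g z (\<lambda>i. v i / c) = dderiv g z v / c"
  using dderiv_combine[OF assms, of z "1 / c" v 0 v] by simp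

definition lin :: "nat \<Rightarrow> (nat \<Rightarrow> 'k::field) \<Rightarrow> (nat \<Rightarrow> 'k) \<Rightarrow> 'k" where
  "lin n l z = (\<Sum>i\<le>n. l i * z i)"

lemma form_lin: "form n 1 (lin n l)"
  unfolding lin_def[abs_def] by (rule form_linear)

definition lin_nonzero :: "nat \<Rightarrow> (nat \<Rightarrow> 'k::field) set set \<Rightarrow> (nat \<Rightarrow> 'k) \<Rightarrow> (nat \<Rightarrow> 'k) set set" where
  "lin_nonzero n X l = {P \<in> X. \<exists>x\<in>P. lin n l x \<noteq> 0}"

definition coord_fun :: "nat \<Rightarrow> (nat \<Rightarrow> 'k::field) \<Rightarrow> nat \<Rightarrow> (nat \<Rightarrow> 'k) set \<Rightarrow> 'k" where
  "coord_fun n l i = form_quotient (\<lambda>z. z i) (lin n l)"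

lemma coord_fun_proj_pt: "i \<le> n \<Longrightarrow> coord_fun n l i (proj_pt z) = z i / lin n l z"
  unfolding coord_fun_def by (rule form_quotient_proj_pt[OF form_var form_lin])

lemma zopen_lin_nonzero: "zopen n X (lin_nonzero n X l)"
  unfolding lin_nonzero_def by (rule zopen_basic[OF form_lin])

lemma regular_coord_fun:
  "i \<le> n \<Longrightarrow> X \<subseteq> proj_space n \<Longrightarrow> zopen n X W \<Longrightarrow> W \<subseteq> lin_nonzero n X l \<Longrightarrow> regular n X W (coord_fun n l i)"
  unfolding coord_fun_def lin_nonzero_def by (rule regular_form_quotient[OF form_var form_lin])

context char_power
begin

context
  fixes n d :: nat and \<phi> :: "(nat \<Rightarrow> 'k) set \<Rightarrow> (nat \<Rightarrow> 'k) set" and fp :: "nat \<Rightarrow> 'k poly"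
  assumes bc: "binary_coords n d fp"
    and \<phi>: "\<And>x. bin_vec x \<Longrightarrow> \<phi> (proj_pt x) = proj_pt (hom_vec d fp x)"
    and mor: "is_morphism n (fermat_cone n) \<phi>"
    and d1: "d \<ge> 1"
begin

abbreviation "X \<equiv> fermat_cone n"
abbreviation "Fv \<equiv> hom_vec d fp"

lemma X_proj: "X \<subseteq> proj_space n"
  by (rule fermat_proj_space)

lemma deg_fp: "degree (fp i) \<le> d"
  using bc unfolding binary_coords_def by blast

lemma Fv_pt: "Fv (pt t) i = poly (fp i) t"
  unfolding hom_vec_def by (rule hom_pt[OF deg_fp])

lemma Fv_above: "i > n \<Longrightarrow> Fv x i = 0"
  by (rule hom_vec_above[OF bc])

lemma proj_pt_Fv_in_X: "bin_vec x \<Longrightarrow> proj_pt (Fv x) \<in> X"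
  using mor \<phi> bin_vec_P1 unfolding is_morphism_def by (metis imageI subsetD)

lemma Fv_fermat:
  assumes "bin_vec x"
  shows "(\<Sum>i\<le>n. Fv x i ^ (q + 1)) = 0"
  using proj_pt_Fv_in_X[OF assms] proj_pt_refl unfolding fermat_def by blast

lemma fp_fermat: "(\<Sum>i\<le>n. fp i ^ q * fp i) = 0"
proof (rule poly_eqI_infinite_field)
  fix t
  have "poly (\<Sum>i\<le>n. fp i ^ q * fp i) t = (\<Sum>i\<le>n. Fv (pt t) i ^ (q + 1))"
    by (simp add: poly_sum Fv_pt mult.commute)
  then show "poly (\<Sum>i\<le>n. fp i ^ q * fp i) t = poly 0 t" using Fv_fermat[OF bin_vec_pt(1)] by simp
qed

lemma zopen_preimage: "zopen n X W \<Longrightarrow> zopen 1 P1 (preimage \<phi> W)"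
  using mor unfolding is_morphism_def by blast

lemma zopen_P1_point:
  assumes "zopen 1 P1 V" "R \<in> V" "x \<in> R"
  shows "bin_vec x" "R = proj_pt x" "\<phi> R = proj_pt (Fv x)"
proof -
  have "R \<in> P1" using assms zopen_subset by blast
  then show "bin_vec x" "R = proj_pt x" using P1_bin_vec[OF _ assms(3)] by simp_all
  then show "\<phi> R = proj_pt (Fv x)" using \<phi> by simp
qed

text \<open>The vector field w has degree d2 - d3 = d - 1 along coordinates of degree d, so
  derivatives of functions of degree 0 have degree (d - 1) - d = -1. This is the source of the
  twist; the derivation laws are those of \<open>dfun\<close>.\<close>

lemma tangent_section_dfun:
  assumes V: "zopen 1 P1 V" and den: "form 1 d3 den" and \<omega>: "\<And>i. form 1 d2 (\<lambda>x. \<omega> x i)"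
    and d: "d2 + 1 = d3 + d" "d2 \<ge> d"
    and nz: "\<And>R x. R \<in> V \<Longrightarrow> x \<in> R \<Longrightarrow> den x \<noteq> 0"
    and w: "\<And>R x i. R \<in> V \<Longrightarrow> x \<in> R \<Longrightarrow> w x i = \<omega> x i / den x"
    and tan: "\<And>R x. R \<in> V \<Longrightarrow> x \<in> R \<Longrightarrow> cone_tangent n (Fv x) (w x)"
  shows "tangent_section n X \<phi> (- 1) V (\<lambda>W f x. dfun n X f (Fv x) (w x))"
  unfolding tangent_section_def
proof (intro conjI allI impI)
  fix W f assume Wf: "zopen n X W \<and> regular n X W f"
  show "twist_section 1 P1 (- 1) (V \<inter> preimage \<phi> W) (\<lambda>x. dfun n X f (Fv x) (w x))"
    unfolding twist_section_def
  proof
    fix Q assume Q: "Q \<in> V \<inter> preimage \<phi> W"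
    then have QW: "\<phi> Q \<in> W" unfolding preimage_def by simp
    obtain \<delta> g h where "local_quotient n X f (\<phi> Q) \<delta> g h"
      using regular_local_quotient[OF _ QW] Wf by blast
    then obtain V1 where V1: "form n \<delta> g" "form n \<delta> h" "zopen n X V1" "\<phi> Q \<in> V1"
      "\<And>R x. R \<in> V1 \<Longrightarrow> x \<in> R \<Longrightarrow> h x \<noteq> 0" "\<And>R x. R \<in> V1 \<Longrightarrow> x \<in> R \<Longrightarrow> f (proj_pt x) = g x / h x"
      by (rule local_quotientE) (rule that)
    define N where "N = V \<inter> preimage \<phi> (V1 \<inter> W)"
    have N: "zopen 1 P1 N" unfolding N_def
      using Wf V1(3) V by (intro zopen_Int zopen_preimage X_proj) auto
    \<comment> \<open>The degree of the derivative of \<open>g\<close> along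
      \<open>\<omega>\<close>, that is (\<delta> - 1) d + d2; by \<open>d2 \<ge> d\<close> the
      subtraction is exact.\<close>
    define e where "e = \<delta> * d + d2 - d"
    have e: "e + d = \<delta> * d + d2" unfolding e_def using d(2) by simp
    define num where "num x = dderiv g (Fv x) (\<omega> x) * h (Fv x) - g (Fv x) * dderiv h (Fv x) (\<omega> x)" for x
    have gF: "form 1 (\<delta> * d) (\<lambda>x. g (Fv x))" "form 1 (\<delta> * d) (\<lambda>x. h (Fv x))"
      by (rule form_comp[OF V1(1) form_hom_vec], rule form_comp[OF V1(2) form_hom_vec])
    have dF: "form 1 e (\<lambda>x. dderiv g (Fv x) (\<omega> x))" "form 1 e (\<lambda>x. dderiv h (Fv x) (\<omega> x))"
      by (rule form_dderiv_comp[OF V1(1) form_hom_vec \<omega> e], rule form_dderiv_comp[OF V1(2) form_hom_vec \<omega> e])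
    have "form 1 (e + \<delta> * d) num"
      unfolding num_def[abs_def]
      using form_diff[OF form_mult[OF dF(1) gF(2)], of "\<lambda>x. g (Fv x) * dderiv h (Fv x) (\<omega> x)"]
        form_mult[OF gF(1) dF(2)] by (simp add: add.commute)
    moreover have "form 1 (d3 + 2 * (\<delta> * d)) (\<lambda>x. den x * h (Fv x) ^ 2)"
      by (rule form_mult[OF den form_power[OF gF(2)]])
    moreover have "int (e + \<delta> * d) = int (d3 + 2 * (\<delta> * d)) + - 1" using e d by linarith
    moreover have "den x * h (Fv x) ^ 2 \<noteq> 0 \<and> dfun n X f (Fv x) (w x) = num x / (den x * h (Fv x) ^ 2)"
      if R: "R \<in> N" "x \<in> R" for R x
    proof -
      have RV: "R \<in> V" using R(1) unfolding N_def by blast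
      have \<phi>R: "\<phi> R = proj_pt (Fv x)" by (rule zopen_P1_point(3)[OF V RV R(2)])
      then have FV1: "proj_pt (Fv x) \<in> V1" using R(1) unfolding N_def preimage_def by auto
      have lq: "local_quotient n X f (proj_pt (Fv x)) \<delta> g h"
        by (rule local_quotientI[OF V1(1-3) FV1 V1(5,6)])
      have "w x = (\<lambda>i. \<omega> x i / den x)" using w[OF RV R(2)] by (rule ext)
      then have "dfun n X f (Fv x) (w x) =
          (dderiv g (Fv x) (\<omega> x) / den x * h (Fv x) - g (Fv x) * (dderiv h (Fv x) (\<omega> x) / den x)) / (h (Fv x))\<^sup>2"
        using dfun_eq[OF lq tan[OF RV R(2)]] dderiv_divide[OF V1(1)] dderiv_divide[OF V1(2)] by simp
      also have "\<dots> = num x / (den x * h (Fv x) ^ 2)"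
        unfolding num_def by (simp add: diff_divide_distrib)
      finally show ?thesis using nz[OF RV R(2)] V1(5)[OF FV1 proj_pt_refl] by simp
    qed
    moreover have "Q \<in> N" unfolding N_def using Q V1(4) QW unfolding preimage_def by auto
    moreover have "N \<subseteq> V \<inter> preimage \<phi> W" unfolding N_def preimage_def by auto
    ultimately show "\<exists>V' g h da d'. zopen 1 P1 V' \<and> Q \<in> V' \<and> V' \<subseteq> V \<inter> preimage \<phi> W \<and>
        form 1 da g \<and> form 1 d' h \<and> int da = int d' + - 1 \<and>
        (\<forall>Q\<in>V'. \<forall>x\<in>Q. h x \<noteq> 0 \<and> dfun n X f (Fv x) (w x) = g x / h x)"
      using N by blast
  qed
next
  fix W W' f f'
  assume *: "zopen n X W \<and> zopen n X W' \<and> W' \<subseteq> W \<and> regular n X W f \<and> regular n X W' f' \<and> (\<forall>P\<in>W'. f P = f' P)"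
  show "\<forall>Q\<in>V \<inter> preimage \<phi> W'. \<forall>x\<in>Q. dfun n X f (Fv x) (w x) = dfun n X f' (Fv x) (w x)"
  proof (intro ballI)
    fix Q x assume Q: "Q \<in> V \<inter> preimage \<phi> W'" "x \<in> Q"
    then have QV: "Q \<in> V" and "\<phi> Q \<in> W'" unfolding preimage_def by auto
    then have FW: "proj_pt (Fv x) \<in> W'" using zopen_P1_point(3)[OF V QV Q(2)] by simp
    then have "proj_pt (Fv x) \<in> W" using * by blast
    then obtain \<delta> g h where lq: "local_quotient n X f (proj_pt (Fv x)) \<delta> g h"
      using regular_local_quotient * by blast
    show "dfun n X f (Fv x) (w x) = dfun n X f' (Fv x) (w x)"
      using dfun_cong[OF lq tan[OF QV Q(2)] _ FW, of f'] * by simp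
  qed
next
  fix W f g assume *: "zopen n X W \<and> regular n X W f \<and> regular n X W g"
  show "\<forall>Q\<in>V \<inter> preimage \<phi> W. \<forall>x\<in>Q.
          (\<forall>c. dfun n X (\<lambda>P. c * f P) (Fv x) (w x) = c * dfun n X f (Fv x) (w x)) \<and>
          dfun n X (\<lambda>P. f P + g P) (Fv x) (w x) = dfun n X f (Fv x) (w x) + dfun n X g (Fv x) (w x) \<and>
          dfun n X (\<lambda>P. f P * g P) (Fv x) (w x) =
          f (\<phi> Q) * dfun n X g (Fv x) (w x) + g (\<phi> Q) * dfun n X f (Fv x) (w x)"
  proof (intro ballI)
    fix Q x assume Q: "Q \<in> V \<inter> preimage \<phi> W" "x \<in> Q"
    then have QV: "Q \<in> V" and "\<phi> Q \<in> W" unfolding preimage_def by auto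
    then have \<phi>Q: "\<phi> Q = proj_pt (Fv x)" and FW: "proj_pt (Fv x) \<in> W"
      using zopen_P1_point(3)[OF V QV Q(2)] by simp_all
    obtain \<delta> a b where 1: "local_quotient n X f (proj_pt (Fv x)) \<delta> a b"
      using regular_local_quotient[OF _ FW] * by blast
    obtain \<delta>' a' b' where 2: "local_quotient n X g (proj_pt (Fv x)) \<delta>' a' b'"
      using regular_local_quotient[OF _ FW] * by blast
    note t = tan[OF QV Q(2)]
    show "(\<forall>c. dfun n X (\<lambda>P. c * f P) (Fv x) (w x) = c * dfun n X f (Fv x) (w x)) \<and>
          dfun n X (\<lambda>P. f P + g P) (Fv x) (w x) = dfun n X f (Fv x) (w x) + dfun n X g (Fv x) (w x) \<and>
          dfun n X (\<lambda>P. f P * g P) (Fv x) (w x) =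
          f (\<phi> Q) * dfun n X g (Fv x) (w x) + g (\<phi> Q) * dfun n X f (Fv x) (w x)"
      unfolding \<phi>Q using dfun_scale[OF 1 t] dfun_add[OF 1 t 2] dfun_mult[OF 1 t 2] by blast
  qed
qed

section \<open>Charts of the projective line, derivations on them and the cocycle of lifts\<close>

definition chart :: "(nat \<Rightarrow> 'k) \<Rightarrow> (nat \<Rightarrow> 'k) set set" where
  "chart l = {Q \<in> P1. \<exists>x\<in>Q. lin n l (Fv x) \<noteq> 0}"

lemma form_lin_Fv: "form 1 d (\<lambda>x. lin n l (Fv x))"
proof -
  have "form 1 (1 * d) (\<lambda>x. lin n l (Fv x))" by (rule form_comp[OF form_lin form_hom_vec])
  then show ?thesis by simp
qed

lemma zopen_chart: "zopen 1 P1 (chart l)"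
  unfolding chart_def by (rule zopen_basic[OF form_lin_Fv])

lemma chart_nonzero:
  assumes "R \<in> chart l" "x \<in> R"
  shows "lin n l (Fv x) \<noteq> 0"
proof -
  obtain y where y: "R \<in> P1" "y \<in> R" "lin n l (Fv y) \<noteq> 0" using assms(1) unfolding chart_def by blast
  then have "x \<in> proj_pt y" using assms(2) P1_bin_vec by blast
  then show ?thesis using form_proj_pt_nonzero[OF form_lin_Fv _ y(3)] by blast
qed

lemma chart_iff: "bin_vec x \<Longrightarrow> proj_pt x \<in> chart l \<longleftrightarrow> lin n l (Fv x) \<noteq> 0"
  using chart_nonzero[OF _ proj_pt_refl] bin_vec_P1 proj_pt_refl unfolding chart_def by blast

lemma chart_preimage:
  assumes "R \<in> chart l"
  shows "R \<in> preimage \<phi> (lin_nonzero n X l)"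
proof -
  obtain y where y: "R \<in> P1" "y \<in> R" "lin n l (Fv y) \<noteq> 0" using assms unfolding chart_def by blast
  have "\<phi> R = proj_pt (Fv y)" "bin_vec y" using zopen_P1_point[OF zopen_chart assms y(2)] by simp_all
  then show ?thesis unfolding preimage_def lin_nonzero_def using y proj_pt_Fv_in_X[of y] proj_pt_refl[of "Fv y"]
    by auto
qed

lemma coord_fun_\<phi>:
  assumes "R \<in> chart l" "x \<in> R" "i \<le> n"
  shows "coord_fun n l' i (\<phi> R) = Fv x i / lin n l' (Fv x)"
  unfolding zopen_P1_point(3)[OF zopen_chart assms(1,2)] by (rule coord_fun_proj_pt[OF assms(3)])

text \<open>The affine coordinates T_i / l satisfy the sum of their (q+1)-st powers = 0. The
  derivation applied to this relation gives the claim, as q + 1 equals 1 in k.\<close>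

lemma derivation_tangency:
  assumes D: "tangent_section n X \<phi> m (chart l) D" and R: "R \<in> chart l" "x \<in> R"
  shows "(\<Sum>i\<le>n. Fv x i ^ q * D (lin_nonzero n X l) (coord_fun n l i) x) = 0"
proof -
  let ?W = "lin_nonzero n X l" and ?\<tau> = "coord_fun n l"
  have W: "zopen n X ?W" by (rule zopen_lin_nonzero)
  have Q: "R \<in> chart l \<inter> preimage \<phi> ?W" using R chart_preimage by blast
  have reg: "regular n X ?W (?\<tau> i)" if "i \<le> n" for i
    by (rule regular_coord_fun[OF that X_proj W]) simp
  have zero: "(\<Sum>i\<le>n. ?\<tau> i P ^ Suc q) = 0" if P: "P \<in> ?W" for P
  proof -
    obtain z where z: "z \<in> P" "P \<in> X" using P unfolding lin_nonzero_def by blast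
    then have "P \<in> proj_space n" using X_proj by blast
    then have Pz: "P = proj_pt z" using z(1) by (rule proj_spaceD(1))
    have "(\<Sum>i\<le>n. ?\<tau> i P ^ Suc q) = (\<Sum>i\<le>n. z i ^ (q + 1)) / lin n l z ^ (q + 1)"
      unfolding Pz sum_divide_distrib by (intro sum.cong) (simp_all add: coord_fun_proj_pt power_divide)
    then show ?thesis using z unfolding fermat_def by simp
  qed
  have "D ?W (\<lambda>P. \<Sum>i\<le>n. ?\<tau> i P ^ Suc q) x = D ?W (\<lambda>_. 0) x"
  proof (rule tangent_section_cong[OF D X_proj W Q R(2) W order_refl])
    show "regular n X ?W (\<lambda>_. 0)" by (rule regular_const[OF W X_proj])
    show "regular n X ?W (\<lambda>P. \<Sum>i\<le>n. ?\<tau> i P ^ Suc q)"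
      by (intro regular_sum[OF W X_proj] regular_power[OF W X_proj] reg) simp
  qed (rule zero)
  also have "\<dots> = 0" by (rule tangent_section_const[OF D X_proj W Q R(2)])
  also have "D ?W (\<lambda>P. \<Sum>i\<le>n. ?\<tau> i P ^ Suc q) x = (\<Sum>i\<le>n. D ?W (\<lambda>P. ?\<tau> i P ^ Suc q) x)"
    by (rule tangent_section_sum[OF D X_proj W Q R(2)], simp, rule regular_power[OF W X_proj reg], simp)
  also have "\<dots> = (\<Sum>i\<le>n. Fv x i ^ q * D ?W (?\<tau> i) x / lin n l (Fv x) ^ q)"
  proof (rule sum.cong)
    fix i assume "i \<in> {..n}"
    then have i: "i \<le> n" by simp
    have "D ?W (\<lambda>P. ?\<tau> i P ^ Suc q) x = of_nat (Suc q) * ?\<tau> i (\<phi> R) ^ q * D ?W (?\<tau> i) x"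
      by (rule tangent_section_power[OF D X_proj W Q R(2) reg[OF i]])
    then show "D ?W (\<lambda>P. ?\<tau> i P ^ Suc q) x = Fv x i ^ q * D ?W (?\<tau> i) x / lin n l (Fv x) ^ q"
      using coord_fun_\<phi>[OF R i] by (simp add: of_nat_q power_divide)
  qed simp
  also have "\<dots> = (\<Sum>i\<le>n. Fv x i ^ q * D ?W (?\<tau> i) x) / lin n l (Fv x) ^ q"
    by (simp add: sum_divide_distrib)
  finally show ?thesis using chart_nonzero[OF R] by simp
qed

text \<open>On \<open>W \<inter> W'\<close> one has \<open>T\<^sub>i/l \<cdot> l/l' = T\<^sub>i/l'\<close>; here \<open>l\<close> is the coordinate \<open>T\<^sub>i\<^sub>0\<close>.\<close>

lemma derivation_change_chart:
  assumes D: "tangent_section n X \<phi> m (chart l') D" and R: "R \<in> chart l" "R \<in> chart l'" "x \<in> R"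
    and l: "\<And>z. lin n l z = z i0" "i0 \<le> n" and i: "i \<le> n"
  shows "D (lin_nonzero n X l') (coord_fun n l' i) x =
     Fv x i / Fv x i0 * D (lin_nonzero n X l') (coord_fun n l' i0) x +
     Fv x i0 / lin n l' (Fv x) * D (lin_nonzero n X l) (coord_fun n l i) x"
proof -
  let ?W = "lin_nonzero n X l" and ?W' = "lin_nonzero n X l'"
  let ?\<tau> = "coord_fun n l" and ?\<tau>' = "coord_fun n l'"
  have W: "zopen n X (?W \<inter> ?W')" by (rule zopen_Int[OF zopen_lin_nonzero zopen_lin_nonzero X_proj])
  have Q: "R \<in> chart l' \<inter> preimage \<phi> (?W \<inter> ?W')"
    using R chart_preimage[OF R(1)] chart_preimage[OF R(2)] unfolding preimage_def by auto
  have reg: "regular n X ?W (?\<tau> i)" "regular n X (?W \<inter> ?W') (?\<tau> i)" if "i \<le> n" for i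
    by (rule regular_coord_fun[OF that X_proj zopen_lin_nonzero], simp,
        rule regular_coord_fun[OF that X_proj W], simp)
  have reg': "regular n X ?W' (?\<tau>' i)" "regular n X (?W \<inter> ?W') (?\<tau>' i)" if "i \<le> n" for i
    by (rule regular_coord_fun[OF that X_proj zopen_lin_nonzero], simp,
        rule regular_coord_fun[OF that X_proj W], simp)
  have eq: "?\<tau> i P * ?\<tau>' i0 P = ?\<tau>' i P" if P: "P \<in> ?W \<inter> ?W'" for P
  proof -
    obtain z where z: "z \<in> P" "lin n l z \<noteq> 0" "P \<in> X" using P unfolding lin_nonzero_def by blast
    then have "P \<in> proj_space n" using X_proj by blast
    then have Pz: "P = proj_pt z" using z(1) by (rule proj_spaceD(1))
    show ?thesis using z(2) unfolding Pz coord_fun_proj_pt[OF i] coord_fun_proj_pt[OF l(2)] l(1) by simp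
  qed
  note tc = tangent_section_cong[OF D X_proj W Q R(3)]
  have "D ?W' (?\<tau>' i) x = D (?W \<inter> ?W') (\<lambda>P. ?\<tau> i P * ?\<tau>' i0 P) x"
    by (rule tc[symmetric, OF zopen_lin_nonzero _ reg'(1)[OF i]
          regular_mult[OF W X_proj reg(2)[OF i] reg'(2)[OF l(2)]] eq]) auto
  also have "\<dots> = ?\<tau> i (\<phi> R) * D (?W \<inter> ?W') (?\<tau>' i0) x + ?\<tau>' i0 (\<phi> R) * D (?W \<inter> ?W') (?\<tau> i) x"
    by (rule tangent_section_rules(3)[OF D X_proj W Q R(3) reg(2)[OF i] reg'(2)[OF l(2)]])
  also have "D (?W \<inter> ?W') (?\<tau>' i0) x = D ?W' (?\<tau>' i0) x"
    by (rule tc[OF zopen_lin_nonzero _ reg'(1)[OF l(2)] reg'(2)[OF l(2)]]) auto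
  also have "D (?W \<inter> ?W') (?\<tau> i) x = D ?W (?\<tau> i) x"
    by (rule tc[OF zopen_lin_nonzero _ reg(1)[OF i] reg(2)[OF i]]) auto
  finally show ?thesis
    unfolding coord_fun_\<phi>[OF R(1,3) i] coord_fun_\<phi>[OF R(1,3) l(2)] l(1) .
qed

text \<open>The lift \<open>F l\<^sup>q / l(f)\<^sup>q\<close> of \<open>F\<close> along \<open>(f\<^sub>0\<^sup>q, \<dots>, f\<^sub>n\<^sup>q)\<close> on the chart where \<open>l(f)\<close> does not vanish.\<close>

definition chart_lift :: "((nat \<Rightarrow> 'k) \<Rightarrow> 'k) \<Rightarrow> (nat \<Rightarrow> 'k) \<Rightarrow> (nat \<Rightarrow> 'k) \<Rightarrow> nat \<Rightarrow> 'k" where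
  "chart_lift G l x i = (if i \<le> n then l i ^ q else 0) * G x / lin n l (Fv x) ^ q"

lemma lin_power_q: "lin n l (z :: nat \<Rightarrow> 'k) ^ q = (\<Sum>i\<le>n. l i ^ q * z i ^ q)"
  by (simp add: lin_def power_q_sum power_mult_distrib)

lemma sum_chart_lift:
  assumes "lin n l (Fv x) \<noteq> 0"
  shows "(\<Sum>i\<le>n. Fv x i ^ q * chart_lift G l x i) = G x"
proof -
  have "(\<Sum>i\<le>n. Fv x i ^ q * chart_lift G l x i) = (\<Sum>i\<le>n. l i ^ q * Fv x i ^ q) * (G x / lin n l (Fv x) ^ q)"
    unfolding sum_distrib_right by (intro sum.cong) (simp_all add: chart_lift_def)
  then show ?thesis using assms unfolding lin_power_q[symmetric] by simp
qed

definition lift_diff :: "((nat \<Rightarrow> 'k) \<Rightarrow> 'k) \<Rightarrow> (nat \<Rightarrow> 'k) \<Rightarrow> (nat \<Rightarrow> 'k) \<Rightarrow> (nat \<Rightarrow> 'k) \<Rightarrow> nat \<Rightarrow> 'k" where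
  "lift_diff G l l' x i = chart_lift G l' x i - chart_lift G l x i"

text \<open>Both lifts map to the same \<open>G\<close>, so the differential of the equation kills
  their difference.\<close>

lemma cone_tangent_lift_diff:
  assumes "R \<in> chart l" "R \<in> chart l'" "x \<in> R"
  shows "cone_tangent n (Fv x) (lift_diff G l l' x)"
proof -
  have "bin_vec x" using zopen_P1_point(1)[OF zopen_chart assms(1,3)] .
  moreover have "(\<Sum>i\<le>n. Fv x i ^ q * lift_diff G l l' x i) = 0"
    using sum_chart_lift[OF chart_nonzero[OF assms(1,3)]] sum_chart_lift[OF chart_nonzero[OF assms(2,3)]]
    by (simp add: lift_diff_def right_diff_distrib sum_subtractf)
  moreover have "lift_diff G l l' x i = 0" if "i > n" for i
    using that by (simp add: lift_diff_def chart_lift_def)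
  ultimately show ?thesis unfolding cone_tangent_def
    using Fv_above Fv_fermat hom_vec_nonzero[OF bc] by blast
qed

text \<open>Over the common denominator, of degree 2 q d, the numerator has degree q d + (q + 1) d -
  1. The difference is d - 1, as \<open>tangent_section_dfun\<close> requires; this dictates the
  degree of \<open>G\<close>.\<close>

lemma tangent_section_lift_diff:
  assumes G: "form 1 ((q + 1) * d - 1) G"
  shows "tangent_section n X \<phi> (- 1) (chart l \<inter> chart l') (\<lambda>W f x. dfun n X f (Fv x) (lift_diff G l l' x))"
proof (rule tangent_section_dfun)
  define e where "e = (q + 1) * d - 1"
  let ?A = "\<lambda>l x. lin n l (Fv x) ^ q"
  let ?c = "\<lambda>l i. if i \<le> n then l i ^ q else (0 :: 'k)"
  show "zopen 1 P1 (chart l \<inter> chart l')" by (rule zopen_Int[OF zopen_chart zopen_chart]) simp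
  show "form 1 (q * d + q * d) (\<lambda>x. ?A l x * ?A l' x)"
    by (intro form_mult form_power form_lin_Fv)
  have fo: "form 1 (q * d + e) (\<lambda>x. ?A k x * (c * G x))" for k c
    using G unfolding e_def by (intro form_mult form_power form_lin_Fv form_scale)
  show "form 1 (q * d + e) (\<lambda>x. ?A l x * (?c l' i * G x) - ?A l' x * (?c l i * G x))" for i
    by (rule form_diff[OF fo fo])
  have pos: "1 \<le> (q + 1) * d" "(q + 1) * d = q * d + d" "1 \<le> q * d" using d1 q_ge_2 by simp_all
  show "q * d + e + 1 = q * d + q * d + d" "d \<le> q * d + e" unfolding e_def using pos by linarith+
  fix R x assume R: "R \<in> chart l \<inter> chart l'" "x \<in> R"
  then have nz: "lin n l (Fv x) \<noteq> 0" "lin n l' (Fv x) \<noteq> 0" using chart_nonzero by blast+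
  then show "?A l x * ?A l' x \<noteq> 0" by simp
  show "lift_diff G l l' x i = (?A l x * (?c l' i * G x) - ?A l' x * (?c l i * G x)) / (?A l x * ?A l' x)" for i
    unfolding lift_diff_def chart_lift_def using nz by (simp add: field_simps)
  show "cone_tangent n (Fv x) (lift_diff G l l' x)" by (rule cone_tangent_lift_diff) (use R in auto)
qed

lemma dfun_coord_fun:
  assumes R: "R \<in> chart l" "x \<in> R" and tan: "cone_tangent n (Fv x) v"
    and l: "\<And>z. lin n l z = z i0" "i0 \<le> n" and i: "i \<le> n"
  shows "dfun n X (coord_fun n l i) (Fv x) v = (v i * Fv x i0 - Fv x i * v i0) / (Fv x i0)\<^sup>2"
proof -
  have "proj_pt (Fv x) \<in> lin_nonzero n X l"
    using chart_preimage[OF R(1)] zopen_P1_point(3)[OF zopen_chart R] unfolding preimage_def by simp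
  then have lq: "local_quotient n X (coord_fun n l i) (proj_pt (Fv x)) 1 (\<lambda>z. z i) (lin n l)"
    unfolding coord_fun_def lin_nonzero_def
    by (intro local_quotient_form_quotient[OF form_var[OF i] form_lin X_proj])
  have "lin n l = (\<lambda>z. z i0)" using l(1) by (rule ext)
  then show ?thesis using dfun_eq[OF lq tan] by simp
qed

text \<open>Freeness is applied to the differences of the local lifts, which form a cocycle because
  they telescope and the derivative is linear in the vector.\<close>

lemma lift_diff_coboundary:
  assumes free: "free_morphism n X \<phi>" and G: "form 1 ((q + 1) * d - 1) G"
    and cover: "chart l0 \<union> chart l1 = P1" and ne: "chart l0 \<noteq> chart l1"
  obtains b0 b1 where "tangent_section n X \<phi> (- 1) (chart l0) b0" "tangent_section n X \<phi> (- 1) (chart l1) b1"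
    "\<And>W f Q x. zopen n X W \<Longrightarrow> regular n X W f \<Longrightarrow> Q \<in> chart l0 \<inter> chart l1 \<inter> preimage \<phi> W \<Longrightarrow> x \<in> Q \<Longrightarrow>
       dfun n X f (Fv x) (lift_diff G l0 l1 x) = b1 W f x - b0 W f x"
proof -
  \<comment> \<open>Cochains are indexed by open sets, so the linear form must be recovered from its
    chart; \<open>ne\<close> makes this possible.\<close>
  define L where "L U = (if U = chart l0 then l0 else l1)" for U
  define c where "c U V W f x = dfun n X f (Fv x) (lift_diff G (L U) (L V) x)" for U V and W :: "(nat \<Rightarrow> 'k) set set" and f x
  let ?\<U> = "{chart l0, chart l1}"
  have L: "chart (L U) = U" if "U \<in> ?\<U>" for U using that unfolding L_def by auto
  have Ll: "L (chart l0) = l0" "L (chart l1) = l1" unfolding L_def using ne by auto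
  have 1: "\<forall>U\<in>?\<U>. zopen 1 P1 U" using zopen_chart by auto
  have 2: "\<Union>?\<U> = P1" using cover by simp
  have 3: "\<forall>U\<in>?\<U>. \<forall>V\<in>?\<U>. tangent_section n X \<phi> (- 1) (U \<inter> V) (c U V)"
  proof (intro ballI)
    fix U V assume UV: "U \<in> ?\<U>" "V \<in> ?\<U>"
    show "tangent_section n X \<phi> (- 1) (U \<inter> V) (c U V)"
      using tangent_section_lift_diff[OF G, of "L U" "L V"]
      unfolding L[OF UV(1)] L[OF UV(2)] c_def[abs_def] .
  qed
  have 4: "\<forall>U\<in>?\<U>. \<forall>V\<in>?\<U>. \<forall>T\<in>?\<U>. tsection_eq n X \<phi> (U \<inter> V \<inter> T)
            (c U T) (\<lambda>W f x. c U V W f x + c V T W f x)"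
  proof (intro ballI)
    fix U V T assume UVT: "U \<in> ?\<U>" "V \<in> ?\<U>" "T \<in> ?\<U>"
    show "tsection_eq n X \<phi> (U \<inter> V \<inter> T) (c U T) (\<lambda>W f x. c U V W f x + c V T W f x)"
      unfolding tsection_eq_def
    proof (intro allI impI ballI)
      fix W f Q x
      assume Wf: "zopen n X W \<and> regular n X W f" and Q: "Q \<in> U \<inter> V \<inter> T \<inter> preimage \<phi> W" and x: "x \<in> Q"
      have Q': "Q \<in> chart (L U)" "Q \<in> chart (L V)" "Q \<in> chart (L T)" "\<phi> Q \<in> W"
        using Q L UVT unfolding preimage_def by auto
      then have "proj_pt (Fv x) \<in> W" using zopen_P1_point(3)[OF zopen_chart Q'(1) x] by simp
      then obtain \<delta> g h where lq: "local_quotient n X f (proj_pt (Fv x)) \<delta> g h"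
        using regular_local_quotient Wf by blast
      \<comment> \<open>The telescoping sum, written with coefficients 1 to match
        \<open>dfun_combine\<close>.\<close>
      have "lift_diff G (L U) (L T) x = (\<lambda>i. 1 * lift_diff G (L U) (L V) x i + 1 * lift_diff G (L V) (L T) x i)"
        by (simp add: lift_diff_def[abs_def])
      then have "c U T W f x = dfun n X f (Fv x)
          (\<lambda>i. 1 * lift_diff G (L U) (L V) x i + 1 * lift_diff G (L V) (L T) x i)"
        unfolding c_def by (rule arg_cong)
      also have "\<dots> = 1 * c U V W f x + 1 * c V T W f x"
        unfolding c_def
        by (rule dfun_combine[OF lq])
           (rule cone_tangent_lift_diff[OF Q'(1,2) x], rule cone_tangent_lift_diff[OF Q'(2,3) x])
      finally show "c U T W f x = c U V W f x + c V T W f x" by simp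
    qed
  qed
  note H1 = free[unfolded free_morphism_def H1_tangent_zero_def]
  from H1[THEN spec[of _ ?\<U>], THEN spec[of _ c], THEN mp, OF conjI[OF 1 conjI[OF 2 conjI[OF 3 4]]]]
  obtain b where b: "\<forall>U\<in>?\<U>. tangent_section n X \<phi> (- 1) U (b U)"
    "\<forall>U\<in>?\<U>. \<forall>V\<in>?\<U>. tsection_eq n X \<phi> (U \<inter> V) (c U V) (\<lambda>W f x. b V W f x - b U W f x)"
    by (elim exE conjE)
  show ?thesis
  proof (rule that[of "b (chart l0)" "b (chart l1)"])
    fix W f Q x
    assume *: "zopen n X W" "regular n X W f" "Q \<in> chart l0 \<inter> chart l1 \<inter> preimage \<phi> W" "x \<in> Q"
    have "tsection_eq n X \<phi> (chart l0 \<inter> chart l1) (c (chart l0) (chart l1))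
        (\<lambda>W f x. b (chart l1) W f x - b (chart l0) W f x)" using b(2) by simp
    then have "c (chart l0) (chart l1) W f x = b (chart l1) W f x - b (chart l0) W f x"
      unfolding tsection_eq_def using * by blast
    then show "dfun n X f (Fv x) (lift_diff G l0 l1 x) = b (chart l1) W f x - b (chart l0) W f x"
      unfolding c_def Ll .
  qed (use b(1) in simp_all)
qed

section \<open>Charts in the affine coordinate and sections as rational functions\<close>

definition lin_poly :: "(nat \<Rightarrow> 'k) \<Rightarrow> 'k poly" where
  "lin_poly l = (\<Sum>i\<le>n. smult (l i) (fp i))"

lemma degree_lin_poly: "degree (lin_poly l) \<le> d"
  unfolding lin_poly_def by (intro degree_sum_le finite_atMost order_trans[OF degree_smult_le deg_fp])

lemma lin_Fv: "lin n l (Fv x) = hom d (lin_poly l) x"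
  by (simp add: lin_def lin_poly_def hom_sum hom_smult hom_vec_def)

lemma pt_in_chart: "proj_pt (pt t) \<in> chart l \<longleftrightarrow> poly (lin_poly l) t \<noteq> 0"
  unfolding chart_iff[OF bin_vec_pt(1)] lin_Fv hom_pt[OF degree_lin_poly] ..

lemma pt_inf_in_chart: "proj_pt pt_inf \<in> chart l \<longleftrightarrow> coeff (lin_poly l) d \<noteq> 0"
  unfolding chart_iff[OF bin_vec_pt(2)] lin_Fv hom_pt_inf ..

text \<open>For \<open>l0\<close> a coordinate is taken whose polynomial has exact degree
  \<open>d\<close>. For \<open>l1\<close> the coefficients run along the curve (1, s, s^2, ...): a
  given point is bad for finitely many s only, and just infinity and the zeros of \<open>l0\<close>
  have to be avoided.\<close>

lemma good_charts:
  obtains i0 l0 l1 where "i0 \<le> n" "\<And>z. lin n l0 z = z i0"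
    "coeff (lin_poly l0) d \<noteq> 0" "coeff (lin_poly l1) d \<noteq> 0"
    "\<And>t. poly (lin_poly l0) t = 0 \<Longrightarrow> poly (lin_poly l1) t \<noteq> 0"
proof -
  obtain i0 where i0: "i0 \<le> n" "coeff (fp i0) d \<noteq> 0" using bc unfolding binary_coords_def by blast
  define l0 :: "nat \<Rightarrow> 'k" where "l0 = (\<lambda>i. if i = i0 then 1 else 0)"
  have l0: "lin n l0 z = z i0" for z
    using i0(1) by (simp add: lin_def l0_def if_distrib[of "\<lambda>u. u * _"] cong: if_cong)
  have lp0: "lin_poly l0 = fp i0"
    using i0(1) by (simp add: lin_poly_def l0_def if_distrib[of "\<lambda>u. smult u _"] cong: if_cong)
  \<comment> \<open>The value at \<open>y\<close> of the linear form with coefficients (1, s, ...,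
    s^n), as a polynomial in s.\<close>
  define vp :: "(nat \<Rightarrow> 'k) \<Rightarrow> 'k poly" where "vp y = (\<Sum>i\<le>n. monom (y i) i)" for y
  have vp: "poly (vp y) s = (\<Sum>i\<le>n. s ^ i * y i)" for y s
    by (simp add: vp_def poly_sum poly_monom mult.commute)
  have vp0: "finite {s. poly (vp y) s = 0}" if "i \<le> n" "y i \<noteq> 0" for y i
  proof -
    have "coeff (vp y) i = y i" using that(1) by (simp add: vp_def coeff_sum)
    then have "vp y \<noteq> 0" using that(2) by auto
    then show ?thesis by (rule poly_roots_finite)
  qed
  define Z where "Z = {t. poly (fp i0) t = 0}"
  have "fp i0 \<noteq> 0" using i0(2) by auto
  then have Z: "finite Z" unfolding Z_def by (rule poly_roots_finite)
  let ?S = "{s. poly (vp (\<lambda>i. coeff (fp i) d)) s = 0} \<union> (\<Union>t\<in>Z. {s. poly (vp (\<lambda>i. poly (fp i) t)) s = 0})"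
  have "finite {s. poly (vp (\<lambda>i. poly (fp i) t)) s = 0}" for t
  proof -
    obtain i where "i \<le> n" "poly (fp i) t \<noteq> 0" using bc unfolding binary_coords_def by blast
    then show ?thesis using vp0[of i "\<lambda>i. poly (fp i) t"] by simp
  qed
  then have "finite ?S" using Z vp0[OF i0(1), of "\<lambda>i. coeff (fp i) d"] i0(2) by simp
  then obtain s where s: "s \<notin> ?S" using ex_new_if_finite[OF infinite_alg_closed_field] by blast
  show ?thesis
  proof (rule that[of i0 l0 "\<lambda>i. s ^ i"])
    show "coeff (lin_poly (\<lambda>i. s ^ i)) d \<noteq> 0"
      using s vp[of "\<lambda>i. coeff (fp i) d" s] by (simp add: lin_poly_def coeff_sum)
    fix t assume "poly (lin_poly l0) t = 0"
    then have "t \<in> Z" unfolding lp0 Z_def by simp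
    then have "poly (vp (\<lambda>i. poly (fp i) t)) s \<noteq> 0" using s by blast
    then show "poly (lin_poly (\<lambda>i. s ^ i)) t \<noteq> 0" unfolding vp by (simp add: lin_poly_def poly_sum)
  qed (use i0 l0 lp0 in simp_all)
qed

text \<open>As the chart contains infinity, \<open>lin_poly l\<close> has exact degree d, and the
  lift has degree (q + 1) d - 1 - q d = d - 1.\<close>

lemma rat_chart_lift:
  assumes F: "degree F \<le> (q + 1) * d - 1" and l: "coeff (lin_poly l) d \<noteq> 0"
  shows "rat {t. proj_pt (pt t) \<notin> chart l} (int d - 1) (\<lambda>t. chart_lift (hom ((q + 1) * d - 1) F) l (pt t) i)"
proof -
  let ?a = "lin_poly l" and ?Z = "{t. proj_pt (pt t) \<notin> chart l}"
  let ?c = "if i \<le> n then l i ^ q else 0"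
  have a: "degree ?a = d" using degree_lin_poly[of l] le_degree[OF l] by simp
  have anz: "?a \<noteq> 0" using l by auto
  have "rat ?Z (int ((q + 1) * d - 1) + (- int (degree (?a ^ q)))) (\<lambda>t. poly (smult ?c F) t * inverse (poly (?a ^ q) t))"
  proof (rule rat_mult[OF rat_poly rat_inverse])
    show "int (degree (smult ?c F)) \<le> int ((q + 1) * d - 1)"
      using F degree_smult_le[of ?c F] by simp
  qed (use anz in \<open>auto simp: pt_in_chart poly_power\<close>)
  moreover have "int ((q + 1) * d - 1) + (- int (degree (?a ^ q))) = int d - 1"
  proof -
    have "degree (?a ^ q) = q * d" using anz a by (simp add: degree_power_eq)
    moreover have "(q + 1) * d = q * d + d" by simp
    ultimately show ?thesis using d1 by (simp add: of_nat_diff)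
  qed
  ultimately have r: "rat ?Z (int d - 1) (\<lambda>t. poly (smult ?c F) t * inverse (poly (?a ^ q) t))" by simp
  show ?thesis
  proof (rule rat_cong[OF r])
    fix t
    show "poly (smult ?c F) t * inverse (poly (?a ^ q) t) = chart_lift (hom ((q + 1) * d - 1) F) l (pt t) i"
      unfolding chart_lift_def lin_Fv hom_pt[OF degree_lin_poly] hom_pt[OF F]
      by (simp add: poly_power divide_inverse)
  qed
qed

text \<open>The value of the derivation on T_i / l is a section of O(-1). Multiplied by l(f), of
  degree d, it becomes the i-th component of a lift of the derivation to the cone, a section of O(d
  - 1).\<close>

lemma rat_derivation:
  assumes D: "tangent_section n X \<phi> (- 1) (chart l) D" and l: "coeff (lin_poly l) d \<noteq> 0" and i: "i \<le> n"
  shows "rat {t. proj_pt (pt t) \<notin> chart l} (int d - 1)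
    (\<lambda>t. lin n l (Fv (pt t)) * D (lin_nonzero n X l) (coord_fun n l i) (pt t))"
proof -
  let ?W = "lin_nonzero n X l"
  have "regular n X ?W (coord_fun n l i)"
    by (rule regular_coord_fun[OF i X_proj zopen_lin_nonzero]) simp
  then have "twist_section 1 P1 (- 1) (chart l \<inter> preimage \<phi> ?W) (D ?W (coord_fun n l i))"
    using conjunct1[OF D[unfolded tangent_section_def]] zopen_lin_nonzero by blast
  moreover have "chart l \<inter> preimage \<phi> ?W = chart l" using chart_preimage by blast
  ultimately have "twist_section 1 P1 (- 1) (chart l) (D ?W (coord_fun n l i))" by simp
  then have "rat {t. proj_pt (pt t) \<notin> chart l} (- 1) (\<lambda>t. D ?W (coord_fun n l i) (pt t))"
    by (rule twist_section_rat[OF _ zopen_chart]) (use l pt_inf_in_chart in blast)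
  then have "rat {t. proj_pt (pt t) \<notin> chart l} (int d + (- 1))
      (\<lambda>t. poly (lin_poly l) t * D ?W (coord_fun n l i) (pt t))"
    by (intro rat_mult rat_poly) (simp_all add: degree_lin_poly)
  then show ?thesis by (simp add: lin_Fv hom_pt[OF degree_lin_poly])
qed

text \<open>This is the Euler sequence made explicit: the derivations b0, b1 are lifted to vectors
  u0, u1 on the cone, which is possible only up to multiples of f, and the resulting defect is
  removed by splitting a section of O(-1).\<close>

lemma free_lift:
  assumes free: "free_morphism n X \<phi>" and F: "degree F \<le> (q + 1) * d - 1"
  shows "\<exists>z. (\<forall>i\<le>n. degree (z i) \<le> d - 1) \<and> F = (\<Sum>i\<le>n. fp i ^ q * z i)"
proof -
  obtain i0 l0 l1 where l: "i0 \<le> n" "\<And>z. lin n l0 z = z i0"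
    "coeff (lin_poly l0) d \<noteq> 0" "coeff (lin_poly l1) d \<noteq> 0"
    "\<And>t. poly (lin_poly l0) t = 0 \<Longrightarrow> poly (lin_poly l1) t \<noteq> 0"
    by (rule good_charts) (rule that)
  define Z0 where "Z0 = {t. proj_pt (pt t) \<notin> chart l0}"
  define Z1 where "Z1 = {t. proj_pt (pt t) \<notin> chart l1}"
  have disj: "Z0 \<inter> Z1 = {}" unfolding Z0_def Z1_def pt_in_chart using l(5) by auto
  have lnz: "lin_poly l0 \<noteq> 0" "lin_poly l1 \<noteq> 0" using l(3,4) by auto
  have fin: "finite Z0" "finite Z1"
    unfolding Z0_def Z1_def pt_in_chart using poly_roots_finite[OF lnz(1)] poly_roots_finite[OF lnz(2)] by simp_all
  have cover: "chart l0 \<union> chart l1 = P1"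
  proof
    show "P1 \<subseteq> chart l0 \<union> chart l1"
    proof
      fix Q :: "(nat \<Rightarrow> 'k) set" assume "Q \<in> P1"
      then show "Q \<in> chart l0 \<union> chart l1"
      proof (rule P1_cases)
        fix t assume "Q = proj_pt (pt t)"
        then show ?thesis using l(5)[of t] pt_in_chart by blast
      next
        assume "Q = proj_pt pt_inf"
        then show ?thesis using l(3) pt_inf_in_chart by blast
      qed
    qed
  qed (auto simp: chart_def)
  \<comment> \<open>By positive degree \<open>chart l0\<close> omits a point, which then lies in
    \<open>chart l1\<close>; so the two charts are different.\<close>
  have "degree (lin_poly l0) > 0" using le_degree[OF l(3)] d1 by simp
  then obtain t0 where "poly (lin_poly l0) t0 = 0" using alg_closed_imp_poly_has_root by blast
  then have "proj_pt (pt t0) \<notin> chart l0" "proj_pt (pt t0) \<in> chart l1"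
    using l(5) unfolding pt_in_chart by blast+
  then have ne: "chart l0 \<noteq> chart l1" by blast
  define G where "G = hom ((q + 1) * d - 1) F"
  have G: "form 1 ((q + 1) * d - 1) G" unfolding G_def by (rule form_hom)
  obtain b0 b1 where b: "tangent_section n X \<phi> (- 1) (chart l0) b0" "tangent_section n X \<phi> (- 1) (chart l1) b1"
    "\<And>W f Q x. zopen n X W \<Longrightarrow> regular n X W f \<Longrightarrow> Q \<in> chart l0 \<inter> chart l1 \<inter> preimage \<phi> W \<Longrightarrow> x \<in> Q \<Longrightarrow>
       dfun n X f (Fv x) (lift_diff G l0 l1 x) = b1 W f x - b0 W f x"
    by (rule lift_diff_coboundary[OF free G cover ne], rule that)
  define W0 where "W0 = lin_nonzero n X l0"
  define W1 where "W1 = lin_nonzero n X l1"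
  define g0 g1 where "g0 i t = chart_lift G l0 (pt t) i" and "g1 i t = chart_lift G l1 (pt t) i" for i t
  \<comment> \<open>Since v(T_i / l) = v_i / l for a vector v with l(v) = 0, this is the lift of
    \<open>b0\<close> to the cone normalised by l0; likewise for \<open>u1\<close> and l1.\<close>
  define u0 where "u0 i t = lin n l0 (Fv (pt t)) * b0 W0 (coord_fun n l0 i) (pt t)" for i t
  define u1 where "u1 i t = lin n l1 (Fv (pt t)) * b1 W1 (coord_fun n l1 i) (pt t)" for i t
  have rg: "rat Z0 (int d - 1) (g0 i)" "rat Z1 (int d - 1) (g1 i)" for i
    unfolding g0_def[abs_def] g1_def[abs_def] Z0_def Z1_def G_def
    by (rule rat_chart_lift[OF F l(3)], rule rat_chart_lift[OF F l(4)])
  have ru: "rat Z0 (int d - 1) (u0 i)" "rat Z1 (int d - 1) (u1 i)" if "i \<le> n" for i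
    unfolding u0_def[abs_def] u1_def[abs_def] Z0_def Z1_def W0_def W1_def
    by (rule rat_derivation[OF b(1) l(3) that], rule rat_derivation[OF b(2) l(4) that])
  \<comment> \<open>The multiple of f by which the corrected lifts differ on the overlap. It is read
    off at the index i0, where T_i / l0 is the constant 1 and \<open>u0\<close> vanishes.\<close>
  define \<mu> where "\<mu> t = (g1 i0 t - g0 i0 t - u1 i0 t) * inverse (poly (lin_poly l0) t)" for t
  have lin0: "poly (lin_poly l0) t = poly (fp i0) t" for t
    using l(2)[of "Fv (pt t)"] unfolding lin_Fv hom_pt[OF degree_lin_poly] Fv_pt .
  have rel: "g1 i t - u1 i t - poly (fp i) t * \<mu> t = g0 i t - u0 i t" if t: "t \<notin> Z0 \<union> Z1" and i: "i \<le> n" for i t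
  proof -
    define x where "x = pt t"
    have R: "proj_pt x \<in> chart l0" "proj_pt x \<in> chart l1" "x \<in> proj_pt x"
      using t proj_pt_refl unfolding Z0_def Z1_def x_def by auto
    define v where "v = lift_diff G l0 l1 x"
    define a where "a = Fv x i0"
    define c where "c = lin n l1 (Fv x)"
    have a: "a \<noteq> 0" "c \<noteq> 0"
      using chart_nonzero[OF R(1,3)] chart_nonzero[OF R(2,3)] unfolding a_def c_def l(2) by simp_all
    have 1: "dfun n X (coord_fun n l0 i) (Fv x) v = b1 W0 (coord_fun n l0 i) x - b0 W0 (coord_fun n l0 i) x"
      unfolding v_def
    proof (rule b(3)[OF _ _ _ R(3)])
      show "zopen n X W0" unfolding W0_def by (rule zopen_lin_nonzero)
      show "regular n X W0 (coord_fun n l0 i)"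
        unfolding W0_def by (rule regular_coord_fun[OF i X_proj zopen_lin_nonzero]) simp
      show "proj_pt x \<in> chart l0 \<inter> chart l1 \<inter> preimage \<phi> W0"
        unfolding W0_def using R chart_preimage by blast
    qed
    have 2: "dfun n X (coord_fun n l0 i) (Fv x) v = (v i * a - Fv x i * v i0) / a\<^sup>2"
      unfolding a_def v_def
      by (rule dfun_coord_fun[OF R(1,3) cone_tangent_lift_diff[OF R] l(2,1) i])
    have 3: "b1 W1 (coord_fun n l1 i) x =
        Fv x i / a * b1 W1 (coord_fun n l1 i0) x + a / c * b1 W0 (coord_fun n l0 i) x"
      unfolding a_def c_def W0_def W1_def
      by (rule derivation_change_chart[OF b(2) R l(2,1) i])
    \<comment> \<open>Facts 1 and 2 multiplied by \<open>a\<close>, and fact 3 multiplied by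
      \<open>c\<close>, share the term a times the value of \<open>b1\<close> on T_i / l0. It
      cancels in the difference, leaving a multiple of \<open>Fv x i\<close>.\<close>
    have "a * dfun n X (coord_fun n l0 i) (Fv x) v = v i - Fv x i * v i0 / a"
      unfolding 2 using a(1) by (simp add: power2_eq_square field_simps)
    then have "v i - Fv x i * v i0 / a = a * b1 W0 (coord_fun n l0 i) x - a * b0 W0 (coord_fun n l0 i) x"
      unfolding 1 right_diff_distrib by (rule sym)
    then have "v i = a * b1 W0 (coord_fun n l0 i) x - a * b0 W0 (coord_fun n l0 i) x + Fv x i * v i0 / a"
      unfolding diff_eq_eq .
    moreover have "c * b1 W1 (coord_fun n l1 i) x =
        Fv x i * (c * b1 W1 (coord_fun n l1 i0) x) / a + a * b1 W0 (coord_fun n l0 i) x"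
      unfolding 3 using a(2) by (simp add: distrib_left)
    ultimately have key: "v i - c * b1 W1 (coord_fun n l1 i) x + a * b0 W0 (coord_fun n l0 i) x =
        Fv x i * ((v i0 - c * b1 W1 (coord_fun n l1 i0) x) / a)"
      by (simp add: right_diff_distrib diff_divide_distrib)
    have v: "v j = g1 j t - g0 j t" for j unfolding v_def lift_diff_def g0_def g1_def x_def ..
    have u: "u1 j t = c * b1 W1 (coord_fun n l1 j) x" "u0 j t = a * b0 W0 (coord_fun n l0 j) x" for j
      unfolding u1_def u0_def c_def a_def x_def l(2) by simp_all
    have a': "a = poly (lin_poly l0) t" unfolding a_def x_def Fv_pt lin0 ..
    have F: "Fv x i = poly (fp i) t" unfolding x_def Fv_pt ..
    have "g1 i t - g0 i t - u1 i t + u0 i t = poly (fp i) t * \<mu> t"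
      using key unfolding u[symmetric] v F \<mu>_def divide_inverse unfolding a' .
    then show ?thesis by (simp add: algebra_simps)
  qed
  \<comment> \<open>Sections of degree d - 1 are divided by l0(f), which has degree d and no zero on
    the overlap. The twist -1 is the one handled by \<open>rat_split\<close>.\<close>
  have "rat (Z0 \<union> Z1) (int d - 1 + (- int (degree (lin_poly l0)))) \<mu>"
    unfolding \<mu>_def[abs_def]
  proof (intro rat_mult rat_diff rat_inverse)
    show "rat (Z0 \<union> Z1) (int d - 1) (g1 i0)" "rat (Z0 \<union> Z1) (int d - 1) (g0 i0)" "rat (Z0 \<union> Z1) (int d - 1) (u1 i0)"
      by (rule rat_mono[OF rg(2)], simp, rule rat_mono[OF rg(1)], simp, rule rat_mono[OF ru(2)[OF l(1)]], simp)
    show "poly (lin_poly l0) t \<noteq> 0" if "t \<notin> Z0 \<union> Z1" for t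
      using that unfolding Z0_def pt_in_chart by blast
  qed (rule lnz(1))
  moreover have "degree (lin_poly l0) = d" using degree_lin_poly[of l0] le_degree[OF l(3)] by simp
  ultimately have "rat (Z0 \<union> Z1) (- 1) \<mu>" by simp
  then obtain s0 s1 where s: "rat Z0 (- 1) s0" "rat Z1 (- 1) s1" "\<And>t. t \<notin> Z0 \<union> Z1 \<Longrightarrow> \<mu> t = s1 t - s0 t"
    by (rule rat_split) (rule that)
  have "\<exists>p. degree p \<le> d - 1 \<and> (\<forall>t. t \<notin> Z0 \<longrightarrow> g0 i t - u0 i t - poly (fp i) t * s0 t = poly p t)"
    if i: "i \<le> n" for i
  proof -
    have rf: "rat Z (int d - 1) (\<lambda>t. poly (fp i) t * s t)" if "rat Z (- 1) s" for Z s
      using rat_mult[OF rat_poly[of "fp i" "int d" Z] that] deg_fp by simp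
    have 0: "rat Z0 (int d - 1) (\<lambda>t. g0 i t - u0 i t - poly (fp i) t * s0 t)"
      by (intro rat_diff rg ru rf s i)
    have 1: "rat Z1 (int d - 1) (\<lambda>t. g1 i t - u1 i t - poly (fp i) t * s1 t)"
      by (intro rat_diff rg ru rf s i)
    have eq: "g0 i t - u0 i t - poly (fp i) t * s0 t = g1 i t - u1 i t - poly (fp i) t * s1 t"
      if "t \<notin> Z0 \<union> Z1" for t
      using rel[OF that i] s(3)[OF that] by (simp add: algebra_simps)
    obtain p where p: "p \<noteq> 0 \<Longrightarrow> int (degree p) \<le> int d - 1"
      "\<And>t. t \<notin> Z0 \<Longrightarrow> g0 i t - u0 i t - poly (fp i) t * s0 t = poly p t"
      using rat_glue[OF 0 1 disj fin eq] by metis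
    have "degree p \<le> d - 1" using p(1) d1 by (cases "p = 0") auto
    then show ?thesis using p(2) by blast
  qed
  then obtain z where z: "\<And>i. i \<le> n \<Longrightarrow> degree (z i) \<le> d - 1"
    "\<And>i t. i \<le> n \<Longrightarrow> t \<notin> Z0 \<Longrightarrow> g0 i t - u0 i t - poly (fp i) t * s0 t = poly (z i) t" by metis
  \<comment> \<open>Off \<open>Z0\<close> the lift g0 contributes F, the correction u0 contributes 0
    by \<open>derivation_tangency\<close>, and the multiple of f contributes 0 by the equation of
    X.\<close>
  have "F = (\<Sum>i\<le>n. fp i ^ q * z i)"
  proof (rule poly_eqI_cofinite[OF fin(1)])
    fix t assume t: "t \<notin> Z0"
    then have R: "proj_pt (pt t) \<in> chart l0" unfolding Z0_def by simp
    have "(\<Sum>i\<le>n. Fv (pt t) i ^ q * g0 i t) = poly F t"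
      unfolding g0_def sum_chart_lift[OF chart_nonzero[OF R proj_pt_refl]] G_def by (rule hom_pt[OF F])
    moreover have "(\<Sum>i\<le>n. Fv (pt t) i ^ q * u0 i t) = 0"
    proof -
      have "(\<Sum>i\<le>n. Fv (pt t) i ^ q * u0 i t) =
          lin n l0 (Fv (pt t)) * (\<Sum>i\<le>n. Fv (pt t) i ^ q * b0 W0 (coord_fun n l0 i) (pt t))"
        unfolding u0_def sum_distrib_left by (intro sum.cong) simp_all
      then show ?thesis unfolding W0_def derivation_tangency[OF b(1) R proj_pt_refl] by simp
    qed
    moreover have "(\<Sum>i\<le>n. Fv (pt t) i ^ q * (poly (fp i) t * s0 t)) = 0"
    proof -
      have "(\<Sum>i\<le>n. Fv (pt t) i ^ q * (poly (fp i) t * s0 t)) = (\<Sum>i\<le>n. Fv (pt t) i ^ (q + 1)) * s0 t"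
        unfolding sum_distrib_right by (intro sum.cong) (simp_all add: Fv_pt)
      then show ?thesis using Fv_fermat[OF bin_vec_pt(1)] by simp
    qed
    ultimately have "poly F t = (\<Sum>i\<le>n. Fv (pt t) i ^ q * (g0 i t - u0 i t - poly (fp i) t * s0 t))"
      by (simp add: right_diff_distrib sum_subtractf)
    also have "\<dots> = poly (\<Sum>i\<le>n. fp i ^ q * z i) t"
      unfolding poly_sum by (intro sum.cong) (simp_all add: z(2)[OF _ t] Fv_pt poly_power)
    finally show "poly F t = poly (\<Sum>i\<le>n. fp i ^ q * z i) t" .
  qed
  then show ?thesis using z(1) by blast
qed

end

end

theorem mainTheorem3:
  fixes p \<nu> q e :: nat
    and \<phi> :: "(nat \<Rightarrow> 'k::alg_closed_field) set \<Rightarrow> (nat \<Rightarrow> 'k) set"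
  assumes "CHAR('k) = p" and "p > 0"
    and "\<nu> \<ge> 1" and "q = p ^ \<nu>"
    and "is_morphism (q + 1) (fermat (q + 1) (q + 1)) \<phi>"
    and "\<not> (\<exists>P. \<forall>Q\<in>P1. \<phi> Q = P)"
    and "has_degree (q + 1) \<phi> e"
    and "free_morphism (q + 1) (fermat (q + 1) (q + 1)) \<phi>"
  shows "real e \<ge> real q powr (3 / 2) - real q"
proof -
  interpret char_power q \<nu> "TYPE('k)"
    by standard (use assms(1-4) in auto)
  obtain d fp where bc: "binary_coords (q + 1) d fp"
    and \<phi>: "\<And>x. bin_vec x \<Longrightarrow> \<phi> (proj_pt x) = proj_pt (hom_vec d fp x)"
    using morphism_binary_coords[OF assms(5) fermat_proj_space] by blast
  have "d \<ge> 1"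
  proof (rule ccontr)
    assume "\<not> d \<ge> 1"
    then have "d = 0" by simp
    \<comment> \<open>Binary forms of degree 0 are constants, so \<open>\<phi>\<close> would be
      constant.\<close>
    then have "hom_vec d fp x = hom_vec d fp pt_inf" for x by (simp add: hom_vec_def hom_def)
    then have "\<phi> Q = proj_pt (hom_vec d fp pt_inf)" if "Q \<in> P1" for Q
      using that \<phi> std_pts_bin_vec unfolding P1_std_pts by (metis imageE)
    then show False using assms(6) by blast
  qed
  have "e = d" by (rule has_degree_eq[OF bc \<phi> assms(7)])
  moreover have "d = q * (d div q) + d mod q" "d mod q < q" using q_ge_2 by auto
  ultimately show ?thesis
    using degree_bound[OF refl \<open>d \<ge> 1\<close> _ _ deg_fp[OF bc \<phi> assms(5) \<open>d \<ge> 1\<close>]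
        fp_fermat[OF bc \<phi> assms(5) \<open>d \<ge> 1\<close>] free_lift[OF bc \<phi> assms(5) \<open>d \<ge> 1\<close> assms(8)]]
    by blast
qed

end
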